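(* Let $(W,S)$ be a Coxeter system with a fixed reflection order $\mathcal{O}$, let $u<v$ in the Bruhat order, let $n\ge 0$, and let $t$ be a reflection. Then the $AD$-polynomial \[ \widetilde{\phi}^{\leq t}_{u,v}=\sum_{x\in B_n(u,v)_{\leq t}} w(x)\] can be expressed in the form $f_n(\mathbf{c},\mathbf{d})+A\,g_{n-1}(\mathbf{c},\mathbf{d})$ for some homogeneous $\mathbf{c}\mathbf{d}$-polynomials $f_n,g_{n-1}$ of degree $n$ and $n-1$ respectively. Moreover, let $F$ be a flip compatible with $\mathcal{O}$ and let $M$ be a $\mathbf{c}\mathbf{d}$-monomial of degree $n$; if the flip condition holds for the interval $[u,v]$ and monomial $M$, then $|\overline{T}_M(u,v)_{\leq t}|$ is the coefficient of $M$ in $f_n$ and $|T_M(u,v)_{\leq t}|$ is the coefficient of $M$ in $f_n+\mathbf{c}\,g_{n-1}$.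
   Context: $(W,S)$ is a Coxeter system, $T$ its set of reflections, $l$ the length function. A reflection order $\mathcal{O}$ is a total order on $T$ such that for every dihedral reflection subgroup with canonical generators $a,b$, its reflections occur in the order $a,aba,ababa,\dots,bab,b$ or the reverse; the reverse $\overline{\mathcal{O}}$ is also a reflection order. Write $u\prec v$ if $l(u)<l(v)$ and $u^{-1}v\in T$. A path of length $n$ from $u$ to $v$ is $x=(u=x_0\prec x_1\prec\cdots\prec x_n\prec x_{n+1}=v)$; $B_n(u,v)$ is the set of such paths, $B(u,v)=\bigcup_nB_n(u,v)$. With $t_i=x_i^{-1}x_{i+1}$, the ascent-descent sequence is $w(x)=\beta_1\cdots\beta_n$ in non-commuting variables $A,D$, $\beta_i=A$ if $t_{i-1}<t_i$ in $\mathcal{O}$, $\beta_i=D$ otherwise. $\mathbf{c}=A+D$, $\mathbf{d}=AD+DA$ are elements of $\mathbb{Z}\langle A,D\rangle$, graded with $\deg A=\deg D=\deg\mathbf{c}=1$, $\deg\mathbf{d}=2$. For an $AD$-word $f$, $\overline f$ swaps $A$ and $D$. $B_n(u,v)_{\le t}=\{x\in B_n(u,v): u^{-1}x_1\le t\text{ in }\mathcal{O}\}$. A flip is a choice for all $u<v$ of an involution $F_{u,v}$ of $B(u,v)$ with $w(F_{u,v}(x))=\overline{w(x)}$. For $x\in B_n(u,v)$ with $w(x)=\beta_1\cdots\beta_n$ and $1\le m\le n$, replace the tail $(x_m\prec\cdots\prec x_n\prec v)$ by $F_{x_m,v}$ of it, obtaining $(u\prec x_1\prec\cdots\prec x_m\prec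 y_{m+1}\prec\cdots\prec y_n\prec v)$ whose $m$-th ascent-descent letter is $\alpha_m$. Define $s_{m,A}(x)=1$ if $\beta_m=A$, else $0$; $s_{m,D}(x)=1$ if $\beta_m=D,\alpha_m=A$, $-1$ if $\beta_m=A,\alpha_m=D$, else $0$. For a $\mathbf{c}\mathbf{d}$-monomial $M$ of degree $n$, let $\gamma_1\cdots\gamma_n=M(A,DA)$ (substitute $\mathbf{c}\mapsto A$, $\mathbf{d}\mapsto DA$) and $s_M(x)=\prod_m s_{m,\gamma_m}(x)$; $\overline{s}_M$ is the same computed with $\overline{\mathcal{O}}$ in place of $\mathcal{O}$ and the same $F$. $F$ is compatible with $\mathcal{O}$ if $s_M(x)=\overline{s}_M(F_{u,v}(x))$ for all $u<v$, all $M$, all $x\in B_n(u,v)$. $T_M(u,v)=\{x\in B_n(u,v): s_{m,\gamma_m}(x)=1\text{ for all }m\}$, and $\overline{T}_M(u,v)$ is the same set constructed using $\overline{\mathcal{O}}$ (and the same $F$). $T_M(u,v)_{\le t}=T_M(u,v)\cap B_n(u,v)_{\le t}$ and $\overline{T}_M(u,v)_{\le t}=\overline{T}_M(u,v)\cap B_n(u,v)_{\le t}$, where in both cases $\le t$ refers to the order $\mathcal{O}$. The flip condition holds for $[u,v]$ and $M$ if for every $x\in B_n(u,v)$: whenever $s_{m,\gamma_m}(x)=-1$ for some $m$, there is $l>m$ with $s_{l,\gamma_l}(x)=0$. *)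

theory Defs
  imports
    "HOL-Algebra.Multiplicative_Group"
    "HOL-Algebra.Generated_Groups"
    "HOL-Library.Poly_Mapping"
begin

section \<open>Noncommutative polynomials\<close>

text \<open>
  Words form a monoid under concatenation. It is written additively because
  \<open>Poly_Mapping\<close> obtains the product of \<open>'k \<Rightarrow>\<^sub>0 int\<close> from the addition of \<open>'k\<close>; hence
  \<open>'x list \<Rightarrow>\<^sub>0 int\<close> is the free associative ring on \<open>'x\<close>.
\<close>

instantiation list :: (type) monoid_add
begin

definition zero_list :: "'a list" where
  "zero_list = []"

definition plus_list :: "'a list \<Rightarrow> 'a list \<Rightarrow> 'a list" where
  "plus_list xs ys = xs @ ys"

instance
  by standard (simp_all add: zero_list_def plus_list_def)

end

type_synonym 'x ncpoly = "'x list \<Rightarrow>\<^sub>0 int"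

definition nc_monom :: "'x list \<Rightarrow> 'x ncpoly" where
  "nc_monom w = Poly_Mapping.single w 1"

definition nc_subst :: "('x \<Rightarrow> 'y ncpoly) \<Rightarrow> 'x ncpoly \<Rightarrow> 'y ncpoly" where
  "nc_subst \<sigma> p =
     (\<Sum>w\<in>Poly_Mapping.keys p. of_int (Poly_Mapping.lookup p w) * prod_list (map \<sigma> w))"

datatype ad = Asc | Des

fun swap_ad :: "ad \<Rightarrow> ad" where
  "swap_ad Asc = Des"
| "swap_ad Des = Asc"

text \<open>\<open>VarC\<close> and \<open>VarD\<close> are formal letters standing for \<open>\<^bold>c\<close> and \<open>\<^bold>d\<close>.\<close>

datatype cd = VarC | VarD

fun cd_value :: "cd \<Rightarrow> ad ncpoly" where
  "cd_value VarC = nc_monom [Asc] + nc_monom [Des]"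
| "cd_value VarD = nc_monom [Asc, Des] + nc_monom [Des, Asc]"

fun cd_letter_degree :: "cd \<Rightarrow> nat" where
  "cd_letter_degree VarC = 1"
| "cd_letter_degree VarD = 2"

definition cd_degree :: "cd list \<Rightarrow> nat" where
  "cd_degree M = sum_list (map cd_letter_degree M)"

text \<open>
  The degree is an integer, so that \<open>0\<close> is the only polynomial of degree \<open>- 1\<close>.
\<close>

definition cd_homogeneous :: "int \<Rightarrow> cd ncpoly \<Rightarrow> bool" where
  "cd_homogeneous k f \<longleftrightarrow> (\<forall>M\<in>Poly_Mapping.keys f. int (cd_degree M) = k)"

text \<open>The word \<open>M(A, DA)\<close>.\<close>

fun cd_letter_pattern :: "cd \<Rightarrow> ad list" where
  "cd_letter_pattern VarC = [Asc]"
| "cd_letter_pattern VarD = [Des, Asc]"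

definition cd_pattern :: "cd list \<Rightarrow> ad list" where
  "cd_pattern M = concat (map cd_letter_pattern M)"


section \<open>Coxeter systems\<close>

definition word_prod :: "('a, 'b) monoid_scheme \<Rightarrow> 'a list \<Rightarrow> 'a" where
  "word_prod G ss = foldr (\<lambda>x y. x \<otimes>\<^bsub>G\<^esub> y) ss \<one>\<^bsub>G\<^esub>"

text \<open>
  The congruence on words over \<open>S\<close> generated by \<open>(s s')\<^sup>m = 1\<close>, where \<open>m\<close> is the order of
  \<open>s s'\<close>. The library order is \<open>0\<close> for elements of infinite order, which give no relation.
  The case \<open>s = s'\<close> gives \<open>s s = 1\<close>, so no formal inverses are needed.
\<close>

inductive cox_equiv :: "('a, 'b) monoid_scheme \<Rightarrow> 'a set \<Rightarrow> 'a list \<Rightarrow> 'a list \<Rightarrow> bool"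
  for G S where
  refl: "cox_equiv G S xs xs"
| sym: "cox_equiv G S xs ys \<Longrightarrow> cox_equiv G S ys xs"
| trans: "cox_equiv G S xs ys \<Longrightarrow> cox_equiv G S ys zs \<Longrightarrow> cox_equiv G S xs zs"
| relation: "s \<in> S \<Longrightarrow> s' \<in> S \<Longrightarrow> group.ord G (s \<otimes>\<^bsub>G\<^esub> s') \<noteq> 0 \<Longrightarrow>
    cox_equiv G S (xs @ concat (replicate (group.ord G (s \<otimes>\<^bsub>G\<^esub> s')) [s, s']) @ ys) (xs @ ys)"

text \<open>
  \<open>G\<close> is generated by the set \<open>S\<close> of elements of order 2, and the relations
  \<open>(s s')\<^sup>m = 1\<close> (with \<open>s\<close>, \<open>s'\<close> in \<open>S\<close>) present \<open>G\<close>.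
\<close>

definition coxeter_system :: "('a, 'b) monoid_scheme \<Rightarrow> 'a set \<Rightarrow> bool" where
  "coxeter_system G S \<longleftrightarrow>
     group G \<and> S \<subseteq> carrier G \<and> generate G S = carrier G \<and>
     (\<forall>s\<in>S. group.ord G s = 2) \<and>
     (\<forall>xs ys. set xs \<subseteq> S \<longrightarrow> set ys \<subseteq> S \<longrightarrow>
        (word_prod G xs = word_prod G ys \<longleftrightarrow> cox_equiv G S xs ys))"

definition cox_length :: "('a, 'b) monoid_scheme \<Rightarrow> 'a set \<Rightarrow> 'a \<Rightarrow> nat" where
  "cox_length G S w = (LEAST k. \<exists>ss. set ss \<subseteq> S \<and> length ss = k \<and> word_prod G ss = w)"

definition reflections :: "('a, 'b) monoid_scheme \<Rightarrow> 'a set \<Rightarrow> 'a set" where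
  "reflections G S = {w \<otimes>\<^bsub>G\<^esub> s \<otimes>\<^bsub>G\<^esub> inv\<^bsub>G\<^esub> w | w s. w \<in> carrier G \<and> s \<in> S}"

text \<open>The relation \<open>u \<prec> v\<close>; the strict Bruhat order is its transitive closure.\<close>

definition bruhat_edge :: "('a, 'b) monoid_scheme \<Rightarrow> 'a set \<Rightarrow> 'a \<Rightarrow> 'a \<Rightarrow> bool" where
  "bruhat_edge G S u v \<longleftrightarrow> u \<in> carrier G \<and> v \<in> carrier G \<and>
     cox_length G S u < cox_length G S v \<and> inv\<^bsub>G\<^esub> u \<otimes>\<^bsub>G\<^esub> v \<in> reflections G S"

definition bruhat_less :: "('a, 'b) monoid_scheme \<Rightarrow> 'a set \<Rightarrow> 'a \<Rightarrow> 'a \<Rightarrow> bool" where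
  "bruhat_less G S = (bruhat_edge G S)\<^sup>+\<^sup>+"


section \<open>Reflection orders\<close>

definition dihedral_reflection_subgroup :: "('a, 'b) monoid_scheme \<Rightarrow> 'a set \<Rightarrow> 'a set \<Rightarrow> bool" where
  "dihedral_reflection_subgroup G S H \<longleftrightarrow>
     (\<exists>p\<in>reflections G S. \<exists>q\<in>reflections G S. p \<noteq> q \<and> H = generate G {p, q})"

text \<open>
  Dyer's canonical generators of a reflection subgroup \<open>H\<close>: the reflections \<open>a\<close> with
  \<open>N(a) \<inter> H = {a}\<close>, where \<open>N(w)\<close> is the set of reflections \<open>r\<close> with \<open>l(r w) < l(w)\<close>.
\<close>

definition canonical_generators :: "('a, 'b) monoid_scheme \<Rightarrow> 'a set \<Rightarrow> 'a set \<Rightarrow> 'a set" where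
  "canonical_generators G S H =
     {a \<in> reflections G S.
        {r \<in> reflections G S. cox_length G S (r \<otimes>\<^bsub>G\<^esub> a) < cox_length G S a} \<inter> H = {a}}"

definition strictly_below :: "'a rel \<Rightarrow> 'a \<Rightarrow> 'a \<Rightarrow> bool" where
  "strictly_below \<O> p q \<longleftrightarrow> (p, q) \<in> \<O> \<and> p \<noteq> q"

text \<open>
  The sequence \<open>a, aba, ababa, \<dots>, bab, b\<close> is increasing. With \<open>m\<close> the order of \<open>ab\<close>, for
  \<open>m\<close> finite the sequence is \<open>(ab)\<^sup>k a\<close> for \<open>k < m\<close>, whose last term \<open>k = m - 1\<close> is \<open>b\<close>. For \<open>m\<close>
  infinite it has an increasing part \<open>(ab)\<^sup>k a\<close> followed by a part \<open>(ba)\<^sup>k b\<close> running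
  downwards in \<open>k\<close> to \<open>b\<close>.
\<close>

definition dihedral_increasing :: "('a, 'b) monoid_scheme \<Rightarrow> 'a rel \<Rightarrow> 'a \<Rightarrow> 'a \<Rightarrow> bool" where
  "dihedral_increasing G \<O> a b \<longleftrightarrow>
     (let m = group.ord G (a \<otimes>\<^bsub>G\<^esub> b);
          p = (\<lambda>k::nat. ((a \<otimes>\<^bsub>G\<^esub> b) [^]\<^bsub>G\<^esub> k) \<otimes>\<^bsub>G\<^esub> a);
          q = (\<lambda>k::nat. ((b \<otimes>\<^bsub>G\<^esub> a) [^]\<^bsub>G\<^esub> k) \<otimes>\<^bsub>G\<^esub> b)
      in if m \<noteq> 0 then (\<forall>i j. i < j \<and> j < m \<longrightarrow> strictly_below \<O> (p i) (p j))
         else (\<forall>i j. i < j \<longrightarrow> strictly_below \<O> (p i) (p j)) \<and>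
              (\<forall>i j. strictly_below \<O> (p i) (q j)) \<and>
              (\<forall>i j. i < j \<longrightarrow> strictly_below \<O> (q j) (q i)))"

definition reflection_order :: "('a, 'b) monoid_scheme \<Rightarrow> 'a set \<Rightarrow> 'a rel \<Rightarrow> bool" where
  "reflection_order G S \<O> \<longleftrightarrow>
     linear_order_on (reflections G S) \<O> \<and>
     (\<forall>H a b. dihedral_reflection_subgroup G S H \<and> a \<noteq> b \<and> canonical_generators G S H = {a, b}
        \<longrightarrow> dihedral_increasing G \<O> a b \<or> dihedral_increasing G (\<O>\<inverse>) a b)"


section \<open>Paths and ascent-descent sequences\<close>

text \<open>
  A path of length \<open>n\<close> is the list \<open>[x\<^sub>0, \<dots>, x\<^sub>n\<^sub>+\<^sub>1]\<close>, which has \<open>n + 2\<close> entries.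
\<close>

definition paths_n :: "('a, 'b) monoid_scheme \<Rightarrow> 'a set \<Rightarrow> nat \<Rightarrow> 'a \<Rightarrow> 'a \<Rightarrow> 'a list set" where
  "paths_n G S n u v =
     {x. length x = n + 2 \<and> x ! 0 = u \<and> x ! (n + 1) = v \<and>
         (\<forall>i\<le>n. bruhat_edge G S (x ! i) (x ! (i + 1)))}"

definition paths :: "('a, 'b) monoid_scheme \<Rightarrow> 'a set \<Rightarrow> 'a \<Rightarrow> 'a \<Rightarrow> 'a list set" where
  "paths G S u v = (\<Union>n. paths_n G S n u v)"

definition path_label :: "('a, 'b) monoid_scheme \<Rightarrow> 'a list \<Rightarrow> nat \<Rightarrow> 'a" where
  "path_label G x i = inv\<^bsub>G\<^esub> (x ! i) \<otimes>\<^bsub>G\<^esub> x ! (i + 1)"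

text \<open>\<open>\<beta>\<^sub>i\<close> for \<open>1 \<le> i \<le> n\<close>, where \<open>n\<close> is \<open>length x - 2\<close>.\<close>

definition ad_letter :: "('a, 'b) monoid_scheme \<Rightarrow> 'a rel \<Rightarrow> 'a list \<Rightarrow> nat \<Rightarrow> ad" where
  "ad_letter G \<O> x i =
     (if strictly_below \<O> (path_label G x (i - 1)) (path_label G x i) then Asc else Des)"

definition ad_word :: "('a, 'b) monoid_scheme \<Rightarrow> 'a rel \<Rightarrow> 'a list \<Rightarrow> ad list" where
  "ad_word G \<O> x = map (ad_letter G \<O> x) [1..<length x - 1]"

definition paths_n_upto ::
  "('a, 'b) monoid_scheme \<Rightarrow> 'a set \<Rightarrow> 'a rel \<Rightarrow> nat \<Rightarrow> 'a \<Rightarrow> 'a \<Rightarrow> 'a \<Rightarrow> 'a list set" where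
  "paths_n_upto G S \<O> n u v t = {x \<in> paths_n G S n u v. (inv\<^bsub>G\<^esub> u \<otimes>\<^bsub>G\<^esub> x ! 1, t) \<in> \<O>}"

definition phi_upto ::
  "('a, 'b) monoid_scheme \<Rightarrow> 'a set \<Rightarrow> 'a rel \<Rightarrow> nat \<Rightarrow> 'a \<Rightarrow> 'a \<Rightarrow> 'a \<Rightarrow> ad ncpoly" where
  "phi_upto G S \<O> n u v t = (\<Sum>x\<in>paths_n_upto G S \<O> n u v t. nc_monom (ad_word G \<O> x))"


section \<open>Flips\<close>

type_synonym 'a flip_family = "'a \<Rightarrow> 'a \<Rightarrow> 'a list \<Rightarrow> 'a list"

definition is_flip ::
  "('a, 'b) monoid_scheme \<Rightarrow> 'a set \<Rightarrow> 'a rel \<Rightarrow> 'a flip_family \<Rightarrow> bool" where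
  "is_flip G S \<O> F \<longleftrightarrow>
     (\<forall>u v. bruhat_less G S u v \<longrightarrow>
        (\<forall>x\<in>paths G S u v. F u v x \<in> paths G S u v \<and> F u v (F u v x) = x \<and>
           ad_word G \<O> (F u v x) = map swap_ad (ad_word G \<O> x)))"

definition flip_tail :: "'a flip_family \<Rightarrow> nat \<Rightarrow> 'a list \<Rightarrow> 'a list" where
  "flip_tail F m x = take m x @ F (x ! m) (last x) (drop m x)"

definition flip_sign ::
  "('a, 'b) monoid_scheme \<Rightarrow> 'a rel \<Rightarrow> 'a flip_family \<Rightarrow> nat \<Rightarrow> ad \<Rightarrow> 'a list \<Rightarrow> int" where
  "flip_sign G \<O> F m \<gamma> x =
     (let \<beta> = ad_letter G \<O> x m; \<alpha> = ad_letter G \<O> (flip_tail F m x) m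
      in case \<gamma> of
           Asc \<Rightarrow> if \<beta> = Asc then 1 else 0
         | Des \<Rightarrow> if \<beta> = Des \<and> \<alpha> = Asc then 1
                  else if \<beta> = Asc \<and> \<alpha> = Des then - 1 else 0)"

text \<open>The value \<open>s\<close> with indices \<open>m\<close> and \<open>\<gamma>\<^sub>m\<close>; the word \<open>\<gamma>\<close> is indexed from 1.\<close>

definition monom_sign_at ::
  "('a, 'b) monoid_scheme \<Rightarrow> 'a rel \<Rightarrow> 'a flip_family \<Rightarrow> cd list \<Rightarrow> nat \<Rightarrow> 'a list \<Rightarrow> int" where
  "monom_sign_at G \<O> F M m x = flip_sign G \<O> F m (cd_pattern M ! (m - 1)) x"

definition monom_sign ::
  "('a, 'b) monoid_scheme \<Rightarrow> 'a rel \<Rightarrow> 'a flip_family \<Rightarrow> cd list \<Rightarrow> 'a list \<Rightarrow> int" where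
  "monom_sign G \<O> F M x = (\<Prod>m = 1..cd_degree M. monom_sign_at G \<O> F M m x)"

definition compatible_flip ::
  "('a, 'b) monoid_scheme \<Rightarrow> 'a set \<Rightarrow> 'a rel \<Rightarrow> 'a flip_family \<Rightarrow> bool" where
  "compatible_flip G S \<O> F \<longleftrightarrow>
     (\<forall>u v M. bruhat_less G S u v \<longrightarrow>
        (\<forall>x\<in>paths_n G S (cd_degree M) u v.
           monom_sign G \<O> F M x = monom_sign G (\<O>\<inverse>) F M (F u v x)))"

definition T_set ::
  "('a, 'b) monoid_scheme \<Rightarrow> 'a set \<Rightarrow> 'a rel \<Rightarrow> 'a flip_family \<Rightarrow> cd list \<Rightarrow> 'a \<Rightarrow> 'a \<Rightarrow> 'a list set" where
  "T_set G S \<O> F M u v =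
     {x \<in> paths_n G S (cd_degree M) u v.
        \<forall>m\<in>{1..cd_degree M}. monom_sign_at G \<O> F M m x = 1}"

definition flip_condition ::
  "('a, 'b) monoid_scheme \<Rightarrow> 'a set \<Rightarrow> 'a rel \<Rightarrow> 'a flip_family \<Rightarrow> cd list \<Rightarrow> 'a \<Rightarrow> 'a \<Rightarrow> bool" where
  "flip_condition G S \<O> F M u v \<longleftrightarrow>
     (\<forall>x\<in>paths_n G S (cd_degree M) u v. \<forall>m\<in>{1..cd_degree M}.
        monom_sign_at G \<O> F M m x = - 1 \<longrightarrow>
        (\<exists>l\<in>{m<..cd_degree M}. monom_sign_at G \<O> F M l x = 0))"

end

theory Submission
  imports Defs
begin

text \<open>
  Remove the first edge \<open>u \<prec> y\<close>, with label \<open>t\<close>, from the paths counted by the truncated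
  polynomial. If the remaining paths with first label at most \<open>t\<close> contribute \<open>f + A g\<close> and all
  remaining paths contribute \<open>F\<close>, then the paths through this edge contribute
  \<open>(c f + d g) + A (F - 2 f - c g)\<close>, provided that \<open>F\<close> is a polynomial in \<open>c\<close> and \<open>d\<close>. The latter
  holds by induction, because the total polynomial is invariant under swapping \<open>A\<close> and \<open>D\<close>, and
  an invariant polynomial \<open>f + A g\<close> has \<open>g = 0\<close>. The signs \<open>s\<^sub>M\<close> summed over the truncated path
  sets satisfy the same recursion as the coefficients of \<open>M\<close>, and the flip condition makes all
  these signs \<open>0\<close> or \<open>1\<close>.

  The swap invariance reduces to Dyer's theorem that there are as many increasing as decreasing
  paths. A reflection order satisfies: \<open>l(tr) < l(t)\<close> iff \<open>t\<close> lies strictly between \<open>r\<close> and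
  \<open>trt\<close>. This condition says that the matrix of increasing paths intertwines two actions of a
  simple reflection on the span of \<open>W\<close>, which yields for the numbers of increasing paths the
  recursion of the \<open>R\<close>-polynomials, in which the order no longer occurs.
\<close>

section \<open>The reflection cocycle\<close>

text \<open>Why \<open>f\<close> and \<open>f + c g\<close> are treated together: for a monomial
  \<open>c M'\<close> the recursion takes the coefficient of \<open>M'\<close> in \<open>f\<close>,
  respectively in \<open>F - (f + c g)\<close>. For \<open>d M'\<close> both take the coefficient of
  \<open>M'\<close> in \<open>g\<close>, which is the coefficient of \<open>c M'\<close> in
  \<open>(f + c g) - f\<close>. So neither order can be handled alone: a letter d mixes the sums of
  signs for \<O> and for its reverse, and compatibility of the flip makes the signed sums mix in the
  same way. The flip condition speaks of \<O> only, so it has to be carried over to the reverse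
  order.

  In the comparison of increasing and decreasing paths the obstacle is that W and T may be infinite
  and a reflection order need not be a well-order. Hence only labels between elements of a finite
  set, closed under a simple reflection s and under predecessors, are kept. They are added one at a
  time, the largest label coming in at the start, beginning with the empty set, where the matrix is
  the identity. Once all of them are present, the twisted action is the one with the opposite length
  comparison.\<close>

locale coxeter = group G for G :: "('a, 'b) monoid_scheme" (structure) +
  fixes S :: "'a set"
  assumes coxeter: "coxeter_system G S"
begin

abbreviation "T \<equiv> reflections G S"
abbreviation "len \<equiv> cox_length G S"
abbreviation "wp \<equiv> word_prod G"

lemma mult_inv_cancel [simp]:
  assumes "x \<in> carrier G" "y \<in> carrier G"
  shows "x \<otimes> (inv x \<otimes> y) = y" "inv x \<otimes> (x \<otimes> y) = y"
  using assms by (simp_all flip: m_assoc)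

lemma conj_eq_iff:
  assumes "x \<in> carrier G" "t \<in> carrier G" "y \<in> carrier G"
  shows "inv x \<otimes> t \<otimes> x = y \<longleftrightarrow> t = x \<otimes> y \<otimes> inv x"
  using assms by (auto simp: m_assoc)

lemma S_carrier: "S \<subseteq> carrier G"
  using coxeter by (simp add: coxeter_system_def)

lemma S_carrierD [simp]: "s \<in> S \<Longrightarrow> s \<in> carrier G"
  using S_carrier by blast

lemma ord_S: "s \<in> S \<Longrightarrow> ord s = 2"
  using coxeter by (simp add: coxeter_system_def)

lemma S_square [simp]: "s \<in> S \<Longrightarrow> s \<otimes> s = \<one>"
  using pow_ord_eq_1[of s] by (simp add: ord_S numeral_2_eq_2)

lemma S_inv [simp]: "s \<in> S \<Longrightarrow> inv s = s"
  by (simp add: inv_equality)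

lemma S_square_assoc [simp]: "s \<in> S \<Longrightarrow> x \<in> carrier G \<Longrightarrow> s \<otimes> (s \<otimes> x) = x"
  by (simp flip: m_assoc)

lemma wp_Nil [simp]: "wp [] = \<one>"
  and wp_Cons [simp]: "wp (s # ss) = s \<otimes> wp ss"
  by (simp_all add: word_prod_def)

lemma wp_closed [simp]: "set ss \<subseteq> carrier G \<Longrightarrow> wp ss \<in> carrier G"
  by (induction ss) auto

lemma wp_closed_S [simp]: "set ss \<subseteq> S \<Longrightarrow> wp ss \<in> carrier G"
  using S_carrier by (intro wp_closed) blast

lemma wp_append [simp]:
  "set xs \<subseteq> S \<Longrightarrow> set ys \<subseteq> S \<Longrightarrow> wp (xs @ ys) = wp xs \<otimes> wp ys"
  by (induction xs) (auto simp: m_assoc)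

lemma wp_rev: "set xs \<subseteq> S \<Longrightarrow> wp (rev xs) = inv (wp xs)"
  by (induction xs) (auto simp: inv_mult_group)

lemma exists_word:
  assumes "w \<in> carrier G"
  shows "\<exists>ss. set ss \<subseteq> S \<and> wp ss = w"
proof -
  have "w \<in> generate G S"
    using assms coxeter by (simp add: coxeter_system_def)
  then show ?thesis
  proof induction
    case one
    then show ?case by (intro exI[of _ "[]"]) simp
  next
    case (incl h)
    then show ?case by (intro exI[of _ "[h]"]) simp
  next
    case (inv h)
    then show ?case by (intro exI[of _ "[h]"]) simp
  next
    case (eng h1 h2)
    then obtain xs ys where "set xs \<subseteq> S" "wp xs = h1" "set ys \<subseteq> S" "wp ys = h2"
      by blast
    then show ?case by (intro exI[of _ "xs @ ys"]) simp
  qed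
qed

text \<open>
  The parity of the number of prefix reflections \<open>s\<^sub>1 \<dots> s\<^sub>i \<dots> s\<^sub>1\<close> of a word equal to \<open>t\<close>.
\<close>

fun word_cocycle :: "'a list \<Rightarrow> 'a \<Rightarrow> bool" where
  "word_cocycle [] t \<longleftrightarrow> False"
| "word_cocycle (s # ss) t \<longleftrightarrow> (t = s) \<noteq> word_cocycle ss (s \<otimes> t \<otimes> s)"

lemma word_cocycle_append:
  assumes "set xs \<subseteq> S" "set ys \<subseteq> S" "t \<in> carrier G"
  shows "word_cocycle (xs @ ys) t \<longleftrightarrow>
    word_cocycle xs t \<noteq> word_cocycle ys (inv (wp xs) \<otimes> t \<otimes> wp xs)"
  using assms
proof (induction xs arbitrary: t)
  case (Cons s xs)
  then show ?case
    by (auto simp: inv_mult_group m_assoc)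
qed simp

text \<open>The prefix reflections of the alternating word \<open>a b a b ...\<close> with 2k
  letters are \<open>(ab)^i a\<close> for i < 2k. The family \<open>E\<close> is abstract because it
  is instantiated by words over S, with \<open>a\<close> and \<open>b\<close> simple, and again by
  powers of a rotation, with \<open>a\<close> and \<open>b\<close> canonical generators of a
  dihedral subgroup; there the recursion is available on the set \<open>X\<close> of reflections of
  that subgroup.\<close>

lemma alternating_cocycle:
  assumes a: "a \<in> carrier G" "a \<otimes> a = \<one>" and b: "b \<in> carrier G" "b \<otimes> b = \<one>"
    and E0: "\<And>t. t \<in> X \<Longrightarrow> \<not> E 0 t"
    and ES: "\<And>k t. t \<in> X \<Longrightarrow> E (Suc k) t \<longleftrightarrow>
      ((t = a) \<noteq> ((a \<otimes> t \<otimes> a = b) \<noteq> E k (inv (a \<otimes> b) \<otimes> t \<otimes> (a \<otimes> b))))"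
    and X: "\<And>t. t \<in> X \<Longrightarrow> t \<in> carrier G \<and> inv (a \<otimes> b) \<otimes> t \<otimes> (a \<otimes> b) \<in> X"
    and t: "t \<in> X"
  shows "E k t \<longleftrightarrow> odd (\<Sum>i<2*k. of_bool (t = (a \<otimes> b) [^] i \<otimes> a) :: nat)"
  using t
proof (induction k arbitrary: t)
  case 0
  then show ?case by (simp add: E0)
next
  case (Suc k)
  define r where "r = a \<otimes> b"
  have ia: "inv a = a" and ib: "inv b = b"
    using a b by (simp_all add: inv_equality)
  have r: "r \<in> carrier G" using a b by (simp add: r_def)
  have tc: "t \<in> carrier G" using X Suc.prems by simp
  have ra: "a \<otimes> inv r = r \<otimes> a"
    using a b by (simp add: r_def inv_mult_group ia ib m_assoc)
  \<comment> \<open>Conjugation by the rotation moves the index by two, since \<open>a\<close>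
    inverts \<open>r\<close>; this accounts for the two letters split off.\<close>
  have conj: "inv r \<otimes> t \<otimes> r = r [^] i \<otimes> a \<longleftrightarrow> t = r [^] Suc (Suc i) \<otimes> a" for i :: nat
  proof -
    have "inv r \<otimes> t \<otimes> r = r [^] i \<otimes> a \<longleftrightarrow> t = r \<otimes> (r [^] i \<otimes> a) \<otimes> inv r"
      using r tc a by (intro conj_eq_iff) auto
    also have "r \<otimes> (r [^] i \<otimes> a) \<otimes> inv r = r \<otimes> r [^] i \<otimes> (a \<otimes> inv r)"
      using r a by (simp add: m_assoc)
    also have "\<dots> = r [^] Suc (Suc i) \<otimes> a"
      unfolding ra using r a nat_pow_Suc2[of r i] by (simp flip: m_assoc)
    finally show ?thesis .
  qed
  have aa: "a \<otimes> (a \<otimes> x) = x" if "x \<in> carrier G" for x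
    using a that by (simp flip: m_assoc)
  have one: "a \<otimes> t \<otimes> a = b \<longleftrightarrow> t = r [^] (1::nat) \<otimes> a"
  proof
    assume h: "a \<otimes> t \<otimes> a = b"
    have "t = a \<otimes> (a \<otimes> t \<otimes> a) \<otimes> a"
      using a tc by (simp add: m_assoc aa)
    then show "t = r [^] (1::nat) \<otimes> a"
      using h a b by (simp add: r_def)
  next
    assume "t = r [^] (1::nat) \<otimes> a"
    then show "a \<otimes> t \<otimes> a = b"
      using a b by (simp add: r_def m_assoc aa)
  qed
  have shift: "(\<Sum>i<2 * Suc k. f i) = f 0 + (f 1 + (\<Sum>i<2*k. f (Suc (Suc i))))"
    for f :: "nat \<Rightarrow> nat"
    by (simp add: sum.lessThan_Suc_shift del: sum.lessThan_Suc)
  have "(\<Sum>i<2 * Suc k. of_bool (t = r [^] i \<otimes> a) :: nat) =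
      of_bool (t = a) + (of_bool (t = r [^] (1::nat) \<otimes> a) +
        (\<Sum>i<2*k. of_bool (t = r [^] Suc (Suc i) \<otimes> a)))"
    using a unfolding shift by (simp only: nat_pow_0 l_one)
  then show ?case
    using Suc.IH[of "inv (a \<otimes> b) \<otimes> t \<otimes> (a \<otimes> b)"] Suc.prems X[OF Suc.prems]
    unfolding ES[OF Suc.prems] by (simp add: one conj flip: r_def)
qed

text \<open>With \<open>m\<close> the order of \<open>ab\<close> the summands have period
  \<open>m\<close>, so \<open>i\<close> and \<open>i + m\<close> cancel modulo 2. This is why a
  defining relation does not change the parities. For infinite order \<open>m\<close> is 0 and the
  sum is empty.\<close>

lemma alternating_sum_even:
  fixes m :: nat
  assumes "a \<in> carrier G" "b \<in> carrier G" "ord (a \<otimes> b) = m"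
  shows "even (\<Sum>i<2*m. of_bool (t = (a \<otimes> b) [^] i \<otimes> a) :: nat)"
proof -
  have split: "(\<Sum>i<m + k. f i) = (\<Sum>i<m. f i) + (\<Sum>i<k. f (i + m))" for k and f :: "nat \<Rightarrow> nat"
    by (induction k) (auto simp: add_ac)
  have "(\<Sum>i<2*m. of_bool (t = (a \<otimes> b) [^] i \<otimes> a) :: nat) =
    (\<Sum>i<m. of_bool (t = (a \<otimes> b) [^] i \<otimes> a)) + (\<Sum>i<m. of_bool (t = (a \<otimes> b) [^] (i + m) \<otimes> a))"
    unfolding mult_2 by (rule split)
  moreover have "(a \<otimes> b) [^] (i + m) = (a \<otimes> b) [^] i" for i
    using assms pow_ord_eq_1[of "a \<otimes> b"] by (simp flip: nat_pow_mult)
  ultimately show ?thesis by simp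
qed

text \<open>The congruence is defined on words in arbitrary group elements, so being a word over S
  is carried along as part of the invariant to make transitivity go through. With the presentation
  this turns two functions of words into functions of group elements.\<close>

lemma cox_equiv_invariant:
  "cox_equiv G S xs ys \<Longrightarrow>
    (set xs \<subseteq> S \<longleftrightarrow> set ys \<subseteq> S) \<and> (even (length xs) \<longleftrightarrow> even (length ys)) \<and>
    (set xs \<subseteq> S \<longrightarrow> (\<forall>t\<in>carrier G. word_cocycle xs t \<longleftrightarrow> word_cocycle ys t))"
proof (induction rule: cox_equiv.induct)
  case (relation s s' xs ys)
  define m where "m = ord (s \<otimes> s')"
  define rel where "rel = (\<lambda>k. concat (replicate k [s, s']))"
  have sub: "set (rel k) \<subseteq> S" for k
    using relation unfolding rel_def by auto
  have wprel: "wp (rel k) = (s \<otimes> s') [^] k" for k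
  proof (induction k)
    case (Suc k)
    have "wp (rel (Suc k)) = s \<otimes> s' \<otimes> wp (rel k)"
      using relation sub[of k] by (simp add: rel_def m_assoc)
    also have "\<dots> = (s \<otimes> s') [^] Suc k"
      using relation unfolding Suc by (intro nat_pow_Suc2[symmetric]) auto
    finally show ?case .
  qed (simp add: rel_def)
  have one: "wp (rel m) = \<one>"
    unfolding wprel m_def using relation by (simp add: pow_ord_eq_1)
  have coc: "\<not> word_cocycle (rel m) t" if "t \<in> carrier G" for t
  proof -
    have "word_cocycle (rel m) t \<longleftrightarrow> odd (\<Sum>i<2*m. of_bool (t = (s \<otimes> s') [^] i \<otimes> s) :: nat)"
    proof (rule alternating_cocycle[where X = "carrier G" and E = "\<lambda>k. word_cocycle (rel k)"])
      fix k t assume "t \<in> carrier G"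
      then show "word_cocycle (rel (Suc k)) t \<longleftrightarrow>
          ((t = s) \<noteq> ((s \<otimes> t \<otimes> s = s') \<noteq> word_cocycle (rel k) (inv (s \<otimes> s') \<otimes> t \<otimes> (s \<otimes> s'))))"
        using relation by (simp add: rel_def inv_mult_group m_assoc)
    qed (use relation that in \<open>auto simp: rel_def\<close>)
    then show ?thesis
      using alternating_sum_even[of s s' m t] relation by (simp add: m_def)
  qed
  have len: "even (length (rel m))"
    by (induction m) (auto simp: rel_def)
  have "word_cocycle (xs @ rel m @ ys) t \<longleftrightarrow> word_cocycle (xs @ ys) t"
    if "set xs \<subseteq> S" "set ys \<subseteq> S" "t \<in> carrier G" for t
    using that sub[of m] one coc
    by (simp add: word_cocycle_append)
  moreover have "set (xs @ rel m @ ys) \<subseteq> S \<longleftrightarrow> set (xs @ ys) \<subseteq> S"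
    using sub[of m] by auto
  ultimately show ?case
    using len unfolding rel_def m_def by (simp add: m_def)
qed auto

lemma wp_eq_invariant:
  assumes "set xs \<subseteq> S" "set ys \<subseteq> S" "wp xs = wp ys"
  shows "even (length xs) \<longleftrightarrow> even (length ys)"
    "t \<in> carrier G \<Longrightarrow> word_cocycle xs t \<longleftrightarrow> word_cocycle ys t"
proof -
  have "cox_equiv G S xs ys"
    using assms coxeter by (simp add: coxeter_system_def)
  from cox_equiv_invariant[OF this] assms
  show "even (length xs) \<longleftrightarrow> even (length ys)"
    "t \<in> carrier G \<Longrightarrow> word_cocycle xs t \<longleftrightarrow> word_cocycle ys t"
    by auto
qed

definition some_word :: "'a \<Rightarrow> 'a list" where
  "some_word w = (SOME ss. set ss \<subseteq> S \<and> wp ss = w)"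

lemma some_word:
  assumes "w \<in> carrier G"
  shows "set (some_word w) \<subseteq> S" "wp (some_word w) = w"
  using someI_ex[OF exists_word[OF assms]] by (auto simp: some_word_def)

text \<open>Dyer's reflection cocycle N(w). On reflections it is the set of left inversions, by
  \<open>cocycle_iff\<close>; as a parity it is additive, which a definition by length would
  hide.\<close>

definition cocycle :: "'a \<Rightarrow> 'a \<Rightarrow> bool" where
  "cocycle w t \<longleftrightarrow> word_cocycle (some_word w) t"

text \<open>The sign character, used to tell reflections from rotations in a dihedral
  subgroup.\<close>

definition odd_elem :: "'a \<Rightarrow> bool" where
  "odd_elem w \<longleftrightarrow> odd (length (some_word w))"

lemma cocycle_wp:
  "set ss \<subseteq> S \<Longrightarrow> t \<in> carrier G \<Longrightarrow> cocycle (wp ss) t \<longleftrightarrow> word_cocycle ss t"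
  unfolding cocycle_def by (rule wp_eq_invariant) (auto simp: some_word)

lemma odd_elem_wp: "set ss \<subseteq> S \<Longrightarrow> odd_elem (wp ss) \<longleftrightarrow> odd (length ss)"
  unfolding odd_elem_def using wp_eq_invariant(1)[of "some_word (wp ss)" ss] by (auto simp: some_word)

text \<open>Additivity of the parity under concatenation of words; in the usual notation N(xy) =
  N(x) + x N(y) x^-1.\<close>

lemma cocycle_mult:
  assumes "x \<in> carrier G" "y \<in> carrier G" "t \<in> carrier G"
  shows "cocycle (x \<otimes> y) t \<longleftrightarrow> cocycle x t \<noteq> cocycle y (inv x \<otimes> t \<otimes> x)"
  using assms word_cocycle_append[of "some_word x" "some_word y" t]
    cocycle_wp[of "some_word x @ some_word y" t]
  by (simp add: some_word cocycle_def)

lemma odd_elem_mult: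
  assumes "x \<in> carrier G" "y \<in> carrier G"
  shows "odd_elem (x \<otimes> y) \<longleftrightarrow> odd_elem x \<noteq> odd_elem y"
  using assms odd_elem_wp[of "some_word x @ some_word y"]
  by (auto simp: some_word odd_elem_def)

lemma cocycle_one [simp]: "t \<in> carrier G \<Longrightarrow> \<not> cocycle \<one> t"
  using cocycle_wp[of "[]" t] by simp

lemma odd_elem_one [simp]: "\<not> odd_elem \<one>"
  using odd_elem_wp[of "[]"] by simp

lemma cocycle_S: "s \<in> S \<Longrightarrow> t \<in> carrier G \<Longrightarrow> cocycle s t \<longleftrightarrow> t = s"
  using cocycle_wp[of "[s]" t] by simp

lemma odd_elem_S: "s \<in> S \<Longrightarrow> odd_elem s"
  using odd_elem_wp[of "[s]"] by simp

lemma cocycle_inv: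
  assumes "x \<in> carrier G" "t \<in> carrier G"
  shows "cocycle (inv x) t \<longleftrightarrow> cocycle x (x \<otimes> t \<otimes> inv x)"
  using cocycle_mult[of "inv x" x t] assms by simp

lemma odd_elem_inv: "x \<in> carrier G \<Longrightarrow> odd_elem (inv x) \<longleftrightarrow> odd_elem x"
  using odd_elem_mult[of "inv x" x] by simp

section \<open>Reflections and their occurrences in words\<close>

lemma reflectionE:
  assumes "t \<in> T"
  obtains w s where "w \<in> carrier G" "s \<in> S" "t = w \<otimes> s \<otimes> inv w"
  using assms by (auto simp: reflections_def)

lemma reflection_closed [simp]: "t \<in> T \<Longrightarrow> t \<in> carrier G"
  by (auto elim: reflectionE)

lemma reflection_square [simp]: "t \<in> T \<Longrightarrow> t \<otimes> t = \<one>"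
  by (auto elim!: reflectionE simp: m_assoc)

lemma reflection_inv [simp]: "t \<in> T \<Longrightarrow> inv t = t"
  by (simp add: inv_equality)

lemma reflection_square_assoc [simp]: "t \<in> T \<Longrightarrow> x \<in> carrier G \<Longrightarrow> t \<otimes> (t \<otimes> x) = x"
  by (simp flip: m_assoc)

lemma reflection_conj:
  assumes "t \<in> T" "x \<in> carrier G"
  shows "x \<otimes> t \<otimes> inv x \<in> T"
proof -
  obtain w s where w: "w \<in> carrier G" "s \<in> S" "t = w \<otimes> s \<otimes> inv w"
    using assms(1) by (rule reflectionE)
  have "x \<otimes> t \<otimes> inv x = (x \<otimes> w) \<otimes> s \<otimes> inv (x \<otimes> w)"
    using w assms by (simp add: m_assoc inv_mult_group)
  then show ?thesis
    using w assms unfolding reflections_def by blast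
qed

lemma reflection_conj': "t \<in> T \<Longrightarrow> x \<in> carrier G \<Longrightarrow> inv x \<otimes> t \<otimes> x \<in> T"
  using reflection_conj[of t "inv x"] by simp

lemma reflection_conj_reflection: "t \<in> T \<Longrightarrow> r \<in> T \<Longrightarrow> t \<otimes> r \<otimes> t \<in> T"
  using reflection_conj[of r t] by simp

lemma S_reflection: "s \<in> S \<Longrightarrow> s \<in> T"
  unfolding reflections_def by (intro CollectI exI[of _ \<one>] exI[of _ s]) simp

lemma reflection_odd: "t \<in> T \<Longrightarrow> odd_elem t"
  by (auto elim!: reflectionE simp: odd_elem_mult odd_elem_inv odd_elem_S)

text \<open>In \<open>t = w s w^-1\<close> the contributions of \<open>w\<close> and of
  \<open>w^-1\<close> are equal and cancel modulo 2, leaving that of \<open>s\<close> at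
  \<open>s\<close>.\<close>

lemma cocycle_self: "t \<in> T \<Longrightarrow> cocycle t t"
proof -
  assume t: "t \<in> T"
  then obtain w s where w: "w \<in> carrier G" "s \<in> S" "t = w \<otimes> s \<otimes> inv w"
    by (rule reflectionE)
  have 1: "inv w \<otimes> t \<otimes> w = s"
    using w by (simp add: m_assoc)
  have "cocycle t t \<longleftrightarrow> cocycle w t \<noteq> cocycle (s \<otimes> inv w) s"
    using w t cocycle_mult[of w "s \<otimes> inv w" t] by (simp add: 1) (simp add: m_assoc)
  also have "cocycle (s \<otimes> inv w) s \<longleftrightarrow> \<not> cocycle (inv w) s"
    using w cocycle_mult[of s "inv w" s] by (simp add: cocycle_S)
  also have "cocycle (inv w) s \<longleftrightarrow> cocycle w t"
    using w cocycle_inv[of w s] by simp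
  finally show ?thesis by simp
qed

text \<open>An odd number of occurrences is at least one; this is where parities become actual
  positions in a word.\<close>

lemma word_cocycle_split:
  assumes "word_cocycle ss t" "set ss \<subseteq> S" "t \<in> carrier G"
  shows "\<exists>as s bs. ss = as @ s # bs \<and> t = wp as \<otimes> s \<otimes> inv (wp as)"
  using assms
proof (induction ss arbitrary: t)
  case (Cons s ss)
  show ?case
  proof (cases "t = s")
    case True
    then show ?thesis
      using Cons.prems by (intro exI[of _ "[]"]) auto
  next
    case False
    then obtain as s' bs where *: "ss = as @ s' # bs" "s \<otimes> t \<otimes> s = wp as \<otimes> s' \<otimes> inv (wp as)"
      using Cons.IH[of "s \<otimes> t \<otimes> s"] Cons.prems by auto
    have "t = s \<otimes> (s \<otimes> t \<otimes> s) \<otimes> s"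
      using Cons.prems by (simp add: m_assoc)
    also have "\<dots> = wp (s # as) \<otimes> s' \<otimes> inv (wp (s # as))"
      using Cons.prems unfolding * by (auto simp: m_assoc inv_mult_group *)
    finally show ?thesis
      using * by (intro exI[of _ "s # as"]) auto
  qed
qed simp

lemma finite_cocycle:
  assumes "w \<in> carrier G"
  shows "finite {t \<in> carrier G. cocycle w t}"
proof (rule finite_subset)
  let ?f = "\<lambda>i. wp (take i (some_word w)) \<otimes> some_word w ! i \<otimes> inv (wp (take i (some_word w)))"
  show "{t \<in> carrier G. cocycle w t} \<subseteq> ?f ` {..<length (some_word w)}"
  proof
    fix t assume t: "t \<in> {t \<in> carrier G. cocycle w t}"
    then obtain as s bs where "some_word w = as @ s # bs" "t = wp as \<otimes> s \<otimes> inv (wp as)"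
      using word_cocycle_split[of "some_word w" t] assms some_word(1)[of w] by (auto simp: cocycle_def)
    then show "t \<in> ?f ` {..<length (some_word w)}"
      by (intro image_eqI[of _ _ "length as"]) auto
  qed
qed simp

section \<open>Length, strong exchange and descents\<close>

lemma len_le: "set ss \<subseteq> S \<Longrightarrow> len (wp ss) \<le> length ss"
  unfolding cox_length_def by (rule Least_le) auto

lemma reduced_word:
  assumes "w \<in> carrier G"
  obtains ss where "set ss \<subseteq> S" "wp ss = w" "length ss = len w"
proof -
  have "\<exists>k ss. set ss \<subseteq> S \<and> length ss = k \<and> wp ss = w"
    using exists_word[OF assms] by blast
  from LeastI_ex[OF this] show ?thesis
    using that unfolding cox_length_def by blast
qed

text \<open>Strong exchange: multiplying by a prefix reflection of a reduced word deletes one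
  letter.\<close>

lemma cocycle_len_less:
  assumes "cocycle w t" "w \<in> carrier G" "t \<in> T"
  shows "len (t \<otimes> w) < len w"
proof -
  obtain ss where ss: "set ss \<subseteq> S" "wp ss = w" "length ss = len w"
    using reduced_word assms by blast
  then obtain as s bs where *: "ss = as @ s # bs" "t = wp as \<otimes> s \<otimes> inv (wp as)"
    using word_cocycle_split[of ss t] cocycle_wp[of ss t] assms by auto
  have "t \<otimes> w = wp (as @ bs)"
    using ss(1) unfolding ss(2)[symmetric] * by (simp add: m_assoc)
  then have "len (t \<otimes> w) \<le> length (as @ bs)"
    using len_le[of "as @ bs"] ss(1) * by auto
  then show ?thesis
    using ss(3) * by simp
qed

text \<open>Exactly one of \<open>w\<close> and \<open>tw\<close> has \<open>t\<close> in its
  cocycle, because \<open>t\<close> belongs to its own; the deletion argument applies to that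
  one.\<close>

lemma cocycle_iff:
  assumes "w \<in> carrier G" "t \<in> T"
  shows "cocycle w t \<longleftrightarrow> len (t \<otimes> w) < len w"
proof
  assume "len (t \<otimes> w) < len w"
  moreover have "len w < len (t \<otimes> w)" if "\<not> cocycle w t"
  proof -
    have "cocycle (t \<otimes> w) t"
      using cocycle_mult[of t w t] that assms cocycle_self by simp
    from cocycle_len_less[OF this] show ?thesis
      using assms by simp
  qed
  ultimately show "cocycle w t" by fastforce
qed (use assms cocycle_len_less in blast)

lemma len_inv: "w \<in> carrier G \<Longrightarrow> len (inv w) = len w"
proof -
  have *: "len (inv w) \<le> len w" if w: "w \<in> carrier G" for w
  proof -
    obtain ss where ss: "set ss \<subseteq> S" "wp ss = w" "length ss = len w"
      using reduced_word w by blast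
    then show ?thesis
      using len_le[of "rev ss"] by (simp add: wp_rev)
  qed
  assume "w \<in> carrier G"
  then show ?thesis using *[of w] *[of "inv w"] by simp
qed

definition up :: "'a \<Rightarrow> 'a \<Rightarrow> bool" where
  "up x t \<longleftrightarrow> len x < len (x \<otimes> t)"

text \<open>Labels multiply on the right while the cocycle describes left multiplication, so lengths
  are compared through inverses.\<close>

lemma up_iff:
  assumes "x \<in> carrier G" "t \<in> T"
  shows "up x t \<longleftrightarrow> \<not> cocycle (inv x) t"
proof -
  have *: "len (t \<otimes> inv x) = len (x \<otimes> t)"
    using len_inv[of "x \<otimes> t"] assms by (simp add: inv_mult_group)
  have "cocycle (inv x) t \<longleftrightarrow> len (x \<otimes> t) < len x"
    using cocycle_iff[of "inv x" t] assms by (simp add: len_inv *)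
  moreover have "cocycle (inv (x \<otimes> t)) t \<longleftrightarrow> len x < len (x \<otimes> t)"
    using cocycle_iff[of "inv (x \<otimes> t)" t] assms * len_inv[of x] by (simp add: inv_mult_group)
  moreover have "cocycle (inv (x \<otimes> t)) t \<longleftrightarrow> \<not> cocycle (inv x) t"
    using cocycle_mult[of t "inv x" t] assms cocycle_self by (simp add: inv_mult_group)
  ultimately show ?thesis
    unfolding up_def by blast
qed

lemma len_one [simp]: "len \<one> = 0"
  using len_le[of "[]"] by simp

lemma exists_descent:
  assumes "v \<in> carrier G" "v \<noteq> \<one>"
  shows "\<exists>s\<in>S. len (s \<otimes> v) < len v"
proof -
  obtain ss where ss: "set ss \<subseteq> S" "wp ss = v" "length ss = len v"
    using reduced_word assms by blast
  with assms obtain s ss' where c: "ss = s # ss'"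
    by (cases ss) auto
  have "s \<otimes> v = wp ss'"
    using ss(1) unfolding ss(2)[symmetric] c by simp
  then have "len (s \<otimes> v) < len v"
    using len_le[of ss'] ss c by auto
  then show ?thesis using ss c by auto
qed

end

section \<open>Dihedral reflection subgroups\<close>

context coxeter
begin

text \<open>The number of conjugating letters in a shortest palindromic expression. It is the
  well-founded measure by which a dihedral subgroup is reduced to its canonical generators.\<close>

definition depth :: "'a \<Rightarrow> nat" where
  "depth t = (LEAST k. \<exists>as s. set as \<subseteq> S \<and> s \<in> S \<and> length as = k \<and> t = wp as \<otimes> s \<otimes> inv (wp as))"

lemma depth_le:
  "set as \<subseteq> S \<Longrightarrow> s \<in> S \<Longrightarrow> depth (wp as \<otimes> s \<otimes> inv (wp as)) \<le> length as"
  unfolding depth_def by (rule Least_le) blast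

lemma depth_word:
  assumes "t \<in> T"
  obtains as s where "set as \<subseteq> S" "s \<in> S" "length as = depth t" "t = wp as \<otimes> s \<otimes> inv (wp as)"
proof -
  obtain w s where w: "w \<in> carrier G" "s \<in> S" "t = w \<otimes> s \<otimes> inv w"
    using assms by (rule reflectionE)
  obtain ss where "set ss \<subseteq> S" "wp ss = w"
    using exists_word w by blast
  with w have "\<exists>k as s. set as \<subseteq> S \<and> s \<in> S \<and> length as = k \<and> t = wp as \<otimes> s \<otimes> inv (wp as)"
    by blast
  from LeastI_ex[OF this] show ?thesis
    using that unfolding depth_def by blast
qed

text \<open>\<open>r\<close> is a prefix reflection of the conjugator of \<open>t\<close>: it is
  itself given by a proper prefix, and \<open>r\<close> times the conjugator is the conjugator with
  \<open>s'\<close> deleted.\<close>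

lemma depth_prefix:
  assumes "set as \<subseteq> S" "s \<in> S" "as = bs @ s' # cs"
    and "t = wp as \<otimes> s \<otimes> inv (wp as)" "r = wp bs \<otimes> s' \<otimes> inv (wp bs)"
  shows "depth r < length as" "depth (r \<otimes> t \<otimes> r) < length as"
proof -
  show "depth r < length as"
    using depth_le[of bs s'] assms by auto
  have "r \<in> T"
    using assms by (auto intro: reflection_conj[OF S_reflection])
  have "r \<otimes> wp as = wp (bs @ cs)"
    using assms by (auto simp: m_assoc)
  moreover have "r \<otimes> t \<otimes> r = (r \<otimes> wp as) \<otimes> s \<otimes> inv (r \<otimes> wp as)"
    using assms(1,2,4) \<open>r \<in> T\<close> by (simp add: inv_mult_group m_assoc)
  ultimately show "depth (r \<otimes> t \<otimes> r) < length as"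
    using depth_le[of "bs @ cs" s] assms by auto
qed

text \<open>Locate \<open>r\<close> among the prefix reflections of the palindrome for
  \<open>t\<close>. In the left half it comes from a prefix of the conjugator, at the centre it is
  \<open>t\<close>, and in the right half \<open>trt\<close> is the prefix reflection at the mirror
  position; hence the two candidates.\<close>

lemma depth_descent:
  assumes t: "t \<in> T" and r: "r \<in> T" and "cocycle t r" "r \<noteq> t"
  shows "\<exists>r'\<in>{r, t \<otimes> r \<otimes> t}. depth r' < depth t \<and> depth (r' \<otimes> t \<otimes> r') < depth t"
proof -
  obtain as s where as: "set as \<subseteq> S" "s \<in> S" "length as = depth t" "t = wp as \<otimes> s \<otimes> inv (wp as)"
    using t by (rule depth_word)
  have "t = wp (as @ s # rev as)"
    using as by (simp add: wp_rev m_assoc)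
  then have "word_cocycle (as @ s # rev as) r"
    using assms as cocycle_wp[of "as @ s # rev as" r] by simp
  then obtain bs s' cs where split: "as @ s # rev as = bs @ s' # cs"
    and req: "r = wp bs \<otimes> s' \<otimes> inv (wp bs)"
    using word_cocycle_split[of "as @ s # rev as" r] as r by auto
  from split consider
      (left) us where "as = bs @ us" "us @ s # rev as = s' # cs"
    | (right) us where "as @ us = bs" "s # rev as = us @ s' # cs"
    unfolding append_eq_append_conv2 by blast
  then show ?thesis
  proof cases
    case left
    show ?thesis
    proof (cases us)
      case Nil
      then show ?thesis
        using left req as \<open>r \<noteq> t\<close> by auto
    next
      case (Cons s'' us')
      then show ?thesis
        using depth_prefix[of as s bs s' us' t r] left as req by auto
    qed
  next
    case right
    show ?thesis
    proof (cases us)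
      case Nil
      then show ?thesis
        using right req as \<open>r \<noteq> t\<close> by auto
    next
      case (Cons s'' us')
      with right have *: "s'' = s" "rev as = us' @ s' # cs" by auto
      then have as': "as = rev cs @ s' # rev us'"
        by (metis rev.simps(2) rev_append rev_rev_ident append.assoc append_Cons append_Nil)
      have sub: "set cs \<subseteq> S" "s' \<in> S" "set us' \<subseteq> S"
        using as(1) unfolding as' by auto
      have "wp as \<otimes> wp us' = wp (rev cs) \<otimes> s'"
        using sub unfolding as' by (simp add: wp_rev m_assoc)
      moreover have "wp bs = wp as \<otimes> s \<otimes> wp us'"
        using sub as right(1) Cons *(1) by (auto simp: m_assoc)
      then have "wp bs = t \<otimes> (wp as \<otimes> wp us')"
        using as(1,2) sub unfolding as(4) by (simp add: m_assoc)
      ultimately have bs: "wp bs = t \<otimes> wp (rev cs) \<otimes> s'"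
        using t sub by (simp add: m_assoc)
      have "t \<otimes> r \<otimes> t = wp (rev cs) \<otimes> s' \<otimes> inv (wp (rev cs))"
        unfolding req bs using t sub by (simp add: m_assoc inv_mult_group)
      from depth_prefix[OF as(1,2) as' as(4) this] show ?thesis
        by (simp add: as(3))
    qed
  qed
qed

text \<open>The integer index lets finite and infinite order be treated alike: indices 0, 1, ...
  give \<open>p\<close>, \<open>pqp\<close>, ..., and -1, -2, ... give \<open>q\<close>,
  \<open>qpq\<close>, .... A product of three reflections of indices i, j, k has index i - j +
  k.\<close>

definition dihedral_refl :: "'a \<Rightarrow> 'a \<Rightarrow> int \<Rightarrow> 'a" where
  "dihedral_refl p q k = (p \<otimes> q) [^] k \<otimes> p"

lemma int_pow_pred: "x \<in> carrier G \<Longrightarrow> x [^] (k - 1 :: int) = x [^] k \<otimes> inv x"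
  by (simp add: int_pow_diff)

lemma int_pow_succ: "x \<in> carrier G \<Longrightarrow> x [^] (k + 1 :: int) = x [^] k \<otimes> x"
  by (simp add: int_pow_mult)

lemma rotation_flip:
  assumes "p \<in> T" "q \<in> T"
  shows "p \<otimes> (p \<otimes> q) [^] k = (p \<otimes> q) [^] (- k :: int) \<otimes> p"
proof -
  define r where "r = p \<otimes> q"
  have r: "r \<in> carrier G" "p \<otimes> r = inv r \<otimes> p" "p \<otimes> inv r = r \<otimes> p"
    using assms by (simp_all add: r_def inv_mult_group m_assoc)
  have pc: "p \<in> carrier G" using assms by simp
  have "p \<otimes> r [^] k = r [^] (- k) \<otimes> p"
  proof (induction k rule: int_induct[where k = 0])
    case base
    then show ?case using pc by simp
  next
    case (step1 i)
    have "p \<otimes> r [^] (i + 1) = p \<otimes> r [^] i \<otimes> r"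
      using r pc by (simp add: int_pow_succ m_assoc)
    also have "\<dots> = r [^] (- i) \<otimes> inv r \<otimes> p"
      unfolding step1 using r pc by (simp add: m_assoc)
    also have "\<dots> = r [^] (- i - 1) \<otimes> p"
      using r by (simp only: int_pow_pred)
    finally show ?case by simp
  next
    case (step2 i)
    have "p \<otimes> r [^] (i - 1) = p \<otimes> r [^] i \<otimes> inv r"
      using r pc by (simp add: int_pow_pred m_assoc)
    also have "\<dots> = r [^] (- i) \<otimes> r \<otimes> p"
      unfolding step2 using r pc by (simp add: m_assoc)
    also have "\<dots> = r [^] (- i + 1) \<otimes> p"
      using r by (simp only: int_pow_succ)
    finally show ?case by simp
  qed
  then show ?thesis by (simp add: r_def)
qed

context
  fixes p q assumes p: "p \<in> T" and q: "q \<in> T"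
begin

lemma dihedral_refl_closed [simp]: "dihedral_refl p q k \<in> carrier G"
  using p q by (simp add: dihedral_refl_def)

lemma rotation_mult_dihedral_refl:
  "(p \<otimes> q) [^] j \<otimes> dihedral_refl p q k = dihedral_refl p q (j + k)"
  using p q by (simp add: dihedral_refl_def int_pow_mult m_assoc)

lemma dihedral_refl_mult_rotation:
  "dihedral_refl p q k \<otimes> (p \<otimes> q) [^] j = dihedral_refl p q (k - j)"
proof -
  have "dihedral_refl p q k \<otimes> (p \<otimes> q) [^] j = (p \<otimes> q) [^] k \<otimes> (p \<otimes> q) [^] (- j) \<otimes> p"
    using p q by (simp add: dihedral_refl_def m_assoc rotation_flip)
  also have "(p \<otimes> q) [^] k \<otimes> (p \<otimes> q) [^] (- j) = (p \<otimes> q) [^] (k - j)"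
    using p q int_pow_mult[of "p \<otimes> q" k "- j"] by simp
  finally show ?thesis by (simp add: dihedral_refl_def)
qed

lemma dihedral_refl_mult:
  "dihedral_refl p q j \<otimes> dihedral_refl p q k = (p \<otimes> q) [^] (j - k)"
proof -
  have "dihedral_refl p q j \<otimes> dihedral_refl p q k = dihedral_refl p q (j - k) \<otimes> p"
    using p q dihedral_refl_mult_rotation[of j k]
    by (simp add: dihedral_refl_def[of p q k] flip: m_assoc)
  then show ?thesis
    using p q by (simp add: dihedral_refl_def m_assoc)
qed

lemma dihedral_refl_mult3:
  "dihedral_refl p q i \<otimes> dihedral_refl p q j \<otimes> dihedral_refl p q k = dihedral_refl p q (i - j + k)"
  by (simp add: dihedral_refl_mult rotation_mult_dihedral_refl)

lemma dihedral_refl_0: "dihedral_refl p q 0 = p"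
  using p by (simp add: dihedral_refl_def)

lemma dihedral_refl_minus_1: "dihedral_refl p q (- 1) = q"
  using p q by (simp add: dihedral_refl_def int_pow_neg inv_mult_group m_assoc)

text \<open>Conjugation by a power of the rotation shifts the index by an even number, so every
  element is conjugate to the one of index 0 or 1, that is to \<open>p\<close> or
  \<open>pqp\<close>.\<close>

lemma dihedral_refl_reflection: "dihedral_refl p q k \<in> T"
proof (cases "even k")
  case True
  then obtain j where k: "k = 2 * j" by (elim evenE)
  have "dihedral_refl p q k = (p \<otimes> q) [^] j \<otimes> p \<otimes> inv ((p \<otimes> q) [^] j)"
    using p q rotation_mult_dihedral_refl[of j j]
    by (simp add: k dihedral_refl_def m_assoc rotation_flip flip: int_pow_neg)
  then show ?thesis
    using p q by (simp add: reflection_conj)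
next
  case False
  then obtain j where k: "k = 2 * j + 1" by (elim oddE)
  have "dihedral_refl p q k = (p \<otimes> q) [^] j \<otimes> dihedral_refl p q 1 \<otimes> (p \<otimes> q) [^] (- j)"
    by (simp only: rotation_mult_dihedral_refl dihedral_refl_mult_rotation) (simp add: k)
  also have "\<dots> = (p \<otimes> q) [^] j \<otimes> (p \<otimes> q \<otimes> p) \<otimes> inv ((p \<otimes> q) [^] j)"
    using p q by (simp add: dihedral_refl_def int_pow_neg)
  finally show ?thesis
    using p q by (simp add: reflection_conj reflection_conj_reflection)
qed

lemma dihedral_elem:
  assumes "h \<in> generate G {p, q}"
  shows "\<exists>k::int. h = (p \<otimes> q) [^] k \<or> h = dihedral_refl p q k"
  using assms
proof induction
  case one
  then show ?case by (intro exI[of _ 0]) simp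
next
  case (incl h)
  then show ?case
    using dihedral_refl_0 dihedral_refl_minus_1 by (metis insertE empty_iff)
next
  case (inv h)
  then have "inv h = h" using p q by auto
  with inv show ?case
    using dihedral_refl_0 dihedral_refl_minus_1 by (metis insertE empty_iff)
next
  case (eng h1 h2)
  then obtain j k where
    "h1 = (p \<otimes> q) [^] (j::int) \<or> h1 = dihedral_refl p q j"
    "h2 = (p \<otimes> q) [^] (k::int) \<or> h2 = dihedral_refl p q k"
    by blast
  moreover have "(p \<otimes> q) [^] j \<otimes> (p \<otimes> q) [^] k = (p \<otimes> q) [^] (j + k)"
    using p q by (simp add: int_pow_mult)
  ultimately show ?case
    by (elim disjE; hypsubst; simp only: rotation_mult_dihedral_refl dihedral_refl_mult_rotation
        dihedral_refl_mult; blast)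
qed

lemma rotation_generate: "(p \<otimes> q) [^] (k::int) \<in> generate G {p, q}"
proof -
  have "subgroup (generate G {p, q}) G"
    using p q by (intro generate_is_subgroup) auto
  then show ?thesis
    by (intro subgroup_int_pow_closed generate.eng generate.incl) simp_all
qed

text \<open>The rotations are products of two reflections, hence even, whereas reflections are odd;
  so no rotation is a reflection.\<close>

lemma dihedral_reflections: "T \<inter> generate G {p, q} = range (dihedral_refl p q)"
proof (intro equalityI subsetI)
  fix h assume h: "h \<in> T \<inter> generate G {p, q}"
  then obtain k :: int where k: "h = (p \<otimes> q) [^] k \<or> h = dihedral_refl p q k"
    using dihedral_elem by blast
  have "(p \<otimes> q) [^] k = dihedral_refl p q k \<otimes> dihedral_refl p q 0"
    by (simp add: dihedral_refl_mult)
  then have "\<not> odd_elem ((p \<otimes> q) [^] k)"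
    using reflection_odd[OF dihedral_refl_reflection] by (simp add: odd_elem_mult)
  then have "h = dihedral_refl p q k"
    using k h reflection_odd[of h] by auto
  then show "h \<in> range (dihedral_refl p q)" by blast
next
  fix h assume "h \<in> range (dihedral_refl p q)"
  then obtain k where "h = dihedral_refl p q k" by blast
  moreover have "dihedral_refl p q k \<in> generate G {p, q}"
    unfolding dihedral_refl_def
    by (intro generate.eng rotation_generate generate.incl) simp
  ultimately show "h \<in> T \<inter> generate G {p, q}"
    using dihedral_refl_reflection[of k] by simp
qed

end

section \<open>Canonical generators of a dihedral reflection subgroup\<close>

lemma canonical_generators_iff:
  "c \<in> canonical_generators G S (generate G {p, q}) \<longleftrightarrow>
    c \<in> T \<inter> generate G {p, q} \<and> (\<forall>r\<in>T \<inter> generate G {p, q}. cocycle c r \<longleftrightarrow> r = c)"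
proof (cases "c \<in> T")
  case True
  then have "{r \<in> T. len (r \<otimes> c) < len c} = {r \<in> T. cocycle c r}"
    using cocycle_iff[of c] by (metis (no_types, lifting) reflection_closed)
  with True show ?thesis
    unfolding canonical_generators_def using cocycle_self[of c] by blast
qed (auto simp: canonical_generators_def)

text \<open>
  The canonical generators are the two elements of least depth. A third one, \<open>c\<close>, is
  impossible: \<open>abc\<close> is a reflection, but its cocycle is supported on \<open>{a, aba, abcba}\<close>,
  which does not contain \<open>abc\<close>.
\<close>

lemma canonical_generators_dihedral:
  assumes p: "p \<in> T" and q: "q \<in> T" and "p \<noteq> q"
  obtains a b where "a \<noteq> b" "canonical_generators G S (generate G {p, q}) = {a, b}"
    "a \<in> T" "b \<in> T" "p \<in> range (dihedral_refl a b)" "q \<in> range (dihedral_refl a b)"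
    "\<And>k. cocycle a (dihedral_refl a b k) \<longleftrightarrow> dihedral_refl a b k = a"
    "\<And>k. cocycle b (dihedral_refl a b k) \<longleftrightarrow> dihedral_refl a b k = b"
proof -
  define X where "X = T \<inter> generate G {p, q}"
  have X3: "x \<otimes> y \<otimes> z \<in> X" if "x \<in> X" "y \<in> X" "z \<in> X" for x y z
    using that unfolding X_def dihedral_reflections[OF p q]
    by (elim rangeE; hypsubst; simp only: dihedral_refl_mult3[OF p q]; blast)
  have XT: "x \<in> T" if "x \<in> X" for x using that by (simp add: X_def)
  have pX: "p \<in> X" "q \<in> X"
    using p q by (simp_all add: X_def generate.incl)
  obtain a where a: "a \<in> X" "\<And>x. x \<in> X \<Longrightarrow> depth a \<le> depth x"
    using ex_has_least_nat[of "\<lambda>x. x \<in> X" p depth] pX by blast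
  have "\<exists>x. x \<in> X - {a}" using pX assms(3) by blast
  then obtain b where b: "b \<in> X" "b \<noteq> a" "\<And>x. x \<in> X \<Longrightarrow> x \<noteq> a \<Longrightarrow> depth b \<le> depth x"
    using ex_has_least_nat[of "\<lambda>x. x \<in> X - {a}" _ depth] by (metis Diff_iff singletonD singletonI)
  have descent: "\<exists>r'\<in>X. r' \<otimes> c \<otimes> r' \<in> X \<and> depth r' < depth c \<and> depth (r' \<otimes> c \<otimes> r') < depth c"
    if "c \<in> X" "r \<in> X" "cocycle c r" "r \<noteq> c" for c r
    using depth_descent[OF XT[OF that(1)] XT[OF that(2)] that(3,4)] X3 that by blast
  have ca: "cocycle a r \<longleftrightarrow> r = a" if "r \<in> X" for r
    using descent[of a r] that a cocycle_self XT by (metis leD)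
  \<comment> \<open>A descent for \<open>b\<close> would supply two elements of smaller depth; both
    must be \<open>a\<close>, and \<open>aba = a\<close> gives \<open>b = a\<close>.\<close>
  have cb: "cocycle b r \<longleftrightarrow> r = b" if r: "r \<in> X" for r
  proof (rule ccontr)
    assume "\<not> ?thesis"
    then have "cocycle b r" "r \<noteq> b" using cocycle_self XT b by auto
    then obtain r' where r': "r' \<in> X" "r' \<otimes> b \<otimes> r' \<in> X" "depth r' < depth b"
      "depth (r' \<otimes> b \<otimes> r') < depth b"
      using descent[of b r] r b by blast
    then have "r' = a" "r' \<otimes> b \<otimes> r' = a"
      using b(3) leD by blast+
    then have "a \<otimes> b \<otimes> a = a" by simp
    then have "a \<otimes> (a \<otimes> b \<otimes> a) \<otimes> a = a" using XT[OF a(1)] by simp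
    then have "b = a" using XT[OF a(1)] XT[OF b(1)] by (simp add: m_assoc)
    with b show False by simp
  qed
  have only: "c = a \<or> c = b" if c: "c \<in> X" "\<And>r. r \<in> X \<Longrightarrow> cocycle c r \<longleftrightarrow> r = c" for c
  proof (rule ccontr)
    assume neg: "\<not> ?thesis"
    have cl: "a \<in> carrier G" "b \<in> carrier G" "c \<in> carrier G"
      using XT a b c by auto
    let ?w = "a \<otimes> b \<otimes> c"
    have sq: "a \<otimes> a = \<one>" "b \<otimes> b = \<one>" "c \<otimes> c = \<one>"
      "a \<otimes> (a \<otimes> x) = x" "b \<otimes> (b \<otimes> x) = x" "c \<otimes> (c \<otimes> x) = x" "inv a = a" "inv b = b" "inv c = c"
      if "x \<in> carrier G" for x
      using XT[OF a(1)] XT[OF b(1)] XT[OF c(1)] that by auto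
    have wX: "?w \<in> X" using X3 a b c by blast
    then have "cocycle ?w ?w" using cocycle_self XT by blast
    moreover have "cocycle ?w ?w \<longleftrightarrow> cocycle (a \<otimes> b) ?w \<noteq> cocycle c (inv (a \<otimes> b) \<otimes> ?w \<otimes> (a \<otimes> b))"
      using cocycle_mult[of "a \<otimes> b" c ?w] cl by simp
    moreover have "cocycle (a \<otimes> b) ?w \<longleftrightarrow> cocycle a ?w \<noteq> cocycle b (a \<otimes> ?w \<otimes> a)"
      using cocycle_mult[of a b ?w] cl sq by simp
    moreover have "inv (a \<otimes> b) \<otimes> ?w \<otimes> (a \<otimes> b) = c \<otimes> a \<otimes> b"
      using cl sq by (simp add: inv_mult_group m_assoc)
    ultimately have "?w = a \<or> a \<otimes> ?w \<otimes> a = b \<or> c \<otimes> a \<otimes> b = c"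
      using ca[OF wX] cb[OF X3[OF a(1) wX a(1)]] c(2)[OF X3[OF c(1) a(1) b(1)]] by auto
    then show False
    proof (elim disjE)
      assume "?w = a"
      then have "a \<otimes> ?w \<otimes> c = a \<otimes> a \<otimes> c" by simp
      then show False using cl sq neg by (simp add: m_assoc)
    next
      assume "a \<otimes> ?w \<otimes> a = b"
      then have "b \<otimes> (a \<otimes> ?w \<otimes> a) \<otimes> a = b \<otimes> b \<otimes> a" by simp
      then show False using cl sq neg by (simp add: m_assoc)
    next
      assume "c \<otimes> a \<otimes> b = c"
      then have "c \<otimes> (c \<otimes> a \<otimes> b) \<otimes> b = c \<otimes> c \<otimes> b" by simp
      then show False using cl sq b(2) by (simp add: m_assoc)
    qed
  qed
  \<comment> \<open>Every element other than \<open>a\<close> and \<open>b\<close> has a descent,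
    hence is a product of elements of smaller depth.\<close>
  have gen: "r \<in> generate G {a, b}" if "r \<in> X" for r
    using that
  proof (induction "depth r" arbitrary: r rule: less_induct)
    case less
    show ?case
    proof (cases "r = a \<or> r = b")
      case True
      then show ?thesis by (auto intro: generate.incl)
    next
      case False
      then obtain x where "x \<in> X" "cocycle r x" "x \<noteq> r"
        using only[of r] less.prems cocycle_self XT by blast
      then obtain r' where r': "r' \<in> X" "r' \<otimes> r \<otimes> r' \<in> X" "depth r' < depth r"
        "depth (r' \<otimes> r \<otimes> r') < depth r"
        using descent less.prems by blast
      have "r = r' \<otimes> (r' \<otimes> r \<otimes> r') \<otimes> r'"
        using XT[OF r'(1)] XT[OF less.prems] by (simp add: m_assoc)
      moreover have "r' \<in> generate G {a, b}" "r' \<otimes> r \<otimes> r' \<in> generate G {a, b}"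
        using less.hyps r' by blast+
      ultimately show ?thesis by (metis generate.eng)
    qed
  qed
  have "subgroup (generate G {p, q}) G"
    using p q by (intro generate_is_subgroup) auto
  then have "generate G {a, b} \<subseteq> generate G {p, q}"
    using a(1) b(1) by (intro generate_subgroup_incl) (auto simp: X_def)
  then have X_eq: "X = range (dihedral_refl a b)"
    using dihedral_reflections[of a b] gen XT a(1) b(1) unfolding X_def by auto
  show ?thesis
  proof (rule that[of a b])
    show "canonical_generators G S (generate G {p, q}) = {a, b}"
    proof (intro equalityI subsetI)
      fix c assume "c \<in> canonical_generators G S (generate G {p, q})"
      then show "c \<in> {a, b}"
        using only[of c] unfolding canonical_generators_iff X_def by blast
    next
      fix c assume "c \<in> {a, b}"
      then show "c \<in> canonical_generators G S (generate G {p, q})"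
        using a(1) b(1) ca cb unfolding canonical_generators_iff X_def[symmetric] by blast
    qed
    have "dihedral_refl a b k \<in> X" for k
      by (simp add: X_eq)
    then show "cocycle a (dihedral_refl a b k) \<longleftrightarrow> dihedral_refl a b k = a"
      "cocycle b (dihedral_refl a b k) \<longleftrightarrow> dihedral_refl a b k = b" for k
      using ca cb by simp_all
    show "p \<in> range (dihedral_refl a b)" "q \<in> range (dihedral_refl a b)"
      using pX by (simp_all add: X_eq)
  qed (use a(1) b(1,2) XT in simp_all)
qed

end

section \<open>Reflection orders\<close>

lemma strictly_below_converse: "strictly_below (\<O>\<inverse>) x y \<longleftrightarrow> strictly_below \<O> y x"
  by (auto simp: strictly_below_def)

lemma strictly_below_linear:
  assumes "linear_order_on A \<O>" "x \<in> A" "y \<in> A" "x \<noteq> y"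
  shows "strictly_below \<O> x y \<longleftrightarrow> \<not> strictly_below \<O> y x"
  using assms unfolding strictly_below_def linear_order_on_def partial_order_on_def
    total_on_def antisym_def by blast

lemma strictly_below_trans:
  assumes "linear_order_on A \<O>" "strictly_below \<O> x y" "strictly_below \<O> y z"
  shows "strictly_below \<O> x z"
  using assms unfolding strictly_below_def linear_order_on_def partial_order_on_def preorder_on_def
    antisym_def trans_def by metis

lemma strictly_below_asym:
  assumes "linear_order_on A \<O>" "strictly_below \<O> x y"
  shows "\<not> strictly_below \<O> y x"
  using assms unfolding strictly_below_def linear_order_on_def partial_order_on_def
    antisym_def by blast

context coxeter
begin

text \<open>
  In terms of lengths: \<open>l(tr) < l(t)\<close> iff \<open>t\<close> lies strictly between \<open>r\<close> and \<open>trt\<close>. This is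
  all that is needed from a reflection order.
\<close>

definition cocycle_order :: "'a rel \<Rightarrow> bool" where
  "cocycle_order \<O> \<longleftrightarrow> linear_order_on T \<O> \<and>
    (\<forall>t\<in>T. \<forall>r\<in>T. r \<noteq> t \<longrightarrow>
      (cocycle t r \<longleftrightarrow> strictly_below \<O> r t \<noteq> strictly_below \<O> (t \<otimes> r \<otimes> t) t))"

lemma conj_neq:
  assumes "t \<in> T" "r \<in> T" "r \<noteq> t"
  shows "t \<otimes> r \<otimes> t \<noteq> t"
proof
  assume "t \<otimes> r \<otimes> t = t"
  then have "t \<otimes> (t \<otimes> r \<otimes> t) \<otimes> t = t \<otimes> t \<otimes> t" by simp
  then show False using assms by (simp add: m_assoc)
qed

lemma strictly_between_converse:
  assumes "linear_order_on T \<O>" "t \<in> T" "r \<in> T" "r \<noteq> t"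
  shows "(strictly_below (\<O>\<inverse>) r t \<noteq> strictly_below (\<O>\<inverse>) (t \<otimes> r \<otimes> t) t) \<longleftrightarrow>
    (strictly_below \<O> r t \<noteq> strictly_below \<O> (t \<otimes> r \<otimes> t) t)"
  using strictly_below_linear[OF assms(1), of r t] strictly_below_linear[OF assms(1), of "t \<otimes> r \<otimes> t" t]
    conj_neq[of t r] reflection_conj_reflection[of t r] assms
  by (auto simp: strictly_below_converse)

lemma cocycle_order_converse: "cocycle_order \<O> \<Longrightarrow> cocycle_order (\<O>\<inverse>)"
  unfolding cocycle_order_def using strictly_between_converse by simp

section \<open>A reflection order restricted to one dihedral subgroup\<close>

lemma dihedral_refl_swap:
  assumes "a \<in> T" "b \<in> T"
  shows "dihedral_refl b a k = dihedral_refl a b (- k - 1)"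
proof -
  have inv: "b \<otimes> a = inv (a \<otimes> b)"
    using assms by (simp add: inv_mult_group)
  have "dihedral_refl a b (- k - 1) = (a \<otimes> b) [^] (- k) \<otimes> (inv (a \<otimes> b) \<otimes> a)"
    using assms by (simp add: dihedral_refl_def int_pow_pred m_assoc)
  also have "inv (a \<otimes> b) \<otimes> a = b"
    using assms by (simp add: inv_mult_group m_assoc)
  also have "(a \<otimes> b) [^] (- k) = (b \<otimes> a) [^] k"
    using assms unfolding inv by (simp add: int_pow_neg int_pow_inv)
  finally show ?thesis
    by (simp add: dihedral_refl_def)
qed

lemma dihedral_refl_nat: "dihedral_refl a b (int k) = (a \<otimes> b) [^] k \<otimes> a"
  by (simp add: dihedral_refl_def int_pow_int)

context
  fixes a b
  assumes aT: "a \<in> T" and bT: "b \<in> T"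
    and cocycle_a: "\<And>k. cocycle a (dihedral_refl a b k) \<longleftrightarrow> dihedral_refl a b k = a"
    and cocycle_b: "\<And>k. cocycle b (dihedral_refl a b k) \<longleftrightarrow> dihedral_refl a b k = b"
begin

lemma dihedral_refl_rotate:
  "inv ((a \<otimes> b) [^] i) \<otimes> dihedral_refl a b j \<otimes> (a \<otimes> b) [^] i = dihedral_refl a b (j - 2 * i)"
  for i :: int
proof -
  have "inv ((a \<otimes> b) [^] i) = (a \<otimes> b) [^] (- i)"
    using aT bT by (simp add: int_pow_neg)
  then show ?thesis
    using aT bT by (simp add: rotation_mult_dihedral_refl dihedral_refl_mult_rotation)
qed

text \<open>Order 0 encodes infinite order, and divisibility by 0 is equality, so both cases are
  covered.\<close>

lemma dihedral_refl_eq_iff: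
  "dihedral_refl a b i = dihedral_refl a b j \<longleftrightarrow> int (ord (a \<otimes> b)) dvd i - j"
proof -
  have "dihedral_refl a b i = dihedral_refl a b j \<longleftrightarrow> (a \<otimes> b) [^] i = (a \<otimes> b) [^] j"
    using aT bT by (simp add: dihedral_refl_def)
  also have "\<dots> \<longleftrightarrow> int (ord (a \<otimes> b)) dvd i - j"
    using aT bT int_pow_eq[of "a \<otimes> b" i j] by (metis dvd_diff_commute m_closed reflection_closed)
  finally show ?thesis .
qed

text \<open>Relative to the subgroup, \<open>a\<close> and \<open>b\<close> have the inversions of
  simple reflections. So the inversions of their alternating product with 2k + 1 letters are its
  prefix reflections, of indices 0 to 2k, counted modulo 2.\<close>

lemma dihedral_cocycle:
  "cocycle (dihedral_refl a b (int k)) (dihedral_refl a b j) \<longleftrightarrow>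
    odd (\<Sum>i<2*k+1. of_bool (dihedral_refl a b j = dihedral_refl a b (int i)) :: nat)"
proof -
  have ac: "a \<in> carrier G" and bc: "b \<in> carrier G" using aT bT by auto
  have X: "t \<in> carrier G \<and> inv (a \<otimes> b) \<otimes> t \<otimes> (a \<otimes> b) \<in> range (dihedral_refl a b)"
    if "t \<in> range (dihedral_refl a b)" for t
  proof -
    obtain k where k: "t = dihedral_refl a b k" using \<open>t \<in> range _\<close> by blast
    have "inv (a \<otimes> b) \<otimes> t \<otimes> (a \<otimes> b) = dihedral_refl a b (k - 2 * 1)"
      using ac bc dihedral_refl_rotate[of 1 k] by (simp add: k)
    then show ?thesis using aT bT k by auto
  qed
  have "cocycle ((a \<otimes> b) [^] k) (dihedral_refl a b j) \<longleftrightarrow>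
    odd (\<Sum>i<2*k. of_bool (dihedral_refl a b j = (a \<otimes> b) [^] i \<otimes> a) :: nat)"
  proof (rule alternating_cocycle[where E = "\<lambda>k. cocycle ((a \<otimes> b) [^] k)" and X = "range (dihedral_refl a b)"])
    fix k t assume t: "t \<in> range (dihedral_refl a b)"
    have tc: "t \<in> carrier G" using X[OF t] by simp
    have "cocycle ((a \<otimes> b) [^] Suc k) t \<longleftrightarrow>
        cocycle (a \<otimes> b) t \<noteq> cocycle ((a \<otimes> b) [^] k) (inv (a \<otimes> b) \<otimes> t \<otimes> (a \<otimes> b))"
      using ac bc tc nat_pow_Suc2[of "a \<otimes> b" k] cocycle_mult[of "a \<otimes> b" "(a \<otimes> b) [^] k" t] by simp
    moreover have "cocycle (a \<otimes> b) t \<longleftrightarrow> cocycle a t \<noteq> cocycle b (a \<otimes> t \<otimes> a)"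
      using ac bc tc aT cocycle_mult[of a b t] by simp
    moreover have "cocycle a t \<longleftrightarrow> t = a"
    proof -
      obtain l where "t = dihedral_refl a b l" using t by blast
      then show ?thesis using cocycle_a[of l] by simp
    qed
    moreover have "a \<otimes> t \<otimes> a \<in> range (dihedral_refl a b)"
    proof -
      obtain k where k: "t = dihedral_refl a b k" using t by blast
      have "a \<otimes> t \<otimes> a = dihedral_refl a b (0 - k + 0)"
        unfolding k using dihedral_refl_mult3[OF aT bT, of 0 k 0] dihedral_refl_0[OF aT bT] by simp
      then show ?thesis by blast
    qed
    then obtain l where "a \<otimes> t \<otimes> a = dihedral_refl a b l" by blast
    then have "cocycle b (a \<otimes> t \<otimes> a) \<longleftrightarrow> a \<otimes> t \<otimes> a = b"
      using cocycle_b[of l] by simp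
    ultimately show "cocycle ((a \<otimes> b) [^] Suc k) t \<longleftrightarrow>
      ((t = a) \<noteq> ((a \<otimes> t \<otimes> a = b) \<noteq>
        cocycle ((a \<otimes> b) [^] k) (inv (a \<otimes> b) \<otimes> t \<otimes> (a \<otimes> b))))"
      by blast
  qed (use X aT bT in auto)
  moreover have "cocycle (dihedral_refl a b (int k)) (dihedral_refl a b j) \<longleftrightarrow>
      cocycle ((a \<otimes> b) [^] k) (dihedral_refl a b j) \<noteq> cocycle a (dihedral_refl a b (j - 2 * int k))"
    using ac bc aT bT cocycle_mult[of "(a \<otimes> b) [^] k" a "dihedral_refl a b j"] dihedral_refl_rotate[of "int k" j]
    by (simp add: dihedral_refl_nat int_pow_int)
  moreover have "cocycle a (dihedral_refl a b (j - 2 * int k)) \<longleftrightarrow>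
      dihedral_refl a b j = dihedral_refl a b (int (2 * k))"
    using dihedral_refl_eq_iff[of "j - 2 * int k" 0] dihedral_refl_eq_iff[of j "int (2 * k)"]
    by (simp add: cocycle_a dihedral_refl_0[OF aT bT])
  ultimately show ?thesis
    unfolding dihedral_refl_nat by simp
qed

text \<open>After reduction modulo \<open>m\<close> the order is that of the residues. The indices 0
  to 2k' meet the class of j' in j' and possibly in j' + m, and this parity is compared with the
  position of the residue of 2k' - j'.\<close>

lemma dihedral_order_finite:
  assumes lin: "linear_order_on T \<O>" and inc: "dihedral_increasing G \<O> a b"
    and m: "ord (a \<otimes> b) \<noteq> 0" and neq: "dihedral_refl a b j \<noteq> dihedral_refl a b k"
  shows "cocycle (dihedral_refl a b k) (dihedral_refl a b j) \<longleftrightarrow>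
    strictly_below \<O> (dihedral_refl a b j) (dihedral_refl a b k) \<noteq>
    strictly_below \<O> (dihedral_refl a b (2 * k - j)) (dihedral_refl a b k)"
proof -
  define m where "m = ord (a \<otimes> b)"
  have m0: "m > 0" using assms(3) by (simp add: m_def)
  let ?R = "dihedral_refl a b"
  have eq: "?R x = ?R y \<longleftrightarrow> int m dvd x - y" for x y
    by (simp add: dihedral_refl_eq_iff m_def)
  have red: "?R x = ?R (int (nat (x mod int m)))" "nat (x mod int m) < m" for x
    using m0 by (simp_all add: eq nat_less_iff)
  obtain j' k' where j': "j' < m" "?R j = ?R (int j')" and k': "k' < m" "?R k = ?R (int k')"
    using red[of j] red[of k] by blast
  have R2: "?R (2 * k - j) = ?R (2 * int k' - int j')"
  proof -
    have "int m dvd 2 * (k - int k') - (j - int j')"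
      using j'(2) k'(2) unfolding eq by (rule dvd_diff[OF dvd_mult, rotated])
    then show ?thesis by (simp add: eq algebra_simps)
  qed
  have less: "strictly_below \<O> (?R (int x)) (?R (int y)) \<longleftrightarrow> x < y" if "x < m" "y < m" for x y
  proof -
    have *: "strictly_below \<O> (?R (int x)) (?R (int y))" if "x < y" "y < m" for x y
      using inc that m0 by (simp add: dihedral_increasing_def dihedral_refl_nat m_def)
    show ?thesis
      using *[of x y] *[of y x] that strictly_below_asym[OF lin, of "?R (int y)" "?R (int x)"]
      by (cases x y rule: linorder_cases) (auto simp: strictly_below_def)
  qed
  have neq': "j' \<noteq> k'" using neq j' k' by auto
  \<comment> \<open>Here \<open>i\<close> is at most 2m - 2, so the quotient of
    \<open>j' - i\<close> by \<open>m\<close> can only be 0 or -1.\<close>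
  have "?R (int j') = ?R (int i) \<longleftrightarrow> i = j' \<or> i = j' + m" if "i < 2 * k' + 1" for i
  proof
    assume "?R (int j') = ?R (int i)"
    then have d: "int m dvd int j' - int i" by (simp add: eq)
    then obtain c where c: "int j' - int i = int m * c" by blast
    have "- 2 * int m < int m * c" "int m * c < int m * 1"
      using c j'(1) k'(1) that by linarith+
    then have "int m * (- 2) < int m * c" by linarith
    then have "- 2 < c" "c < 1"
      using m0 \<open>int m * c < int m * 1\<close> mult_less_cancel_left_pos[of "int m" "- 2" c]
        mult_less_cancel_left_pos[of "int m" c 1] by simp_all
    then have "c = 0 \<or> c = -1" by linarith
    then show "i = j' \<or> i = j' + m" using c by auto
  qed (auto simp: eq)
  then have "(\<Sum>i<2*k'+1. of_bool (?R (int j') = ?R (int i)) :: nat) =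
      (\<Sum>i<2*k'+1. (if i = j' then 1 else 0) + (if i = j' + m then 1 else 0))"
    using m0 by (intro sum.cong) auto
  also have "\<dots> = of_bool (j' \<le> 2 * k') + of_bool (j' + m \<le> 2 * k')"
    by (simp add: sum.distrib)
  finally have coc: "cocycle (?R k) (?R j) \<longleftrightarrow> (j' \<le> 2 * k') \<noteq> (j' + m \<le> 2 * k')"
    using j' k' by (simp add: dihedral_cocycle)
  have ord1: "strictly_below \<O> (?R j) (?R k) \<longleftrightarrow> j' < k'"
    using less j' k' by simp
  have ord2: "strictly_below \<O> (?R (2 * k - j)) (?R k) \<longleftrightarrow> x < k'"
    if "x < m" "int m dvd 2 * int k' - int j' - int x" for x
  proof -
    have "?R (2 * k - j) = ?R (int x)"
      unfolding R2 using that(2) by (simp add: eq)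
    then show ?thesis using less[OF that(1) k'(1)] k' by simp
  qed
  \<comment> \<open>The residue of 2k' - j' is obtained by adding \<open>m\<close>, by doing
    nothing, or by subtracting \<open>m\<close>, respectively.\<close>
  consider "2 * k' < j'" | "j' \<le> 2 * k'" "2 * k' - j' < m" | "j' \<le> 2 * k'" "j' + m \<le> 2 * k'"
    by linarith
  then show ?thesis
  proof cases
    case 1
    have "int m dvd 2 * int k' - int j' - int (2 * k' + m - j')"
      using 1 j'(1) by (simp add: of_nat_diff)
    then show ?thesis
      using ord2[of "2 * k' + m - j'"] 1 j' k' coc ord1 by simp
  next
    case 2
    have "int m dvd 2 * int k' - int j' - int (2 * k' - j')"
      using 2 by (simp add: of_nat_diff)
    then show ?thesis
      using ord2[of "2 * k' - j'"] 2 j' k' coc ord1 neq' by auto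
  next
    case 3
    have "int m dvd 2 * int k' - int j' - int (2 * k' - j' - m)"
      using 3 by (simp add: of_nat_diff)
    then show ?thesis
      using ord2[of "2 * k' - j' - m"] 3 j' k' coc ord1 neq' by auto
  qed
qed

text \<open>In the increasing order the nonnegative indices come before all negative ones, so the
  elements below index k are those of index 0 to k - 1. The inversions have index 0 to 2k, an
  interval symmetric about k: exactly one of j and 2k - j is below k if j lies in it, and neither
  otherwise.\<close>

lemma dihedral_order_infinite_nat:
  assumes lin: "linear_order_on T \<O>" and inc: "dihedral_increasing G \<O> a b"
    and m: "ord (a \<otimes> b) = 0" and neq: "j \<noteq> int k"
  shows "cocycle (dihedral_refl a b (int k)) (dihedral_refl a b j) \<longleftrightarrow>
    strictly_below \<O> (dihedral_refl a b j) (dihedral_refl a b (int k)) \<noteq>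
    strictly_below \<O> (dihedral_refl a b (2 * int k - j)) (dihedral_refl a b (int k))"
proof -
  let ?R = "dihedral_refl a b"
  have eq: "?R x = ?R y \<longleftrightarrow> x = y" for x y
    by (simp add: dihedral_refl_eq_iff m)
  have "(\<Sum>i<2*k+1. of_bool (?R j = ?R (int i)) :: nat) = (\<Sum>i<2*k+1. if i = nat j \<and> 0 \<le> j then 1 else 0)"
    by (intro sum.cong) (auto simp: eq)
  also have "\<dots> = of_bool (0 \<le> j \<and> j \<le> 2 * int k)"
    by (cases "0 \<le> j") auto
  finally have coc: "cocycle (?R (int k)) (?R j) \<longleftrightarrow> 0 \<le> j \<and> j \<le> 2 * int k"
    by (simp add: dihedral_cocycle)
  have *: "strictly_below \<O> (?R (int x)) (?R (int y))" if "x < y" for x y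
    using inc that m by (simp add: dihedral_increasing_def dihedral_refl_nat)
  have neg: "strictly_below \<O> (?R (int x)) (?R y)" if "y < 0" for x y
  proof -
    have "?R y = (b \<otimes> a) [^] nat (- y - 1) \<otimes> b"
      using dihedral_refl_swap[OF aT bT, of "- y - 1"] that dihedral_refl_nat[of b a "nat (- y - 1)"] by simp
    then show ?thesis
      using inc m by (simp add: dihedral_increasing_def dihedral_refl_nat)
  qed
  have below: "strictly_below \<O> (?R y) (?R (int k)) \<longleftrightarrow> 0 \<le> y \<and> y < int k" for y
  proof (cases "0 \<le> y")
    case True
    then obtain x where "y = int x" by (metis nonneg_int_cases)
    then show ?thesis
      using *[of x k] *[of k x] strictly_below_asym[OF lin, of "?R (int k)" "?R (int x)"]
      by (cases x k rule: linorder_cases) (auto simp: strictly_below_def)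
  next
    case False
    then show ?thesis using neg[of y k] strictly_below_asym[OF lin, of "?R (int k)" "?R y"] by auto
  qed
  show ?thesis
    unfolding coc below using neq by auto
qed

end

text \<open>For infinite order the increasing sequence is carried to itself by exchanging
  \<open>a\<close> and \<open>b\<close> and reversing \<O>. This moves a negative index k to -k - 1,
  which is nonnegative, and betweenness does not see the reversal.\<close>

lemma dihedral_order:
  assumes aT: "a \<in> T" and bT: "b \<in> T"
    and cocycle_a: "\<And>k. cocycle a (dihedral_refl a b k) \<longleftrightarrow> dihedral_refl a b k = a"
    and cocycle_b: "\<And>k. cocycle b (dihedral_refl a b k) \<longleftrightarrow> dihedral_refl a b k = b"
    and lin: "linear_order_on T \<O>" and inc: "dihedral_increasing G \<O> a b"
    and neq: "dihedral_refl a b j \<noteq> dihedral_refl a b k"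
  shows "cocycle (dihedral_refl a b k) (dihedral_refl a b j) \<longleftrightarrow>
    strictly_below \<O> (dihedral_refl a b j) (dihedral_refl a b k) \<noteq>
    strictly_below \<O> (dihedral_refl a b (2 * k - j)) (dihedral_refl a b k)"
proof (cases "ord (a \<otimes> b) = 0")
  case False
  then show ?thesis
    using dihedral_order_finite[OF aT bT cocycle_a cocycle_b lin inc] neq by blast
next
  case m: True
  show ?thesis
  proof (cases "0 \<le> k")
    case True
    then obtain k' where "k = int k'" by (metis nonneg_int_cases)
    then show ?thesis
      using dihedral_order_infinite_nat[OF aT bT cocycle_a cocycle_b lin inc m, of j k'] neq by auto
  next
    case False
    define k' where "k' = nat (- k - 1)"
    have k: "k = - int k' - 1" using False by (simp add: k'_def)
    have inv: "b \<otimes> a = inv (a \<otimes> b)"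
      using aT bT by (simp add: inv_mult_group)
    have m': "ord (b \<otimes> a) = 0" 
      using m aT bT unfolding inv by simp
    have inc': "dihedral_increasing G (\<O>\<inverse>) b a"
      using inc m m' unfolding dihedral_increasing_def by (simp add: strictly_below_converse)
    have lin': "linear_order_on T (\<O>\<inverse>)" using lin by simp
    have R: "dihedral_refl a b x = dihedral_refl b a (- x - 1)" for x
      using dihedral_refl_swap[OF aT bT, of "- x - 1"] by simp
    have "- j - 1 \<noteq> int k'"
    proof
      assume "- j - 1 = int k'"
      then have "j = k" using k by simp
      with neq show False by simp
    qed
    have "cocycle b (dihedral_refl b a x) \<longleftrightarrow> dihedral_refl b a x = b"
      "cocycle a (dihedral_refl b a x) \<longleftrightarrow> dihedral_refl b a x = a" for x
      using cocycle_a cocycle_b by (simp_all add: dihedral_refl_swap[OF aT bT])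
    from dihedral_order_infinite_nat[OF bT aT this lin' inc' m' \<open>- j - 1 \<noteq> int k'\<close>]
    have "cocycle (dihedral_refl a b k) (dihedral_refl a b j) \<longleftrightarrow>
      strictly_below (\<O>\<inverse>) (dihedral_refl a b j) (dihedral_refl a b k) \<noteq>
      strictly_below (\<O>\<inverse>) (dihedral_refl a b (2 * k - j)) (dihedral_refl a b k)"
      by (simp add: R k algebra_simps)
    moreover have "dihedral_refl a b (2 * k - j) = dihedral_refl a b k \<otimes> dihedral_refl a b j \<otimes> dihedral_refl a b k"
      using dihedral_refl_mult3[OF aT bT, of k j k] by (simp add: algebra_simps)
    ultimately show ?thesis
      using strictly_between_converse[OF lin dihedral_refl_reflection[OF aT bT] dihedral_refl_reflection[OF aT bT] neq]
      by simp
  qed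
qed

text \<open>The condition on \<open>t\<close> and \<open>r\<close> takes place inside the dihedral
  subgroup they generate, and betweenness is insensitive to whether \<O> or its reverse increases
  from \<open>a\<close> to \<open>b\<close>.\<close>

lemma reflection_order_cocycle_order:
  assumes "reflection_order G S \<O>"
  shows "cocycle_order \<O>"
  unfolding cocycle_order_def
proof (intro conjI ballI impI)
  show lin: "linear_order_on T \<O>"
    using assms by (simp add: reflection_order_def)
  fix t r assume t: "t \<in> T" and r: "r \<in> T" and neq: "r \<noteq> t"
  let ?H = "generate G {t, r}"
  show "cocycle t r \<longleftrightarrow> strictly_below \<O> r t \<noteq> strictly_below \<O> (t \<otimes> r \<otimes> t) t"
  proof (rule canonical_generators_dihedral[OF t r neq[symmetric]])
    fix a b
    assume ab: "a \<noteq> b" "canonical_generators G S ?H = {a, b}" "a \<in> T" "b \<in> T"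
      "t \<in> range (dihedral_refl a b)" "r \<in> range (dihedral_refl a b)"
      "\<And>k. cocycle a (dihedral_refl a b k) \<longleftrightarrow> dihedral_refl a b k = a"
      "\<And>k. cocycle b (dihedral_refl a b k) \<longleftrightarrow> dihedral_refl a b k = b"
    obtain j k where jk: "r = dihedral_refl a b j" "t = dihedral_refl a b k"
      using ab(5,6) by blast
    have trt: "t \<otimes> r \<otimes> t = dihedral_refl a b (2 * k - j)"
      unfolding jk dihedral_refl_mult3[OF ab(3,4)] by (simp add: algebra_simps)
    have "dihedral_reflection_subgroup G S ?H"
      unfolding dihedral_reflection_subgroup_def
      by (intro bexI[of _ t] bexI[of _ r] conjI t r neq[symmetric]) (rule HOL.refl)
    moreover have "\<forall>H a b. dihedral_reflection_subgroup G S H \<and> a \<noteq> b \<and>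
        canonical_generators G S H = {a, b} \<longrightarrow>
        dihedral_increasing G \<O> a b \<or> dihedral_increasing G (\<O>\<inverse>) a b"
      using assms unfolding reflection_order_def by (rule conjunct2)
    ultimately have "dihedral_increasing G \<O> a b \<or> dihedral_increasing G (\<O>\<inverse>) a b"
      using ab(1,2) by simp
    moreover have neq': "dihedral_refl a b j \<noteq> dihedral_refl a b k"
      using neq jk by simp
    moreover have lin': "linear_order_on T (\<O>\<inverse>)" using lin by simp
    ultimately consider
        "cocycle t r \<longleftrightarrow> strictly_below \<O> r t \<noteq> strictly_below \<O> (t \<otimes> r \<otimes> t) t"
      | "cocycle t r \<longleftrightarrow> strictly_below (\<O>\<inverse>) r t \<noteq> strictly_below (\<O>\<inverse>) (t \<otimes> r \<otimes> t) t"
      using dihedral_order[OF ab(3,4,7,8) lin _ neq'] dihedral_order[OF ab(3,4,7,8) lin' _ neq']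
      unfolding jk trt[unfolded jk] by blast
    then show "cocycle t r \<longleftrightarrow> strictly_below \<O> r t \<noteq> strictly_below \<O> (t \<otimes> r \<otimes> t) t"
      by cases (use strictly_between_converse[OF lin t r neq] in blast)+
  qed
qed

end

section \<open>Counting increasing chains\<close>

lemma linear_order_finite_min:
  assumes "linear_order_on B \<O>" "finite A" "A \<noteq> {}" "A \<subseteq> B"
  obtains t where "t \<in> A" "\<And>r. r \<in> A \<Longrightarrow> r \<noteq> t \<Longrightarrow> strictly_below \<O> t r"
proof -
  have "\<exists>t\<in>A. \<forall>r\<in>A. r \<noteq> t \<longrightarrow> strictly_below \<O> t r"
    using assms(2-4)
  proof (induction rule: finite_ne_induct)
    case (insert x A)
    then obtain t where t: "t \<in> A" "\<forall>r\<in>A. r \<noteq> t \<longrightarrow> strictly_below \<O> t r" by auto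
    show ?case
    proof (cases "strictly_below \<O> x t")
      case True
      then have "strictly_below \<O> x r" if "r \<in> A" for r
        using that t strictly_below_trans[OF assms(1) True, of r] by (cases "r = t") auto
      then show ?thesis by (intro bexI[of _ x]) auto
    next
      case False
      moreover have "x \<noteq> t" using t insert by auto
      ultimately have "strictly_below \<O> t x"
        using strictly_below_linear[OF assms(1), of x t] t insert by auto
      then show ?thesis using t by (intro bexI[of _ t]) auto
    qed
  qed simp
  then show ?thesis using that by blast
qed

context coxeter
begin

definition below :: "'a \<Rightarrow> 'a set" where
  "below v = {x. (bruhat_edge G S)\<^sup>*\<^sup>* x v}"

lemma bruhat_edge_mult:
  assumes "x \<in> carrier G" "t \<in> T"
  shows "bruhat_edge G S x (x \<otimes> t) \<longleftrightarrow> up x t"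
  using assms by (simp add: bruhat_edge_def up_def flip: m_assoc)

lemma bruhat_edgeE:
  assumes "bruhat_edge G S x y"
  obtains t where "t \<in> T" "y = x \<otimes> t" "up x t" "x \<in> carrier G"
  using assms that[of "inv x \<otimes> y"] by (auto simp: bruhat_edge_def up_def)

lemma below_self [simp]: "v \<in> below v"
  by (simp add: below_def)

lemma below_step: "bruhat_edge G S x y \<Longrightarrow> y \<in> below v \<Longrightarrow> x \<in> below v"
  by (simp add: below_def converse_rtranclp_into_rtranclp)

lemma below_mono: "y \<in> below v \<Longrightarrow> below y \<subseteq> below v"
  by (auto simp: below_def)

lemma below_carrier: "v \<in> carrier G \<Longrightarrow> below v \<subseteq> carrier G"
proof
  fix x assume "v \<in> carrier G" "x \<in> below v"
  then have "(bruhat_edge G S)\<^sup>*\<^sup>* x v" "v \<in> carrier G" by (auto simp: below_def)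
  then show "x \<in> carrier G"
    by (cases rule: converse_rtranclpE) (auto simp: bruhat_edge_def)
qed

text \<open>Edges into \<open>v\<close> correspond to reflections in the cocycle of
  \<open>inv v\<close>, of which there are finitely many.\<close>

lemma finite_below: "v \<in> carrier G \<Longrightarrow> finite (below v)"
proof (induction "len v" arbitrary: v rule: less_induct)
  case less
  have sub: "below v \<subseteq> insert v (\<Union>x\<in>{x. bruhat_edge G S x v}. below x)"
  proof
    fix x assume "x \<in> below v"
    then have "(bruhat_edge G S)\<^sup>*\<^sup>* x v" by (simp add: below_def)
    then consider "x = v" | y where "(bruhat_edge G S)\<^sup>*\<^sup>* x y" "bruhat_edge G S y v"
      by (rule rtranclp.cases) metis+
    then show "x \<in> insert v (\<Union>x\<in>{x. bruhat_edge G S x v}. below x)"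
    proof cases
      case 2
      then show ?thesis unfolding below_def by blast
    qed simp
  qed
  have "{x. bruhat_edge G S x v} \<subseteq> (\<lambda>t. v \<otimes> t) ` {t \<in> carrier G. cocycle (inv v) t}"
  proof
    fix x assume "x \<in> {x. bruhat_edge G S x v}"
    then have "bruhat_edge G S x v" by simp
    then obtain t where t: "t \<in> T" "v = x \<otimes> t" "up x t" "x \<in> carrier G"
      by (rule bruhat_edgeE)
    have x: "x = v \<otimes> t" using t by (simp add: m_assoc)
    have "len x < len v" using t(2,3) by (simp add: up_def)
    then have "\<not> up v t" unfolding up_def x[symmetric] by simp
    then have "cocycle (inv v) t" using up_iff t(1) less.prems by simp
    with t(1) show "x \<in> (\<lambda>t. v \<otimes> t) ` {t \<in> carrier G. cocycle (inv v) t}"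
      by (intro image_eqI[of x _ t] x) simp
  qed
  then have "finite {x. bruhat_edge G S x v}"
    by (rule finite_subset) (intro finite_imageI finite_cocycle inv_closed less.prems)
  moreover have "finite (below x)" if "bruhat_edge G S x v" for x
    using less.hyps[of x] that by (simp add: bruhat_edge_def)
  ultimately have "finite (insert v (\<Union>x\<in>{x. bruhat_edge G S x v}. below x))" by simp
  with sub show ?case by (rule finite_subset)
qed

text \<open>By the cocycle identity the factor \<open>s\<close> changes the cocycle of the inverse
  at the single reflection \<open>x^-1 s x\<close>.\<close>

lemma up_left_mult:
  assumes "x \<in> carrier G" "t \<in> T" "s \<in> S"
  shows "up (s \<otimes> x) t \<longleftrightarrow> up x t \<noteq> (t = inv x \<otimes> s \<otimes> x)"
proof -
  have "cocycle (inv (s \<otimes> x)) t \<longleftrightarrow> cocycle (inv x) t \<noteq> cocycle s (x \<otimes> t \<otimes> inv x)"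
    using assms cocycle_mult[of "inv x" s t] by (simp add: inv_mult_group)
  also have "cocycle s (x \<otimes> t \<otimes> inv x) \<longleftrightarrow> x \<otimes> t \<otimes> inv x = s"
    using assms by (simp add: cocycle_S)
  also have "\<dots> \<longleftrightarrow> t = inv x \<otimes> s \<otimes> x"
    using assms conj_eq_iff[of "inv x" t s] by simp
  finally show ?thesis
    using up_iff[of "s \<otimes> x" t] up_iff[of x t] assms by fastforce
qed

lemma len_left_mult_less:
  assumes "x \<in> carrier G" "s \<in> S"
  shows "len (s \<otimes> x) < len x \<longleftrightarrow> \<not> len x < len (s \<otimes> x)"
proof -
  have t: "inv x \<otimes> s \<otimes> x \<in> T"
    using assms by (intro reflection_conj') (auto intro: S_reflection)
  have *: "x \<otimes> (inv x \<otimes> s \<otimes> x) = s \<otimes> x" "s \<otimes> x \<otimes> (inv x \<otimes> s \<otimes> x) = x"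
    using assms by (simp_all add: m_assoc)
  show ?thesis
    using up_left_mult[OF assms(1) t assms(2)] unfolding up_def * by simp
qed

text \<open>
  The restriction to \<open>u t\<close> in \<open>below v\<close> only drops terms that vanish; it keeps the sum finite
  when \<open>A\<close> is infinite.
\<close>

fun chains :: "'a rel \<Rightarrow> 'a set \<Rightarrow> nat \<Rightarrow> 'a \<Rightarrow> 'a \<Rightarrow> nat" where
  "chains \<O> A 0 u v = of_bool (u = v)"
| "chains \<O> A (Suc n) u v = (\<Sum>t | t \<in> A \<and> up u t \<and> u \<otimes> t \<in> below v.
     chains \<O> {r \<in> A. strictly_below \<O> t r} n (u \<otimes> t) v)"

declare chains.simps(2) [simp del]

text \<open>Multiplication by the variable in the generating function of \<open>chains\<close> over
  the length \<open>n\<close>, whence the value 0 at \<open>n = 0\<close>.\<close>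

definition chains_pred :: "'a rel \<Rightarrow> 'a set \<Rightarrow> nat \<Rightarrow> 'a \<Rightarrow> 'a \<Rightarrow> nat" where
  "chains_pred \<O> A n u v = (case n of 0 \<Rightarrow> 0 | Suc m \<Rightarrow> chains \<O> A m u v)"

lemma chains_pred_simps [simp]:
  "chains_pred \<O> A 0 u v = 0" "chains_pred \<O> A (Suc n) u v = chains \<O> A n u v"
  by (simp_all add: chains_pred_def)

lemma chains_nonzero_below:
  assumes "chains \<O> A n u v \<noteq> 0" "A \<subseteq> T" "u \<in> carrier G"
  shows "u \<in> below v"
proof (cases n)
  case 0
  then show ?thesis using assms by (auto split: if_splits)
next
  case (Suc m)
  have "{t. t \<in> A \<and> up u t \<and> u \<otimes> t \<in> below v} \<noteq> {}"
  proof
    assume "{t. t \<in> A \<and> up u t \<and> u \<otimes> t \<in> below v} = {}"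
    with assms(1) show False unfolding Suc chains.simps(2) by (simp only: sum.empty)
  qed
  then obtain t where "t \<in> A" "up u t" "u \<otimes> t \<in> below v" by blast
  then show ?thesis
    using assms bruhat_edge_mult[of u t] below_step[of u "u \<otimes> t" v] by blast
qed

lemma chains_empty: "chains \<O> {} n u v = of_bool (n = 0 \<and> u = v)"
  by (cases n) (auto simp: chains.simps(2))

text \<open>A chain either avoids the smallest label \<open>t\<close> or uses it at its first step,
  so the matrix for \<open>A\<close> factors through the one for \<open>A - {t}\<close>.\<close>

lemma chains_min:
  assumes lin: "linear_order_on T \<O>" and A: "finite A" "A \<subseteq> T" "t \<in> A"
    and min: "\<And>r. r \<in> A \<Longrightarrow> r \<noteq> t \<Longrightarrow> strictly_below \<O> t r" and u: "u \<in> carrier G"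
  shows "chains \<O> A n u v =
    chains \<O> (A - {t}) n u v + of_bool (up u t) * chains_pred \<O> (A - {t}) n (u \<otimes> t) v"
proof (cases n)
  case (Suc m)
  let ?P = "\<lambda>t. up u t \<and> u \<otimes> t \<in> below v"
  let ?f = "\<lambda>t'. chains \<O> {r \<in> A. strictly_below \<O> t' r} m (u \<otimes> t') v"
  have split: "{t' \<in> A. ?P t'} = {t' \<in> A - {t}. ?P t'} \<union> {t' \<in> {t}. ?P t'}"
    using A by auto
  have "chains \<O> A n u v = (\<Sum>t' | t' \<in> A - {t} \<and> ?P t'. ?f t') + (\<Sum>t' | t' \<in> {t} \<and> ?P t'. ?f t')"
    unfolding Suc chains.simps split using A by (intro sum.union_disjoint) auto
  also have "(\<Sum>t' | t' \<in> A - {t} \<and> ?P t'. ?f t') = chains \<O> (A - {t}) n u v"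
    unfolding Suc chains.simps
  proof (intro sum.cong HOL.refl)
    fix t' assume "t' \<in> {t' \<in> A - {t}. ?P t'}"
    then have "{r \<in> A. strictly_below \<O> t' r} = {r \<in> A - {t}. strictly_below \<O> t' r}"
      using min[of t'] strictly_below_asym[OF lin, of t t'] by auto
    then show "?f t' = chains \<O> {r \<in> A - {t}. strictly_below \<O> t' r} m (u \<otimes> t') v" by simp
  qed
  also have "{r \<in> A. strictly_below \<O> t r} = A - {t}"
    using min by (auto simp: strictly_below_def)
  then have "(\<Sum>t' | t' \<in> {t} \<and> ?P t'. ?f t') = of_bool (?P t) * chains \<O> (A - {t}) m (u \<otimes> t) v"
    by (cases "?P t") (auto simp: conj_commute cong: conj_cong)
  also have "\<dots> = of_bool (up u t) * chains \<O> (A - {t}) m (u \<otimes> t) v"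
  proof -
    have "A - {t} \<subseteq> T" "u \<otimes> t \<in> carrier G" using A u by auto
    then have "u \<otimes> t \<notin> below v \<Longrightarrow> chains \<O> (A - {t}) m (u \<otimes> t) v = 0"
      using chains_nonzero_below by blast
    then show ?thesis by auto
  qed
  finally show ?thesis by (simp add: Suc)
qed simp

lemma chains_pred_min:
  assumes "linear_order_on T \<O>" "finite A" "A \<subseteq> T" "t \<in> A"
    "\<And>r. r \<in> A \<Longrightarrow> r \<noteq> t \<Longrightarrow> strictly_below \<O> t r" "u \<in> carrier G"
  shows "chains_pred \<O> A n u v = chains_pred \<O> (A - {t}) n u v +
    of_bool (up u t) * chains_pred \<O> (A - {t}) (n - 1) (u \<otimes> t) v"
  using chains_min[OF assms] by (cases n) auto

text \<open>
  Left multiplication by \<open>s\<close> acts on the span of the group in two ways: by the Hecke algebra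
  rule for the length function, and by the rule for the length function twisted by the
  reflections in \<open>A\<close>. The matrix of chains with labels in \<open>A\<close> intertwines them. Enlarging \<open>A\<close>
  by one reflection \<open>t\<close> uses exactly the order condition on \<open>t\<close>, \<open>r\<close>, \<open>trt\<close> with \<open>r = x\<^sup>-\<^sup>1 s x\<close>.
\<close>

lemma chains_intertwine:
  assumes ord: "cocycle_order \<O>" and s: "s \<in> S"
    and V: "V \<subseteq> carrier G" "\<And>x. x \<in> V \<Longrightarrow> s \<otimes> x \<in> V"
      "\<And>x y. bruhat_edge G S x y \<Longrightarrow> y \<in> V \<Longrightarrow> x \<in> V"
    and L: "finite L" "L \<subseteq> T" "\<And>x. x \<in> V \<Longrightarrow> inv x \<otimes> s \<otimes> x \<in> L"
    and "A \<subseteq> L" "\<And>t r. t \<in> A \<Longrightarrow> r \<in> L \<Longrightarrow> strictly_below \<O> t r \<Longrightarrow> r \<in> A"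
    and "x \<in> carrier G" and y: "y \<in> V"
  shows "chains \<O> A n x (s \<otimes> y) + of_bool (len (s \<otimes> y) < len y) * chains_pred \<O> A n x y =
    chains \<O> A n (s \<otimes> x) y +
      of_bool ((len (s \<otimes> x) < len x) \<noteq> (inv x \<otimes> s \<otimes> x \<in> A)) * chains_pred \<O> A n x y"
proof -
  have lin: "linear_order_on T \<O>" using ord by (simp add: cocycle_order_def)
  have yc: "y \<in> carrier G" using V y by blast
  have below_V: "z \<in> V" if "z \<in> below w" "w \<in> V" for z w
  proof -
    have "(bruhat_edge G S)\<^sup>*\<^sup>* z w" using that by (simp add: below_def)
    then show ?thesis using that(2)
      by (induction rule: converse_rtranclp_induct) (use V in blast)+
  qed
  have "finite A" using assms by (auto intro: finite_subset)
  then show ?thesis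
    using assms(9-11)
  proof (induction "card A" arbitrary: A n x)
    \<comment> \<open>The matrix for the empty set is the identity, and without labels the two
      actions agree.\<close>
    case 0
    then have "A = {}" by simp
    have "x = s \<otimes> y \<longleftrightarrow> s \<otimes> x = y"
      using s yc \<open>x \<in> carrier G\<close> by auto
    then show ?case
      unfolding \<open>A = {}\<close> by (cases n) (auto simp: chains_empty)
  next
    case (Suc k)
    then have "A \<noteq> {}" and AT: "A \<subseteq> T" using L by auto
    obtain t where t: "t \<in> A" "\<And>r. r \<in> A \<Longrightarrow> r \<noteq> t \<Longrightarrow> strictly_below \<O> t r"
      using linear_order_finite_min[OF lin \<open>finite A\<close> \<open>A \<noteq> {}\<close> AT] by blast
    define A' where "A' = A - {t}"
    have tT: "t \<in> T" and tc: "t \<in> carrier G" using t AT by auto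
    have A'_iff: "r \<in> A' \<longleftrightarrow> strictly_below \<O> t r" if "r \<in> L" for r
      using t that Suc.prems(3)[of t r] by (auto simp: A'_def strictly_below_def)
    have xc: "x \<in> carrier G" by fact
    define e where "e = (\<lambda>A x. (len (s \<otimes> x) < len x) \<noteq> (inv x \<otimes> s \<otimes> x \<in> A))"
    let ?C = "chains \<O> A'" and ?P = "chains_pred \<O> A'"
    let ?ey = "of_bool (len (s \<otimes> y) < len y) :: nat"
    have IH: "?C n x (s \<otimes> y) + ?ey * ?P n x y = ?C n (s \<otimes> x) y + of_bool (e A' x) * ?P n x y"
      if "x \<in> carrier G" for n x
      unfolding e_def
    proof (rule Suc.hyps(1))
      show "k = card A'" using Suc.hyps(2) t Suc.prems(1) by (simp add: A'_def)
      show "finite A'" "A' \<subseteq> L" using Suc.prems by (auto simp: A'_def)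
      show "r \<in> A'" if "t' \<in> A'" "r \<in> L" "strictly_below \<O> t' r" for t' r
        using that Suc.prems(3)[of t' r] t(2)[of t'] strictly_below_asym[OF lin, of t t']
        by (auto simp: A'_def)
    qed fact
    have IHP: "?P n x (s \<otimes> y) + ?ey * ?P (n - 1) x y = ?P n (s \<otimes> x) y + of_bool (e A' x) * ?P (n - 1) x y"
      if "x \<in> carrier G" for n x
      using IH[OF that] by (cases n) auto
    have C: "chains \<O> A n u v = ?C n u v + of_bool (up u t) * ?P n (u \<otimes> t) v" if "u \<in> carrier G" for n u v
      unfolding A'_def using lin Suc.prems(1) AT t that by (rule chains_min)
    have P: "chains_pred \<O> A n u v = ?P n u v + of_bool (up u t) * ?P (n - 1) (u \<otimes> t) v"
      if "u \<in> carrier G" for n u v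
      unfolding A'_def using lin Suc.prems(1) AT t that by (rule chains_pred_min)
    define r where "r = inv x \<otimes> s \<otimes> x"
    have rT: "r \<in> T" unfolding r_def using xc s by (auto intro: reflection_conj' S_reflection)
    have xr: "x \<otimes> r = s \<otimes> x" using xc s by (simp add: r_def m_assoc)
    have up_s: "up (s \<otimes> x) t \<longleftrightarrow> up x t \<noteq> (t = r)"
      unfolding r_def using up_left_mult xc tT s by blast
    have len_up: "len (s \<otimes> x) < len x \<longleftrightarrow> \<not> up x r"
      using len_left_mult_less[OF xc s] by (simp add: up_def xr)
    have main: "chains \<O> A n x (s \<otimes> y) + ?ey * chains_pred \<O> A n x y =
        chains \<O> A n (s \<otimes> x) y + of_bool (e A x) * chains_pred \<O> A n x y"
    \<comment> \<open>If \<open>r = t\<close>, the vertices \<open>x\<close> and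
      \<open>x t = s x\<close> are exchanged by \<open>s\<close>, and passing from \<open>A'\<close>
      to \<open>A\<close> reverses \<open>e\<close> at \<open>x\<close>. Otherwise \<open>s\<close>
      carries the edge at \<open>x\<close> to the edge at \<open>s x\<close> with the same label,
      and what has to be shown is that \<open>e\<close> agrees at the two ends of the edge.\<close>
    proof (cases "r = t")
      case True
      have xt: "x \<otimes> t = s \<otimes> x" using xr True by simp
      have sxt: "s \<otimes> x \<otimes> t = x" using xt tT xc tc by (simp add: m_assoc flip: xt)
      have r': "inv (s \<otimes> x) \<otimes> s \<otimes> (s \<otimes> x) = t"
        using xc s by (simp add: inv_mult_group m_assoc r_def flip: True)
      have "t \<notin> A'" by (simp add: A'_def)
      then have e: "e A' x \<longleftrightarrow> \<not> up x t" "e A x \<longleftrightarrow> up x t" "e A' (s \<otimes> x) \<longleftrightarrow> up x t"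
        using len_up t(1) True len_left_mult_less[OF xc s] xc s
        unfolding e_def r' by (simp_all add: up_def xt flip: r_def)
      have "chains \<O> A n x (s \<otimes> y) + ?ey * chains_pred \<O> A n x y =
          (?C n x (s \<otimes> y) + ?ey * ?P n x y) +
          of_bool (up x t) * (?P n (s \<otimes> x) (s \<otimes> y) + ?ey * ?P (n - 1) (s \<otimes> x) y)"
        using C[OF xc] P[OF xc] by (simp add: xt algebra_simps)
      also have "\<dots> = (?C n (s \<otimes> x) y + of_bool (\<not> up x t) * ?P n x y) +
          of_bool (up x t) * (?P n x y + of_bool (up x t) * ?P (n - 1) (s \<otimes> x) y)"
        using IH[OF xc] IHP[of "s \<otimes> x"] xc s by (simp add: e)
      also have "\<dots> = chains \<O> A n (s \<otimes> x) y + of_bool (e A x) * chains_pred \<O> A n x y"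
        using C[of "s \<otimes> x"] P[OF xc] xc s by (simp add: up_s True sxt xt e)
      finally show ?thesis .
    next
      case False
      then have eA: "e A x \<longleftrightarrow> e A' x"
        by (auto simp: e_def A'_def simp flip: r_def)
      have upeq: "up (s \<otimes> x) t \<longleftrightarrow> up x t" using up_s False by auto
      \<comment> \<open>If the term does not vanish, \<open>x t\<close> and \<open>x\<close> lie in
        \<open>V\<close>, hence \<open>r\<close> and \<open>trt\<close> in \<open>L\<close>, where
        membership in \<open>A'\<close> means lying above \<open>t\<close>. By the cocycle identity
        the length terms at \<open>x t\<close> and \<open>x\<close> differ by
        \<open>cocycle t r\<close>, and the order condition says that this is offset by the change
        from \<open>r\<close> to \<open>trt\<close>.\<close>
      have twist: "of_bool (up x t) * (of_bool (e A' (x \<otimes> t)) * ?P (n - 1) (x \<otimes> t) y) =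
          of_bool (up x t) * (of_bool (e A' x) * ?P (n - 1) (x \<otimes> t) y)"
      proof (cases "up x t \<and> ?P (n - 1) (x \<otimes> t) y \<noteq> 0")
        case True
        then have "x \<otimes> t \<in> below y"
          using chains_nonzero_below[of \<O> A' _ "x \<otimes> t" y] AT xc tc
          by (cases "n - 1") (auto simp: A'_def)
        then have xtV: "x \<otimes> t \<in> V" using below_V y by blast
        then have xV: "x \<in> V" using V(3) True bruhat_edge_mult[OF xc tT] by blast
        have rL: "r \<in> L" using L(3)[OF xV] by (simp add: r_def)
        have trt: "inv (x \<otimes> t) \<otimes> s \<otimes> (x \<otimes> t) = t \<otimes> r \<otimes> t"
          using xc tT s by (simp add: r_def inv_mult_group m_assoc)
        then have trtL: "t \<otimes> r \<otimes> t \<in> L" using L(3)[OF xtV] by simp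
        have trtT: "t \<otimes> r \<otimes> t \<in> T" using reflection_conj_reflection tT rT by blast
        have "s \<otimes> (x \<otimes> t) = s \<otimes> x \<otimes> t"
          using xc tc s by (simp add: m_assoc)
        also have "\<dots> = x \<otimes> t \<otimes> (t \<otimes> r \<otimes> t)"
          unfolding xr[symmetric] using xc tT rT by (simp add: m_assoc)
        finally have sxt: "s \<otimes> (x \<otimes> t) = x \<otimes> t \<otimes> (t \<otimes> r \<otimes> t)" .
        have "len (s \<otimes> (x \<otimes> t)) < len (x \<otimes> t) \<longleftrightarrow> \<not> up (x \<otimes> t) (t \<otimes> r \<otimes> t)"
          using len_left_mult_less[of "x \<otimes> t" s] xc tc s by (simp add: up_def sxt)
        also have "\<dots> \<longleftrightarrow> cocycle (t \<otimes> inv x) (t \<otimes> r \<otimes> t)"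
          using up_iff[of "x \<otimes> t" "t \<otimes> r \<otimes> t"] xc tT trtT by (simp add: inv_mult_group)
        also have "\<dots> \<longleftrightarrow> cocycle t (t \<otimes> r \<otimes> t) \<noteq> cocycle (inv x) r"
          using cocycle_mult[of t "inv x" "t \<otimes> r \<otimes> t"] xc tT rT tc by (simp add: m_assoc)
        also have "cocycle t (t \<otimes> r \<otimes> t) \<longleftrightarrow> cocycle t r"
          using cocycle_inv[of t r] tT rT by simp
        also have "cocycle t r \<longleftrightarrow> strictly_below \<O> r t \<noteq> strictly_below \<O> (t \<otimes> r \<otimes> t) t"
          using ord tT rT False unfolding cocycle_order_def by blast
        also have "\<dots> \<longleftrightarrow> (r \<in> A') \<noteq> (t \<otimes> r \<otimes> t \<in> A')"
          using A'_iff[OF rL] A'_iff[OF trtL] strictly_below_linear[OF lin tT rT]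
            strictly_below_linear[OF lin tT trtT] conj_neq[OF tT rT] False by auto
        also have "cocycle (inv x) r \<longleftrightarrow> len (s \<otimes> x) < len x"
          using up_iff[OF xc rT] len_up by simp
        finally have "e A' (x \<otimes> t) \<longleftrightarrow> e A' x"
          unfolding e_def trt r_def[symmetric] by blast
        then show ?thesis by simp
      qed auto
      have "chains \<O> A n x (s \<otimes> y) + ?ey * chains_pred \<O> A n x y =
          (?C n x (s \<otimes> y) + ?ey * ?P n x y) +
          of_bool (up x t) * (?P n (x \<otimes> t) (s \<otimes> y) + ?ey * ?P (n - 1) (x \<otimes> t) y)"
        using C[OF xc] P[OF xc] by (simp add: algebra_simps)
      also have "\<dots> = (?C n (s \<otimes> x) y + of_bool (e A' x) * ?P n x y) +
          of_bool (up x t) * (?P n (s \<otimes> (x \<otimes> t)) y + of_bool (e A' (x \<otimes> t)) * ?P (n - 1) (x \<otimes> t) y)"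
        using IH[OF xc] IHP[of "x \<otimes> t"] xc tc by simp
      also have "\<dots> = (?C n (s \<otimes> x) y + of_bool (e A' x) * ?P n x y) +
          (of_bool (up x t) * ?P n (s \<otimes> (x \<otimes> t)) y + of_bool (up x t) * (of_bool (e A' x) * ?P (n - 1) (x \<otimes> t) y))"
        unfolding twist[symmetric] by (simp add: algebra_simps)
      also have "\<dots> = chains \<O> A n (s \<otimes> x) y + of_bool (e A x) * chains_pred \<O> A n x y"
        using C[of "s \<otimes> x"] P[OF xc] xc s tc by (simp add: upeq eA m_assoc algebra_simps)
      finally show ?thesis .
    qed
    then show ?case unfolding e_def .
  qed
qed

text \<open>Only labels of edges ending in \<open>below v\<close> occur; this lets the possibly
  infinite T be replaced by a finite set of labels.\<close>

lemma chains_cong: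
  assumes "A \<subseteq> T" "B \<subseteq> T" "u \<in> carrier G"
    "\<And>u t. u \<in> carrier G \<Longrightarrow> t \<in> T \<Longrightarrow> up u t \<Longrightarrow> u \<otimes> t \<in> below v \<Longrightarrow> t \<in> A \<longleftrightarrow> t \<in> B"
  shows "chains \<O> A n u v = chains \<O> B n u v"
  using assms
proof (induction n arbitrary: A B u)
  case (Suc n)
  have "{t. t \<in> A \<and> up u t \<and> u \<otimes> t \<in> below v} = {t. t \<in> B \<and> up u t \<and> u \<otimes> t \<in> below v}"
    using Suc.prems by blast
  moreover have "chains \<O> {r \<in> A. strictly_below \<O> t r} n (u \<otimes> t) v =
      chains \<O> {r \<in> B. strictly_below \<O> t r} n (u \<otimes> t) v" if "t \<in> B" for t
  proof (rule Suc.IH)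
    show "u \<otimes> t \<in> carrier G" using Suc.prems that by auto
  qed (use Suc.prems in blast)+
  ultimately show ?case
    unfolding chains.simps by (intro sum.cong) auto
qed simp

text \<open>The intertwining relation at \<open>y = s v\<close> with all relevant labels in
  \<open>A\<close>, where the twisted indicator becomes \<open>l(x) < l(s x)\<close>. In generating
  functions it is the recursion of the R-polynomials in their form with nonnegative
  coefficients.\<close>

lemma chains_recursion:
  assumes ord: "cocycle_order \<O>" and s: "s \<in> S" and v: "v \<in> carrier G" "len (s \<otimes> v) < len v"
    and x: "x \<in> carrier G"
  shows "chains \<O> T (Suc n) x v =
    chains \<O> T (Suc n) (s \<otimes> x) (s \<otimes> v) + of_bool (len x < len (s \<otimes> x)) * chains \<O> T n x (s \<otimes> v)"
proof -
  \<comment> \<open>Adding the translate makes \<open>V\<close> closed under \<open>s\<close>;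
    \<open>Vpred\<close> shows by a lifting argument that it stays closed under predecessors.
    \<open>L\<close> collects the labels between elements of \<open>V\<close>.\<close>
  define V where "V = below v \<union> (\<lambda>x. s \<otimes> x) ` below v"
  define L where "L = T \<inter> (\<lambda>(x, y). inv x \<otimes> y) ` (V \<times> V)"
  have sv: "s \<otimes> v \<in> carrier G" using s v by simp
  have bc: "z \<in> carrier G" if "z \<in> below v" for z using below_carrier[OF v(1)] that by blast
  have Vc: "V \<subseteq> carrier G" using s bc by (auto simp: V_def)
  have Vs: "s \<otimes> z \<in> V" if "z \<in> V" for z using that s bc by (auto simp: V_def)
  have "bruhat_edge G S (s \<otimes> v) v"
  proof -
    have "inv (s \<otimes> v) \<otimes> v = inv v \<otimes> s \<otimes> v" using s v by (simp add: inv_mult_group)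
    then show ?thesis
      using s v S_reflection reflection_conj'[of s v] by (simp add: bruhat_edge_def)
  qed
  then have sv_below: "s \<otimes> v \<in> below v" using below_step by simp
  have Vpred: "z \<in> V" if e: "bruhat_edge G S z w" and wV: "w \<in> V" for z w
  proof (cases "w \<in> below v")
    case True
    then show ?thesis using e below_step by (auto simp: V_def)
  next
    case False
    then obtain y where y: "y \<in> below v" "w = s \<otimes> y" using wV by (auto simp: V_def)
    obtain t where t: "t \<in> T" "w = z \<otimes> t" "up z t" "z \<in> carrier G"
      using e by (rule bruhat_edgeE)
    have szt: "s \<otimes> z \<otimes> t = y"
      using t y s bc by (simp add: m_assoc flip: t(2))
    show ?thesis
    proof (cases "up (s \<otimes> z) t")
      case True
      then have "s \<otimes> z \<in> below v"
        using bruhat_edge_mult[of "s \<otimes> z" t] below_step[of "s \<otimes> z" y v] t y szt s by simp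
      then have "s \<otimes> (s \<otimes> z) \<in> V" by (auto simp: V_def)
      then show ?thesis using s t by simp
    next
      case False
      then have "t = inv z \<otimes> s \<otimes> z" using up_left_mult t s by blast
      then have "y = z" using szt t s by (simp add: m_assoc)
      then show ?thesis using y by (simp add: V_def)
    qed
  qed
  have L: "finite L" "L \<subseteq> T" "\<And>x. x \<in> V \<Longrightarrow> inv x \<otimes> s \<otimes> x \<in> L"
  proof -
    have "finite V" using finite_below v by (simp add: V_def)
    then show "finite L" by (simp add: L_def)
    show "L \<subseteq> T" by (simp add: L_def)
    fix z assume z: "z \<in> V"
    then have zc: "z \<in> carrier G" using Vc by blast
    have "inv z \<otimes> s \<otimes> z = inv z \<otimes> (s \<otimes> z)" using zc s by (simp add: m_assoc)
    then show "inv z \<otimes> s \<otimes> z \<in> L"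
      using z Vs zc s reflection_conj'[of s z] S_reflection by (force simp: L_def)
  qed
  have TL: "chains \<O> T n z w = chains \<O> L n z w" if "z \<in> carrier G" "w \<in> below v" for n z w
  proof (rule chains_cong)
    fix u t assume u: "u \<in> carrier G" "t \<in> T" "up u t" "u \<otimes> t \<in> below w"
    then have "u \<otimes> t \<in> V" using below_mono that by (auto simp: V_def)
    moreover from this have "u \<in> V" using Vpred bruhat_edge_mult u by blast
    moreover have "t = inv u \<otimes> (u \<otimes> t)" using u by simp
    ultimately have "t \<in> L" using u by (force simp: L_def)
    then show "t \<in> T \<longleftrightarrow> t \<in> L" using u by simp
  qed (use L that in auto)
  have svV: "s \<otimes> v \<in> V" using sv_below by (simp add: V_def)
  have "chains \<O> L (Suc n) x (s \<otimes> (s \<otimes> v)) + of_bool (len (s \<otimes> (s \<otimes> v)) < len (s \<otimes> v)) * chains_pred \<O> L (Suc n) x (s \<otimes> v) =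
    chains \<O> L (Suc n) (s \<otimes> x) (s \<otimes> v) +
      of_bool ((len (s \<otimes> x) < len x) \<noteq> (inv x \<otimes> s \<otimes> x \<in> L)) * chains_pred \<O> L (Suc n) x (s \<otimes> v)"
    by (rule chains_intertwine[OF ord s Vc Vs Vpred L _ _ x svV]) auto
  moreover have "of_bool ((len (s \<otimes> x) < len x) \<noteq> (inv x \<otimes> s \<otimes> x \<in> L)) * chains \<O> L n x (s \<otimes> v) =
      of_bool (len x < len (s \<otimes> x)) * chains \<O> L n x (s \<otimes> v)"
  proof (cases "chains \<O> L n x (s \<otimes> v) = 0")
    case False
    then have "x \<in> below (s \<otimes> v)" using chains_nonzero_below L x by blast
    then have "x \<in> V" using below_mono[OF sv_below] by (auto simp: V_def)
    then show ?thesis using L(3) len_left_mult_less[OF x s] by simp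
  qed simp
  ultimately show ?thesis
    using v s x sv_below by (simp add: TL)
qed

text \<open>Both orders satisfy the recursion, which they enter only through the counts at the
  shorter element \<open>s v\<close>; at the identity there are no chains of positive
  length.\<close>

theorem chains_converse:
  assumes "cocycle_order \<O>" "v \<in> carrier G" "x \<in> carrier G"
  shows "chains \<O> T n x v = chains (\<O>\<inverse>) T n x v"
  using assms(2,3)
proof (induction "len v" arbitrary: v n x rule: less_induct)
  case less
  show ?case
  proof (cases n)
    case (Suc m)
    show ?thesis
    proof (cases "v = \<one>")
      case True
      have "\<not> (up x t \<and> x \<otimes> t \<in> below \<one>)" if "t \<in> T" for t
      proof
        assume *: "up x t \<and> x \<otimes> t \<in> below \<one>"
        then have "(bruhat_edge G S)\<^sup>*\<^sup>* (x \<otimes> t) \<one>" by (simp add: below_def)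
        then have "x \<otimes> t = \<one>"
          by (cases rule: rtranclp.cases) (auto simp: bruhat_edge_def)
        then show False using * by (simp add: up_def)
      qed
      then have "{t. t \<in> T \<and> up x t \<and> x \<otimes> t \<in> below \<one>} = {}" by blast
      then show ?thesis unfolding Suc True chains.simps by (simp only: sum.empty)
    next
      case False
      then obtain s where s: "s \<in> S" "len (s \<otimes> v) < len v"
        using exists_descent less.prems by blast
      then show ?thesis
        unfolding Suc chains_recursion[OF assms(1) s(1) less.prems(1) s(2) less.prems(2)]
          chains_recursion[OF cocycle_order_converse[OF assms(1)] s(1) less.prems(1) s(2) less.prems(2)]
        using less.hyps[OF s(2)] less.prems s by simp
    qed
  qed simp
qed

end

section \<open>Noncommutative polynomials\<close>

lemma ncpoly_induct [case_names single add]: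
  fixes p :: "'x ncpoly"
  assumes single: "\<And>k v. P (Poly_Mapping.single k v)" and add: "\<And>f g. P f \<Longrightarrow> P g \<Longrightarrow> P (f + g)"
  shows "P p"
proof -
  have "P (\<Sum>k\<in>A. Poly_Mapping.single k (Poly_Mapping.lookup p k))" if "finite A" for A
    using that
  proof induction
    case empty
    show ?case using single[of undefined 0] by simp
  qed (simp add: add single)
  moreover have "(\<Sum>k\<in>Poly_Mapping.keys p. Poly_Mapping.single k (Poly_Mapping.lookup p k)) = p"
    by (rule poly_mapping_eqI) (auto simp: lookup_sum lookup_single when_def in_keys_iff)
  ultimately show ?thesis by (metis finite_keys)
qed

lemma lookup_nc_monom: "Poly_Mapping.lookup (nc_monom w) w' = of_bool (w = w')"
  by (simp add: nc_monom_def lookup_single when_def)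

lemma nc_monom_mult: "nc_monom v * nc_monom w = nc_monom (v @ w)"
  by (simp add: nc_monom_def mult_single plus_list_def)

lemma nc_monom_Nil: "nc_monom [] = 1"
proof -
  have "nc_monom [] = Poly_Mapping.single (0::'a list) (1::int)"
    by (simp add: nc_monom_def zero_list_def)
  then show ?thesis by simp
qed

lemma lookup_nc_monom_mult_Cons:
  "Poly_Mapping.lookup (nc_monom [a] * f) (b # w) = (if a = b then Poly_Mapping.lookup f w else 0)"
proof (induction f rule: ncpoly_induct)
  case (single k v)
  then show ?case
    by (auto simp: nc_monom_def mult_single lookup_single plus_list_def when_def)
next
  case (add f g)
  then show ?case by (simp add: distrib_left lookup_add)
qed

lemma lookup_nc_monom_mult_Nil: "Poly_Mapping.lookup (nc_monom [a] * f) [] = 0"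
proof (induction f rule: ncpoly_induct)
  case (single k v)
  then show ?case
    by (auto simp: nc_monom_def mult_single lookup_single plus_list_def when_def)
next
  case (add f g)
  then show ?case by (simp add: distrib_left lookup_add)
qed

lemma nc_subst_superset:
  assumes "finite A" "Poly_Mapping.keys p \<subseteq> A"
  shows "nc_subst \<sigma> p = (\<Sum>w\<in>A. of_int (Poly_Mapping.lookup p w) * prod_list (map \<sigma> w))"
  unfolding nc_subst_def using assms
  by (intro sum.mono_neutral_left) (auto simp: in_keys_iff)

lemma nc_subst_add: "nc_subst \<sigma> (p + q) = nc_subst \<sigma> p + nc_subst \<sigma> q"
proof -
  let ?A = "Poly_Mapping.keys p \<union> Poly_Mapping.keys q"
  have "finite ?A" "Poly_Mapping.keys (p + q) \<subseteq> ?A"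
    by (simp_all add: keys_add)
  then show ?thesis
    using nc_subst_superset[of ?A p \<sigma>] nc_subst_superset[of ?A q \<sigma>] nc_subst_superset[of ?A "p + q" \<sigma>]
    by (simp add: lookup_add distrib_right sum.distrib)
qed

lemma nc_subst_0 [simp]: "nc_subst \<sigma> 0 = 0"
  by (simp add: nc_subst_def)

lemma nc_subst_diff: "nc_subst \<sigma> (p - q) = nc_subst \<sigma> p - nc_subst \<sigma> q"
  using nc_subst_add[of \<sigma> "p - q" q] by simp

lemma nc_subst_sum: "nc_subst \<sigma> (\<Sum>x\<in>X. f x) = (\<Sum>x\<in>X. nc_subst \<sigma> (f x))"
  by (induction X rule: infinite_finite_induct) (auto simp: nc_subst_add)

lemma nc_subst_single: "nc_subst \<sigma> (Poly_Mapping.single w c) = of_int c * prod_list (map \<sigma> w)"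
  by (cases "c = 0") (auto simp: nc_subst_def)

lemma nc_subst_of_bool: "nc_subst \<sigma> (of_bool P) = of_bool P"
  using nc_subst_single[of \<sigma> "0" 1, unfolded single_one] by (cases P) (simp_all add: zero_list_def)

lemma nc_subst_nc_monom_mult: "nc_subst \<sigma> (nc_monom [x] * p) = \<sigma> x * nc_subst \<sigma> p"
proof (induction p rule: ncpoly_induct)
  case (single k v)
  have "\<sigma> x * (of_int v * prod_list (map \<sigma> k)) = of_int v * (\<sigma> x * prod_list (map \<sigma> k))"
    by (metis mult.assoc mult_of_int_commute)
  then show ?case
    by (simp add: nc_monom_def mult_single plus_list_def nc_subst_single)
next
  case (add f g)
  then show ?case by (simp add: distrib_left nc_subst_add)
qed

lemma cd_degree_simps [simp]:
  "cd_degree [] = 0" "cd_degree (x # M) = cd_letter_degree x + cd_degree M"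
  by (simp_all add: cd_degree_def)

lemma cd_homogeneous_0 [simp]: "cd_homogeneous k 0"
  by (simp add: cd_homogeneous_def)

lemma cd_homogeneous_of_bool: "cd_homogeneous 0 (of_bool P)"
  by (auto simp: cd_homogeneous_def zero_list_def)

lemma cd_homogeneous_iff: "cd_homogeneous k f \<longleftrightarrow> (\<forall>M. Poly_Mapping.lookup f M \<noteq> 0 \<longrightarrow> int (cd_degree M) = k)"
  by (auto simp: cd_homogeneous_def in_keys_iff)

lemma cd_homogeneous_add: "cd_homogeneous k f \<Longrightarrow> cd_homogeneous k g \<Longrightarrow> cd_homogeneous k (f + g)"
  unfolding cd_homogeneous_iff lookup_add by (metis add.right_neutral)

lemma cd_homogeneous_diff: "cd_homogeneous k f \<Longrightarrow> cd_homogeneous k g \<Longrightarrow> cd_homogeneous k (f - g)"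
  unfolding cd_homogeneous_iff lookup_minus by (metis diff_0_right)

lemma cd_homogeneous_sum: "(\<And>x. x \<in> X \<Longrightarrow> cd_homogeneous k (f x)) \<Longrightarrow> cd_homogeneous k (\<Sum>x\<in>X. f x)"
  by (induction X rule: infinite_finite_induct) (auto intro: cd_homogeneous_add)

lemma cd_homogeneous_mult:
  assumes "cd_homogeneous k f" "k' = k + int (cd_letter_degree x)"
  shows "cd_homogeneous k' (nc_monom [x] * f)"
  unfolding cd_homogeneous_iff
proof (intro allI impI)
  fix M assume M: "Poly_Mapping.lookup (nc_monom [x] * f) M \<noteq> 0"
  then obtain M' where M': "M = x # M'" "Poly_Mapping.lookup f M' \<noteq> 0"
    by (cases M) (auto simp: lookup_nc_monom_mult_Cons lookup_nc_monom_mult_Nil split: if_splits)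
  then show "int (cd_degree M) = k'"
    using assms unfolding cd_homogeneous_iff by simp
qed

section \<open>Paths\<close>

context coxeter
begin

abbreviation "edge \<equiv> bruhat_edge G S"

text \<open>\<open>u\<close> may have infinitely many upper neighbours, but those from which
  \<open>v\<close> can be reached are finite in number.\<close>

definition succs :: "'a \<Rightarrow> 'a \<Rightarrow> 'a set" where
  "succs u v = {y \<in> below v. edge u y}"

lemma finite_succs: "v \<in> carrier G \<Longrightarrow> finite (succs u v)"
  by (simp add: succs_def finite_below)

lemma path_nonempty: "x \<in> paths_n G S n u v \<Longrightarrow> x \<noteq> []"
  by (auto simp: paths_n_def)

lemma path_length: "x \<in> paths_n G S n u v \<Longrightarrow> length x = n + 2"
  by (simp add: paths_n_def)

lemma path_nth_0: "x \<in> paths_n G S n u v \<Longrightarrow> x ! 0 = u"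
  by (simp add: paths_n_def)

lemma path_last: "x \<in> paths_n G S n u v \<Longrightarrow> last x = v"
  by (cases x rule: rev_cases) (auto simp: paths_n_def nth_append)

lemma paths_0: "paths_n G S 0 u v = (if edge u v then {[u, v]} else {})"
proof -
  have "x = [u, v]" if "x \<in> paths_n G S 0 u v" for x
    using that by (intro nth_equalityI) (auto simp: paths_n_def less_Suc_eq)
  then show ?thesis by (auto simp: paths_n_def)
qed

lemma Cons_path_iff:
  "u' # z \<in> paths_n G S (Suc n) u v \<longleftrightarrow> u' = u \<and> edge u (z ! 0) \<and> z \<in> paths_n G S n (z ! 0) v"
proof -
  have "(\<forall>i\<le>Suc n. edge ((u' # z) ! i) ((u' # z) ! (i + 1))) \<longleftrightarrow>
      edge u' (z ! 0) \<and> (\<forall>i\<le>n. edge (z ! i) (z ! (i + 1)))"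
  proof (intro iffI conjI allI impI)
    fix i assume "edge u' (z ! 0) \<and> (\<forall>i\<le>n. edge (z ! i) (z ! (i + 1)))" "i \<le> Suc n"
    then show "edge ((u' # z) ! i) ((u' # z) ! (i + 1))" by (cases i) auto
  qed fastforce+
  then show ?thesis by (auto simp: paths_n_def)
qed

lemma path_below:
  assumes "x \<in> paths_n G S n u v" "i \<le> n + 1"
  shows "(edge)\<^sup>*\<^sup>* (x ! i) v"
  using assms(2)
proof (induction rule: inc_induct)
  case base
  then show ?case using assms(1) by (simp add: paths_n_def)
next
  case (step i)
  then have "edge (x ! i) (x ! (Suc i))"
    using assms(1) by (simp add: paths_n_def)
  then show ?case using step.IH by (rule converse_rtranclp_into_rtranclp)
qed

lemma path_bruhat_less:
  assumes "x \<in> paths_n G S n u v" "i \<le> n"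
  shows "bruhat_less G S (x ! i) v"
proof -
  have "edge (x ! i) (x ! (Suc i))"
    using assms by (simp add: paths_n_def)
  moreover have "(edge)\<^sup>*\<^sup>* (x ! Suc i) v" using path_below[OF assms(1)] assms(2) by simp
  ultimately show ?thesis unfolding bruhat_less_def by (rule rtranclp_into_tranclp2)
qed

lemma paths_Suc:
  "paths_n G S (Suc n) u v = (\<Union>y\<in>succs u v. (#) u ` paths_n G S n y v)"
proof (intro equalityI subsetI)
  fix x assume x: "x \<in> paths_n G S (Suc n) u v"
  then obtain u' z where xz: "x = u' # z" by (cases x) (auto simp: paths_n_def)
  then have *: "u' = u" "edge u (z ! 0)" "z \<in> paths_n G S n (z ! 0) v"
    using x Cons_path_iff by blast+
  then have "z ! 0 \<in> below v"
    using path_below[of z n "z ! 0" v 0] by (simp add: below_def)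
  then show "x \<in> (\<Union>y\<in>succs u v. (#) u ` paths_n G S n y v)"
    using * xz by (auto simp: succs_def)
next
  fix x assume "x \<in> (\<Union>y\<in>succs u v. (#) u ` paths_n G S n y v)"
  then obtain y z where "edge u y" "x = u # z" "z \<in> paths_n G S n y v"
    by (auto simp: succs_def)
  then show "x \<in> paths_n G S (Suc n) u v"
    using Cons_path_iff path_nth_0 by metis
qed

lemma finite_paths: "v \<in> carrier G \<Longrightarrow> finite (paths_n G S n u v)"
  by (induction n arbitrary: u) (auto simp: paths_0 paths_Suc finite_succs)

lemma sum_paths_Suc:
  assumes "v \<in> carrier G"
  shows "(\<Sum>x\<in>paths_n G S (Suc n) u v. h x) = (\<Sum>y\<in>succs u v. \<Sum>z\<in>paths_n G S n y v. h (u # z))"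
proof -
  have "(\<Sum>x\<in>paths_n G S (Suc n) u v. h x) = (\<Sum>y\<in>succs u v. \<Sum>x\<in>(#) u ` paths_n G S n y v. h x)"
    unfolding paths_Suc using finite_succs[OF assms] finite_paths[OF assms]
    by (intro sum.UNION_disjoint) (auto dest: path_nth_0)
  also have "\<dots> = (\<Sum>y\<in>succs u v. \<Sum>z\<in>paths_n G S n y v. h (u # z))"
    by (simp add: sum.reindex)
  finally show ?thesis .
qed

definition label :: "'a \<Rightarrow> 'a \<Rightarrow> 'a" where
  "label u y = inv u \<otimes> y"

lemma label_reflection: "edge u y \<Longrightarrow> label u y \<in> T"
  by (simp add: bruhat_edge_def label_def)

lemma edge_carrier: "edge u y \<Longrightarrow> u \<in> carrier G \<and> y \<in> carrier G"
  by (simp add: bruhat_edge_def)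

lemma path_edge_0: "x \<in> paths_n G S n u v \<Longrightarrow> edge u (x ! 1)"
  by (auto simp: paths_n_def)

text \<open>The letter that arises in front when an edge with label \<open>t\<close> is prepended to
  \<open>x\<close>.\<close>

definition first_letter :: "'a rel \<Rightarrow> 'a \<Rightarrow> 'a list \<Rightarrow> ad" where
  "first_letter \<O> t x = (if strictly_below \<O> t (label (x ! 0) (x ! 1)) then Asc else Des)"

lemma ad_letter_Cons_1:
  "ad_letter G \<O> (u # z) (Suc 0) = first_letter \<O> (label u (z ! 0)) z"
  by (simp add: ad_letter_def first_letter_def path_label_def label_def)

lemma ad_letter_Cons_Suc:
  "i \<ge> 1 \<Longrightarrow> ad_letter G \<O> (u # z) (Suc i) = ad_letter G \<O> z i"
  by (cases i) (auto simp: ad_letter_def path_label_def)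

lemma ad_word_Cons:
  assumes "length z \<ge> 2"
  shows "ad_word G \<O> (u # z) = first_letter \<O> (label u (z ! 0)) z # ad_word G \<O> z"
proof -
  have "[1..<length (u # z) - 1] = 1 # map Suc [1..<length z - 1]"
  proof -
    have "Suc (length z - 1) = length z" using assms by simp
    then show ?thesis using assms by (simp add: upt_conv_Cons map_Suc_upt del: upt_Suc)
  qed
  then show ?thesis
    unfolding ad_word_def by (auto simp: ad_letter_Cons_1 ad_letter_Cons_Suc)
qed

lemma ad_word_two: "ad_word G \<O> [u, v] = []"
  by (simp add: ad_word_def)

lemma ad_word_length: "length (ad_word G \<O> x) = length x - 2"
  by (auto simp: ad_word_def)

lemma ad_word_path_Cons:
  assumes "z \<in> paths_n G S n y v"
  shows "ad_word G \<O> (u # z) = first_letter \<O> (label u y) z # ad_word G \<O> z"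
  using ad_word_Cons[of z \<O> u] path_length[OF assms] path_nth_0[OF assms] by simp

text \<open>Two equal consecutive labels would lead back to \<open>u\<close>, as a reflection is an
  involution. So \<open>Des\<close> always means a strict descent, and reversing \<O> exchanges the
  letters.\<close>

lemma label_neq:
  assumes "edge u y" "edge y w"
  shows "label u y \<noteq> label y w"
proof
  assume eq: "label u y = label y w"
  have c: "u \<in> carrier G" "y \<in> carrier G" "w \<in> carrier G"
    using assms edge_carrier by auto
  have "w = y \<otimes> label y w" using c by (simp add: label_def)
  also have "\<dots> = u \<otimes> label u y \<otimes> label u y" unfolding eq[symmetric] using c by (simp add: label_def)
  also have "\<dots> = u" using c label_reflection[OF assms(1)] by (simp add: m_assoc)
  finally show False using assms by (simp add: bruhat_edge_def)
qed

lemma first_letter_converse: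
  assumes "linear_order_on T \<O>" "edge u y" "z \<in> paths_n G S n y v"
  shows "first_letter (\<O>\<inverse>) (label u y) z = swap_ad (first_letter \<O> (label u y) z)"
proof -
  have e: "edge y (z ! 1)" "z ! 0 = y"
    using path_edge_0 path_nth_0 assms by blast+
  show ?thesis
    using strictly_below_linear[OF assms(1) label_reflection[OF assms(2)] label_reflection[OF e(1)]]
      label_neq[OF assms(2) e(1)] e(2)
    by (auto simp: first_letter_def strictly_below_converse)
qed

lemma ad_word_converse:
  assumes "linear_order_on T \<O>" "x \<in> paths_n G S n u v"
  shows "ad_word G (\<O>\<inverse>) x = map swap_ad (ad_word G \<O> x)"
  using assms(2)
proof (induction n arbitrary: u x)
  case 0
  then show ?case by (auto simp: paths_0 ad_word_two split: if_splits)
next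
  case (Suc n)
  then obtain y z where *: "edge u y" "x = u # z" "z \<in> paths_n G S n y v"
    by (auto simp: paths_Suc succs_def)
  then show ?case
    using Suc.IH[of z y] first_letter_converse[OF assms(1) *(1,3)] by (simp add: ad_word_path_Cons)
qed

section \<open>The swap symmetry of the ascent-descent words\<close>

text \<open>The condition \<open>P\<close> on the first label is what removing the leading letter
  passes on to the shorter path.\<close>

definition word_count :: "'a rel \<Rightarrow> ('a \<Rightarrow> bool) \<Rightarrow> 'a \<Rightarrow> 'a \<Rightarrow> ad list \<Rightarrow> nat" where
  "word_count \<O> P u v w =
     card {x \<in> paths_n G S (length w) u v. ad_word G \<O> x = w \<and> P (label u (x ! 1))}"

abbreviation "total_count \<O> \<equiv> word_count \<O> (\<lambda>_. True)"

lemma label_succs: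
  assumes "u \<in> carrier G"
  shows "bij_betw (label u) (succs u v) {t \<in> T. up u t \<and> u \<otimes> t \<in> below v}"
proof (rule bij_betwI[where g = "\<lambda>t. u \<otimes> t"])
  show "label u \<in> succs u v \<rightarrow> {t \<in> T. up u t \<and> u \<otimes> t \<in> below v}"
    using assms by (auto simp: succs_def label_def bruhat_edge_def up_def)
  show "(\<lambda>t. u \<otimes> t) \<in> {t \<in> T. up u t \<and> u \<otimes> t \<in> below v} \<rightarrow> succs u v"
    using assms by (auto simp: succs_def bruhat_edge_mult)
qed (use assms in \<open>auto simp: label_def succs_def bruhat_edge_def\<close>)

lemma chains_Suc_succs:
  assumes "A \<subseteq> T" "u \<in> carrier G"
  shows "chains \<O> A (Suc n) u v =
    (\<Sum>y\<in>{y \<in> succs u v. label u y \<in> A}. chains \<O> {r \<in> A. strictly_below \<O> (label u y) r} n y v)"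
proof -
  have "bij_betw (label u) {y \<in> succs u v. label u y \<in> A} {t. t \<in> A \<and> up u t \<and> u \<otimes> t \<in> below v}"
    using label_succs[OF assms(2), of v] assms(1) unfolding bij_betw_def inj_on_def by auto
  then have "chains \<O> A (Suc n) u v =
    (\<Sum>y\<in>{y \<in> succs u v. label u y \<in> A}. chains \<O> {r \<in> A. strictly_below \<O> (label u y) r} n (u \<otimes> label u y) v)"
    unfolding chains.simps by (intro sum.reindex_bij_betw[symmetric])
  also have "\<dots> = (\<Sum>y\<in>{y \<in> succs u v. label u y \<in> A}. chains \<O> {r \<in> A. strictly_below \<O> (label u y) r} n y v)"
    by (intro sum.cong) (auto simp: label_def succs_def bruhat_edge_def)
  finally show ?thesis .
qed

lemma card_paths_Suc:
  assumes "v \<in> carrier G"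
  shows "card {x \<in> paths_n G S (Suc n) u v. P x} = (\<Sum>y\<in>succs u v. card {z \<in> paths_n G S n y v. P (u # z)})"
  using sum_paths_Suc[OF assms, of "\<lambda>x. of_bool (P x) :: nat" n u]
  by (simp add: finite_paths[OF assms] Int_def)

text \<open>A path of length n has n + 1 edges, hence \<open>Suc n\<close> steps in the chain. Since
  \<open>A\<close> is closed upwards, restricting the first label of an increasing path restricts
  all of them, and the part of \<open>A\<close> above a label is again closed upwards.\<close>

lemma card_increasing_paths:
  assumes lin: "linear_order_on T \<O>" and v: "v \<in> carrier G" and A: "A \<subseteq> T"
    "\<And>t r. t \<in> A \<Longrightarrow> r \<in> T \<Longrightarrow> strictly_below \<O> t r \<Longrightarrow> r \<in> A" and u: "u \<in> carrier G"
  shows "card {x \<in> paths_n G S n u v. ad_word G \<O> x = replicate n Asc \<and> label u (x ! 1) \<in> A} =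
    chains \<O> A (Suc n) u v"
  using A u
proof (induction n arbitrary: A u)
  case 0
  have "{x \<in> paths_n G S 0 u v. ad_word G \<O> x = replicate 0 Asc \<and> label u (x ! 1) \<in> A} =
      (if edge u v \<and> label u v \<in> A then {[u, v]} else {})"
    by (auto simp: paths_0 ad_word_two)
  moreover have "{y \<in> succs u v. label u y \<in> A \<and> y = v} = (if edge u v \<and> label u v \<in> A then {v} else {})"
    by (auto simp: succs_def)
  ultimately show ?case
    using 0 finite_succs[OF v, of u] 
    by (simp add: chains_Suc_succs Int_def conj_assoc)
next
  case (Suc n)
  have "card {x \<in> paths_n G S (Suc n) u v. ad_word G \<O> x = replicate (Suc n) Asc \<and> label u (x ! 1) \<in> A} =
     (\<Sum>y\<in>succs u v. card {z \<in> paths_n G S n y v.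
        ad_word G \<O> (u # z) = replicate (Suc n) Asc \<and> label u (z ! 0) \<in> A})"
    using card_paths_Suc[OF v, where P = "\<lambda>x. ad_word G \<O> x = replicate (Suc n) Asc \<and> label u (x ! 1) \<in> A"] by simp
  also have "\<dots> = (\<Sum>y\<in>{y \<in> succs u v. label u y \<in> A}.
      chains \<O> {r \<in> A. strictly_below \<O> (label u y) r} (Suc n) y v)"
  proof (rule sum.mono_neutral_cong_right)
    show "\<forall>y\<in>succs u v - {y \<in> succs u v. label u y \<in> A}. card {z \<in> paths_n G S n y v.
        ad_word G \<O> (u # z) = replicate (Suc n) Asc \<and> label u (z ! 0) \<in> A} = 0"
      by (auto simp: path_nth_0 card_eq_0_iff)
  next
    fix y assume y: "y \<in> {y \<in> succs u v. label u y \<in> A}"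
    then have e: "edge u y" by (simp add: succs_def)
    let ?B = "{r \<in> A. strictly_below \<O> (label u y) r}"
    have "ad_word G \<O> (u # z) = replicate (Suc n) Asc \<and> label u (z ! 0) \<in> A \<longleftrightarrow>
        ad_word G \<O> z = replicate n Asc \<and> label y (z ! 1) \<in> ?B" if z: "z \<in> paths_n G S n y v" for z
    proof -
      have "label y (z ! 1) \<in> T" using path_edge_0[OF z] by (rule label_reflection)
      then show ?thesis
        using y Suc.prems(2)[of "label u y" "label y (z ! 1)"] z path_nth_0[OF z]
        by (auto simp: ad_word_path_Cons[OF z] first_letter_def)
    qed
    then have "{z \<in> paths_n G S n y v.
        ad_word G \<O> (u # z) = replicate (Suc n) Asc \<and> label u (z ! 0) \<in> A} =
      {z \<in> paths_n G S n y v. ad_word G \<O> z = replicate n Asc \<and> label y (z ! 1) \<in> ?B}" by blast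
    also have "card \<dots> = chains \<O> ?B (Suc n) y v"
    proof (rule Suc.IH)
      show "?B \<subseteq> T" using Suc.prems by blast
      show "y \<in> carrier G" using edge_carrier[OF e] by simp
      fix t r assume "t \<in> ?B" "r \<in> T" "strictly_below \<O> t r"
      then show "r \<in> ?B"
        using Suc.prems(2) strictly_below_trans[OF lin, of "label u y" t r] by blast
    qed
    finally show "card {z \<in> paths_n G S n y v.
        ad_word G \<O> (u # z) = replicate (Suc n) Asc \<and> label u (z ! 0) \<in> A} = chains \<O> ?B (Suc n) y v" .
  qed (auto simp: finite_succs[OF v])
  also have "\<dots> = chains \<O> A (Suc (Suc n)) u v"
    using chains_Suc_succs[of A u \<O> "Suc n" v] Suc.prems by simp
  finally show ?case .
qed

lemma word_count_Asc:
  assumes "linear_order_on T \<O>" "v \<in> carrier G" "u \<in> carrier G"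
  shows "total_count \<O> u v (replicate n Asc) = chains \<O> T (Suc n) u v"
proof -
  have "{x \<in> paths_n G S n u v. ad_word G \<O> x = replicate n Asc \<and> label u (x ! 1) \<in> T} =
      {x \<in> paths_n G S n u v. ad_word G \<O> x = replicate n Asc}"
    using path_edge_0 label_reflection by blast
  then show ?thesis
    using card_increasing_paths[OF assms(1,2) order.refl _ assms(3), of n] by (simp add: word_count_def)
qed

text \<open>Trades the swap of letters for the reversal of the order, to which the comparison of
  chain counts applies.\<close>

lemma word_count_swap:
  assumes "linear_order_on T \<O>"
  shows "total_count \<O> u v (map swap_ad w) = total_count (\<O>\<inverse>) u v w"
proof -
  have inv: "map swap_ad (map swap_ad w) = w" for w
  proof (induction w)
    case (Cons a w)
    then show ?case by (cases a) auto
  qed simp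
  have "{x \<in> paths_n G S (length w) u v. ad_word G \<O> x = map swap_ad w} =
    {x \<in> paths_n G S (length w) u v. ad_word G (\<O>\<inverse>) x = w}"
    using ad_word_converse[OF assms] inv by metis
  then show ?thesis by (simp add: word_count_def)
qed

lemma word_count_Nil: "word_count \<O> P u v [] = of_bool (edge u v \<and> P (label u v))"
proof -
  have "{x \<in> paths_n G S (length []) u v. ad_word G \<O> x = [] \<and> P (label u (x ! 1))} =
      (if edge u v \<and> P (label u v) then {[u, v]} else {})"
    by (auto simp: paths_0 ad_word_two)
  then show ?thesis by (simp add: word_count_def)
qed

lemma word_count_Cons:
  assumes v: "v \<in> carrier G"
  shows "word_count \<O> P u v (a # w) = (\<Sum>y\<in>succs u v. of_bool (P (label u y)) *
    word_count \<O> (\<lambda>r. strictly_below \<O> (label u y) r \<longleftrightarrow> a = Asc) y v w)"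
proof -
  have "word_count \<O> P u v (a # w) = (\<Sum>y\<in>succs u v. card {z \<in> paths_n G S (length w) y v.
      ad_word G \<O> (u # z) = a # w \<and> P (label u ((u # z) ! 1))})"
    unfolding word_count_def
    using card_paths_Suc[OF v, where P = "\<lambda>x. ad_word G \<O> x = a # w \<and> P (label u (x ! 1))"] by simp
  also have "\<dots> = (\<Sum>y\<in>succs u v. of_bool (P (label u y)) *
    word_count \<O> (\<lambda>r. strictly_below \<O> (label u y) r \<longleftrightarrow> a = Asc) y v w)"
  proof (rule sum.cong[OF HOL.refl])
    fix y assume "y \<in> succs u v"
    have "ad_word G \<O> (u # z) = a # w \<and> P (label u ((u # z) ! 1)) \<longleftrightarrow>
        P (label u y) \<and> ad_word G \<O> z = w \<and> (strictly_below \<O> (label u y) (label y (z ! 1)) \<longleftrightarrow> a = Asc)"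
      if "z \<in> paths_n G S (length w) y v" for z
      using path_nth_0[OF that] by (cases a) (auto simp: ad_word_path_Cons[OF that] first_letter_def)
    then have "{z \<in> paths_n G S (length w) y v. ad_word G \<O> (u # z) = a # w \<and> P (label u ((u # z) ! 1))} =
      {z \<in> paths_n G S (length w) y v. P (label u y) \<and> ad_word G \<O> z = w \<and>
        (strictly_below \<O> (label u y) (label y (z ! 1)) \<longleftrightarrow> a = Asc)}" by blast
    then show "card {z \<in> paths_n G S (length w) y v. ad_word G \<O> (u # z) = a # w \<and> P (label u ((u # z) ! 1))} =
      of_bool (P (label u y)) * word_count \<O> (\<lambda>r. strictly_below \<O> (label u y) r \<longleftrightarrow> a = Asc) y v w"
      by (simp add: word_count_def)
  qed
  finally show ?thesis .
qed

lemma word_count_split: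
  assumes v: "v \<in> carrier G"
  shows "total_count \<O> u v w = word_count \<O> P u v w + word_count \<O> (\<lambda>r. \<not> P r) u v w"
proof -
  have "{x \<in> paths_n G S (length w) u v. ad_word G \<O> x = w \<and> True} =
    {x \<in> paths_n G S (length w) u v. ad_word G \<O> x = w \<and> P (label u (x ! 1))} \<union>
    {x \<in> paths_n G S (length w) u v. ad_word G \<O> x = w \<and> \<not> P (label u (x ! 1))}" by blast
  then show ?thesis
    unfolding word_count_def by (simp only:) (rule card_Un_disjoint; auto simp: finite_paths[OF v])
qed

lemma word_count_below:
  assumes "y \<notin> below v"
  shows "word_count \<O> P y v w = 0"
proof -
  have "y \<in> below v" if "x \<in> paths_n G S (length w) y v" for x
    using path_below[OF that, of 0] path_nth_0[OF that] by (simp add: below_def)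
  then have "{x \<in> paths_n G S (length w) y v. ad_word G \<O> x = w \<and> P (label y (x ! 1))} = {}"
    using assms by blast
  then show ?thesis unfolding word_count_def by (simp only: card.empty)
qed

text \<open>Cutting a path at the letter after \<open>\<alpha>\<close> leaves that letter free.\<close>

lemma word_count_cut:
  assumes v: "v \<in> carrier G"
  shows "word_count \<O> P u v (\<alpha> @ Asc # \<beta>) + word_count \<O> P u v (\<alpha> @ Des # \<beta>) =
    (\<Sum>y\<in>below v. word_count \<O> P u y \<alpha> * total_count \<O> y v \<beta>)"
proof (induction \<alpha> arbitrary: u P)
  case Nil
  have "word_count \<O> P u v (Asc # \<beta>) + word_count \<O> P u v (Des # \<beta>) =
      (\<Sum>y\<in>succs u v. of_bool (P (label u y)) * total_count \<O> y v \<beta>)"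
    unfolding word_count_Cons[OF v] sum.distrib[symmetric] distrib_left[symmetric]
  proof (intro sum.cong HOL.refl)
    fix y
    show "of_bool (P (label u y)) * (word_count \<O> (\<lambda>r. strictly_below \<O> (label u y) r \<longleftrightarrow> Asc = Asc) y v \<beta> +
        word_count \<O> (\<lambda>r. strictly_below \<O> (label u y) r \<longleftrightarrow> Des = Asc) y v \<beta>) =
      of_bool (P (label u y)) * total_count \<O> y v \<beta>"
      using word_count_split[OF v, of \<O> y \<beta> "strictly_below \<O> (label u y)"] by simp
  qed
  also have "\<dots> = (\<Sum>y\<in>below v. word_count \<O> P u y [] * total_count \<O> y v \<beta>)"
    by (rule sum.mono_neutral_cong_left) (auto simp: finite_below v word_count_Nil succs_def)
  finally show ?case by simp
next
  case (Cons a \<alpha>)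
  define Q where "Q = (\<lambda>y r. strictly_below \<O> (label u y) r \<longleftrightarrow> a = Asc)"
  have "word_count \<O> P u v ((a # \<alpha>) @ Asc # \<beta>) + word_count \<O> P u v ((a # \<alpha>) @ Des # \<beta>) =
      (\<Sum>y\<in>succs u v. of_bool (P (label u y)) *
        (word_count \<O> (Q y) y v (\<alpha> @ Asc # \<beta>) + word_count \<O> (Q y) y v (\<alpha> @ Des # \<beta>)))"
    by (simp add: word_count_Cons[OF v] sum.distrib distrib_left Q_def)
  also have "\<dots> = (\<Sum>y\<in>succs u v. of_bool (P (label u y)) *
      (\<Sum>y'\<in>below v. word_count \<O> (Q y) y y' \<alpha> * total_count \<O> y' v \<beta>))"
    by (simp only: Cons.IH)
  also have "\<dots> = (\<Sum>y'\<in>below v. \<Sum>y\<in>succs u v.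
      of_bool (P (label u y)) * word_count \<O> (Q y) y y' \<alpha> * total_count \<O> y' v \<beta>)"
    unfolding sum_distrib_left by (subst sum.swap) (simp only: mult.assoc)
  also have "\<dots> = (\<Sum>y'\<in>below v. word_count \<O> P u y' (a # \<alpha>) * total_count \<O> y' v \<beta>)"
  proof (intro sum.cong HOL.refl)
    fix y' assume y': "y' \<in> below v"
    then have "y' \<in> carrier G" using below_carrier[OF v] by blast
    \<comment> \<open>Successors of \<open>u\<close> that are not below the cutting point
      \<open>y'\<close> carry no path to it.\<close>
    have "(\<Sum>y\<in>succs u v. of_bool (P (label u y)) * word_count \<O> (Q y) y y' \<alpha>) =
        (\<Sum>y\<in>succs u y'. of_bool (P (label u y)) * word_count \<O> (Q y) y y' \<alpha>)"
    proof (rule sum.mono_neutral_right[OF finite_succs[OF v]])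
      show "succs u y' \<subseteq> succs u v" using below_mono[OF y'] by (auto simp: succs_def)
      show "\<forall>y\<in>succs u v - succs u y'. of_bool (P (label u y)) * word_count \<O> (Q y) y y' \<alpha> = 0"
      proof
        fix y assume "y \<in> succs u v - succs u y'"
        then have "y \<notin> below y'" by (auto simp: succs_def)
        then show "of_bool (P (label u y)) * word_count \<O> (Q y) y y' \<alpha> = 0"
          by (simp add: word_count_below)
      qed
    qed
    also have "\<dots> = word_count \<O> P u y' (a # \<alpha>)"
      unfolding word_count_Cons[OF \<open>y' \<in> carrier G\<close>] Q_def ..
    finally show "(\<Sum>y\<in>succs u v. of_bool (P (label u y)) * word_count \<O> (Q y) y y' \<alpha> * total_count \<O> y' v \<beta>) =
        word_count \<O> P u y' (a # \<alpha>) * total_count \<O> y' v \<beta>"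
      unfolding sum_distrib_right[symmetric] by simp
  qed
  finally show ?case .
qed

text \<open>
  By the cutting formula, changing one letter of \<open>w\<close> changes the sign of the difference of
  the counts of \<open>w\<close> and its swap; for a word without descents the difference is \<open>0\<close>.
\<close>

lemma word_count_swap_eq:
  assumes ord: "cocycle_order \<O>" and "v \<in> carrier G" "u \<in> carrier G"
  shows "total_count \<O> u v (map swap_ad w) = total_count \<O> u v w"
  using assms(2,3)
proof (induction "length w" arbitrary: u v w rule: less_induct)
  case less
  have lin: "linear_order_on T \<O>" "linear_order_on T (\<O>\<inverse>)"
    using ord by (auto simp: cocycle_order_def)
  have below_c: "y \<in> carrier G" if "y \<in> below v" for y
    using below_carrier[OF less.prems(1)] that by blast
  \<comment> \<open>Both halves of the cut are shorter than \<open>w\<close>, so the induction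
    hypothesis makes the sum over the two choices of the letter symmetric.\<close>
  have swap: "total_count \<O> u v (map swap_ad (\<alpha> @ Asc # \<beta>)) + total_count \<O> u v (map swap_ad (\<alpha> @ Des # \<beta>)) =
      total_count \<O> u v (\<alpha> @ Asc # \<beta>) + total_count \<O> u v (\<alpha> @ Des # \<beta>)"
    if "length w = length \<alpha> + Suc (length \<beta>)" for \<alpha> \<beta>
  proof -
    have "total_count \<O> u y (map swap_ad \<alpha>) * total_count \<O> y v (map swap_ad \<beta>) =
        total_count \<O> u y \<alpha> * total_count \<O> y v \<beta>" if "y \<in> below v" for y
      using less.hyps[of \<alpha> y u] less.hyps[of \<beta> v y] less.prems below_c[OF that]
        \<open>length w = _\<close> by simp
    then show ?thesis
      using word_count_cut[OF less.prems(1), of \<O> "\<lambda>_. True" u "map swap_ad \<alpha>" "map swap_ad \<beta>"]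
        word_count_cut[OF less.prems(1), of \<O> "\<lambda>_. True" u \<alpha> \<beta>]
      by (simp add: add.commute)
  qed
  \<comment> \<open>The induction runs over the part not yet normalised, from its last letter: an
    \<open>Asc\<close> is absorbed into the block of ascents, a \<open>Des\<close> is replaced by
    \<open>Asc\<close> by means of \<open>swap\<close>.\<close>
  have "total_count \<O> u v (map swap_ad (\<alpha> @ replicate k Asc)) = total_count \<O> u v (\<alpha> @ replicate k Asc)"
    if "length w = length \<alpha> + k" for \<alpha> k
    using that
  proof (induction \<alpha> arbitrary: k rule: rev_induct)
    case Nil
    show ?case
      using word_count_Asc[OF lin(1) less.prems] word_count_Asc[OF lin(2) less.prems]
        chains_converse[OF ord less.prems]
      by (simp only: append_Nil word_count_swap[OF lin(1)])
  next
    case (snoc a \<alpha>)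
    have Asc: "total_count \<O> u v (map swap_ad (\<alpha> @ Asc # replicate k Asc)) =
        total_count \<O> u v (\<alpha> @ Asc # replicate k Asc)"
      using snoc.IH[of "Suc k"] snoc.prems by simp
    show ?case
    proof (cases a)
      case Asc
      then show ?thesis using \<open>total_count \<O> u v (map swap_ad (\<alpha> @ Asc # replicate k Asc)) = _\<close> by simp
    next
      case Des
      then show ?thesis using Asc swap[of \<alpha> "replicate k Asc"] snoc.prems by simp
    qed
  qed
  from this[of w 0] show ?case by simp
qed

end

section \<open>The cd-polynomials of a truncated path set\<close>

definition swap_invariant :: "ad ncpoly \<Rightarrow> bool" where
  "swap_invariant p \<longleftrightarrow> (\<forall>w. Poly_Mapping.lookup p (map swap_ad w) = Poly_Mapping.lookup p w)"

lemma swap_invariant_mult_cd_value: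
  assumes "swap_invariant p"
  shows "swap_invariant (cd_value x * p)"
  unfolding swap_invariant_def
proof
  fix w
  have inv: "Poly_Mapping.lookup p (map swap_ad w) = Poly_Mapping.lookup p w" for w
    using assms by (simp add: swap_invariant_def)
  have split: "nc_monom [a, b] * p = nc_monom [a] * (nc_monom [b] * p)" for a b
    by (simp add: nc_monom_mult flip: mult.assoc)
  show "Poly_Mapping.lookup (cd_value x * p) (map swap_ad w) = Poly_Mapping.lookup (cd_value x * p) w"
  proof (cases w)
    case Nil
    then show ?thesis by simp
  next
    case w: (Cons a w')
    show ?thesis
    proof (cases x)
      case VarC
      then show ?thesis
        using w by (cases a) (simp_all add: distrib_right lookup_add lookup_nc_monom_mult_Cons inv)
    next
      case VarD
      show ?thesis
      proof (cases w')
        case Nil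
        then show ?thesis
          using w VarD by (cases a)
            (simp_all add: distrib_right lookup_add split lookup_nc_monom_mult_Cons lookup_nc_monom_mult_Nil)
      next
        case (Cons b w'')
        then show ?thesis
          using w VarD by (cases a; cases b)
            (simp_all add: distrib_right lookup_add split lookup_nc_monom_mult_Cons inv)
      qed
    qed
  qed
qed

lemma swap_invariant_nc_subst: "swap_invariant (nc_subst cd_value p)"
proof (induction p rule: ncpoly_induct)
  case (single k v)
  show ?case
  proof (induction k)
    case Nil
    show ?case by (auto simp: nc_subst_single swap_invariant_def lookup_of_int zero_list_def when_def)
  next
    case (Cons x k)
    have "Poly_Mapping.single (x # k) v = nc_monom [x] * Poly_Mapping.single k v"
      by (simp add: nc_monom_def mult_single plus_list_def)
    then show ?case
      using swap_invariant_mult_cd_value[OF Cons, of x] by (simp add: nc_subst_nc_monom_mult)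
  qed
next
  case (add f g)
  then show ?case by (simp add: nc_subst_add swap_invariant_def lookup_add)
qed

text \<open>In a product with A on the left no word begins with D, so symmetry removes the words
  beginning with A as well.\<close>

lemma Asc_mult_swap_invariant:
  assumes "swap_invariant (nc_monom [Asc] * p)"
  shows "p = 0"
proof (rule poly_mapping_eqI)
  fix w
  have "Poly_Mapping.lookup p w = Poly_Mapping.lookup (nc_monom [Asc] * p) (Asc # w)"
    by (simp add: lookup_nc_monom_mult_Cons)
  also have "\<dots> = Poly_Mapping.lookup (nc_monom [Asc] * p) (map swap_ad (Asc # w))"
    using assms by (simp only: swap_invariant_def)
  also have "\<dots> = 0" by (simp add: lookup_nc_monom_mult_Cons)
  finally show "Poly_Mapping.lookup p w = Poly_Mapping.lookup 0 w" by simp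
qed

context coxeter
begin

text \<open>Negating "strictly above" makes this match the letter \<open>Des\<close> for every
  label; on reflections it is \<open>r \<le> t\<close>.\<close>

definition upto_label :: "'a rel \<Rightarrow> 'a \<Rightarrow> 'a set" where
  "upto_label \<O> t = {r. \<not> strictly_below \<O> t r}"

text \<open>A set of labels replaces the bound \<open>t\<close>, so that \<open>UNIV\<close> gives
  the untruncated polynomial, which the recursion also calls for.\<close>

definition phi :: "'a rel \<Rightarrow> nat \<Rightarrow> 'a \<Rightarrow> 'a \<Rightarrow> 'a set \<Rightarrow> ad ncpoly" where
  "phi \<O> n u v L = (\<Sum>x | x \<in> paths_n G S n u v \<and> label u (x ! 1) \<in> L. nc_monom (ad_word G \<O> x))"

text \<open>
  Splitting off the first edge \<open>u \<prec> y\<close> with label \<open>t\<close> turns \<open>f + A g\<close> for the paths from \<open>y\<close>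
  with first label at most \<open>t\<close>, and \<open>F\<close> for all paths from \<open>y\<close>, into
  \<open>D (f + A g) + A (F - f - A g) = (c f + d g) + A (F - 2 f - c g)\<close>.
\<close>

fun cd_f :: "'a rel \<Rightarrow> nat \<Rightarrow> 'a \<Rightarrow> 'a \<Rightarrow> 'a set \<Rightarrow> cd ncpoly"
  and cd_g :: "'a rel \<Rightarrow> nat \<Rightarrow> 'a \<Rightarrow> 'a \<Rightarrow> 'a set \<Rightarrow> cd ncpoly" where
  "cd_f \<O> 0 u v L = of_bool (bruhat_edge G S u v \<and> label u v \<in> L)"
| "cd_f \<O> (Suc n) u v L = (\<Sum>y | y \<in> succs u v \<and> label u y \<in> L.
     nc_monom [VarC] * cd_f \<O> n y v (upto_label \<O> (label u y)) +
     nc_monom [VarD] * cd_g \<O> n y v (upto_label \<O> (label u y)))"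
| "cd_g \<O> 0 u v L = 0"
| "cd_g \<O> (Suc n) u v L = (\<Sum>y | y \<in> succs u v \<and> label u y \<in> L.
     cd_f \<O> n y v UNIV - cd_f \<O> n y v (upto_label \<O> (label u y)) -
     cd_f \<O> n y v (upto_label \<O> (label u y)) -
     nc_monom [VarC] * cd_g \<O> n y v (upto_label \<O> (label u y)))"

lemma cd_homogeneous_cd_f_g:
  "cd_homogeneous (int n) (cd_f \<O> n u v L)" "cd_homogeneous (int n - 1) (cd_g \<O> n u v L)"
proof (induction n arbitrary: u L)
  case 0
  show "cd_homogeneous (int 0) (cd_f \<O> 0 u v L)" "cd_homogeneous (int 0 - 1) (cd_g \<O> 0 u v L)" for u L
    by (simp_all add: cd_homogeneous_of_bool)
next
  case (Suc n)
  show "cd_homogeneous (int (Suc n)) (cd_f \<O> (Suc n) u v L)" for u L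
    unfolding cd_f.simps
    by (intro cd_homogeneous_sum cd_homogeneous_add cd_homogeneous_mult[OF Suc.IH(1)] cd_homogeneous_mult[OF Suc.IH(2)]) auto
  show "cd_homogeneous (int (Suc n) - 1) (cd_g \<O> (Suc n) u v L)" for u L
    unfolding cd_g.simps using Suc.IH(1)
    by (intro cd_homogeneous_sum cd_homogeneous_diff cd_homogeneous_mult[OF Suc.IH(2)]) auto
qed

lemma sum_paths_filter:
  assumes "v \<in> carrier G"
  shows "(\<Sum>x | x \<in> paths_n G S n u v \<and> P x. h x) =
    (\<Sum>x\<in>paths_n G S n u v. if P x then h x else (0::'c::comm_monoid_add))"
  by (rule sum.inter_filter[OF finite_paths[OF assms]])

lemma first_letter_Des_iff:
  "z ! 0 = y \<Longrightarrow> first_letter \<O> t z = Des \<longleftrightarrow> label y (z ! 1) \<in> upto_label \<O> t"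
  by (simp add: first_letter_def upto_label_def)

lemma first_letter_Asc_iff:
  "z ! 0 = y \<Longrightarrow> first_letter \<O> t z = Asc \<longleftrightarrow> label y (z ! 1) \<notin> upto_label \<O> t"
  by (simp add: first_letter_def upto_label_def)

lemma sum_paths_upto_Suc:
  assumes v: "v \<in> carrier G"
  shows "(\<Sum>x | x \<in> paths_n G S (Suc n) u v \<and> label u (x ! 1) \<in> L. h x) =
    (\<Sum>y | y \<in> succs u v \<and> label u y \<in> L. \<Sum>z\<in>paths_n G S n y v. h (u # z))"
proof -
  have "(\<Sum>x | x \<in> paths_n G S (Suc n) u v \<and> label u (x ! 1) \<in> L. h x) =
    (\<Sum>y\<in>succs u v. \<Sum>z\<in>paths_n G S n y v. if label u ((u # z) ! 1) \<in> L then h (u # z) else 0)"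
    unfolding sum_paths_filter[OF v] by (rule sum_paths_Suc[OF v])
  also have "\<dots> = (\<Sum>y\<in>succs u v. if label u y \<in> L then (\<Sum>z\<in>paths_n G S n y v. h (u # z)) else 0)"
    by (intro sum.cong HOL.refl) (auto simp: path_nth_0)
  also have "\<dots> = (\<Sum>y | y \<in> succs u v \<and> label u y \<in> L. \<Sum>z\<in>paths_n G S n y v. h (u # z))"
    by (rule sum.inter_filter[OF finite_succs[OF v], symmetric])
  finally show ?thesis .
qed

lemma phi_Suc:
  assumes v: "v \<in> carrier G"
  shows "phi \<O> (Suc n) u v L = (\<Sum>y | y \<in> succs u v \<and> label u y \<in> L.
    nc_monom [Des] * phi \<O> n y v (upto_label \<O> (label u y)) +
    nc_monom [Asc] * (phi \<O> n y v UNIV - phi \<O> n y v (upto_label \<O> (label u y))))"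
  unfolding phi_def sum_paths_upto_Suc[OF v]
proof (intro sum.cong HOL.refl)
  fix y
  let ?U = "upto_label \<O> (label u y)" and ?w = "\<lambda>z. nc_monom (ad_word G \<O> z)"
  have "(\<Sum>z\<in>paths_n G S n y v. nc_monom (ad_word G \<O> (u # z))) =
    (\<Sum>z\<in>paths_n G S n y v. nc_monom [Des] * (if label y (z ! 1) \<in> ?U then ?w z else 0) +
      nc_monom [Asc] * (?w z - (if label y (z ! 1) \<in> ?U then ?w z else 0)))"
  proof (intro sum.cong HOL.refl)
    fix z assume z: "z \<in> paths_n G S n y v"
    have "first_letter \<O> (label u y) z = (if label y (z ! 1) \<in> ?U then Des else Asc)"
      using first_letter_Des_iff first_letter_Asc_iff path_nth_0[OF z] by auto
    then show "nc_monom (ad_word G \<O> (u # z)) =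
      nc_monom [Des] * (if label y (z ! 1) \<in> ?U then ?w z else 0) +
      nc_monom [Asc] * (?w z - (if label y (z ! 1) \<in> ?U then ?w z else 0))"
      by (simp add: ad_word_path_Cons[OF z] nc_monom_mult)
  qed
  then show "(\<Sum>z\<in>paths_n G S n y v. nc_monom (ad_word G \<O> (u # z))) =
    nc_monom [Des] * (\<Sum>x | x \<in> paths_n G S n y v \<and> label y (x ! 1) \<in> ?U. ?w x) +
    nc_monom [Asc] * ((\<Sum>x | x \<in> paths_n G S n y v \<and> label y (x ! 1) \<in> UNIV. ?w x) -
      (\<Sum>x | x \<in> paths_n G S n y v \<and> label y (x ! 1) \<in> ?U. ?w x))"
    unfolding sum_paths_filter[OF v]
    by (simp add: sum.distrib sum_subtractf flip: sum_distrib_left)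
qed

lemma swap_invariant_phi:
  assumes "cocycle_order \<O>" "v \<in> carrier G" "u \<in> carrier G"
  shows "swap_invariant (phi \<O> n u v UNIV)"
proof -
  have "Poly_Mapping.lookup (phi \<O> n u v UNIV) w = of_bool (length w = n) * int (total_count \<O> u v w)" for w
  proof -
    have "Poly_Mapping.lookup (phi \<O> n u v UNIV) w =
        (\<Sum>x\<in>paths_n G S n u v. of_bool (ad_word G \<O> x = w))"
      by (simp add: phi_def lookup_sum lookup_nc_monom)
    also have "\<dots> = int (card {x \<in> paths_n G S n u v. ad_word G \<O> x = w})"
      by (simp add: finite_paths[OF assms(2)] Int_def)
    also have "{x \<in> paths_n G S n u v. ad_word G \<O> x = w} =
        (if length w = n then {x \<in> paths_n G S n u v. ad_word G \<O> x = w} else {})"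
      by (auto simp: ad_word_length path_length)
    finally show ?thesis by (simp add: word_count_def)
  qed
  then show ?thesis
    using word_count_swap_eq[OF assms] by (simp add: swap_invariant_def)
qed

lemma phi_eq:
  assumes ord: "cocycle_order \<O>" and v: "v \<in> carrier G" and "u \<in> carrier G"
  shows "phi \<O> n u v L = nc_subst cd_value (cd_f \<O> n u v L) + nc_monom [Asc] * nc_subst cd_value (cd_g \<O> n u v L)"
  using assms(3)
proof (induction n arbitrary: u L)
  case 0
  have "phi \<O> 0 u v L = of_bool (bruhat_edge G S u v \<and> label u v \<in> L)"
  proof -
    have "{x \<in> paths_n G S 0 u v. label u (x ! 1) \<in> L} = (if bruhat_edge G S u v \<and> label u v \<in> L then {[u, v]} else {})"
      by (auto simp: paths_0)
    then show ?thesis by (simp add: phi_def ad_word_two nc_monom_Nil)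
  qed
  then show ?case by (simp add: nc_subst_of_bool)
next
  case (Suc n)
  let ?s = "nc_subst cd_value" and ?A = "nc_monom [Asc]" and ?D = "nc_monom [Des]"
  have "?D * phi \<O> n y v U + ?A * (phi \<O> n y v UNIV - phi \<O> n y v U) =
      ?s (nc_monom [VarC] * cd_f \<O> n y v U + nc_monom [VarD] * cd_g \<O> n y v U) +
      ?A * ?s (cd_f \<O> n y v UNIV - cd_f \<O> n y v U - cd_f \<O> n y v U - nc_monom [VarC] * cd_g \<O> n y v U)"
    if y: "y \<in> succs u v" for y U
  proof -
    have yc: "y \<in> carrier G" using y by (simp add: succs_def bruhat_edge_def)
    note IH = Suc.IH[OF yc]
    \<comment> \<open>The total polynomial and its \<open>cd_f\<close> part are both invariant,
      hence so is their difference.\<close>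
    have "swap_invariant (?A * ?s (cd_g \<O> n y v UNIV))"
      using swap_invariant_phi[OF ord v yc, of n] swap_invariant_nc_subst[of "cd_f \<O> n y v UNIV"]
      unfolding IH[of UNIV] by (simp add: swap_invariant_def lookup_add)
    then have "?s (cd_g \<O> n y v UNIV) = 0"
      by (rule Asc_mult_swap_invariant)
    then have "phi \<O> n y v UNIV = ?s (cd_f \<O> n y v UNIV)"
      unfolding IH[of UNIV] by simp
    then show ?thesis
      unfolding IH[of U]
      by (simp add: nc_subst_add nc_subst_diff nc_subst_nc_monom_mult algebra_simps nc_monom_mult)
        (simp flip: mult.assoc add: nc_monom_mult)
  qed
  then show ?case
    unfolding phi_Suc[OF v] cd_f.simps cd_g.simps nc_subst_sum sum_distrib_left sum.distrib[symmetric]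
    by (intro sum.cong) auto
qed

end

section \<open>Signs of paths under a flip\<close>

lemma length_cd_pattern: "length (cd_pattern M) = cd_degree M"
proof (induction M)
  case (Cons x M)
  then show ?case by (cases x) (auto simp: cd_pattern_def)
qed (simp add: cd_pattern_def)

text \<open>Dropping the leading letter from the pattern of \<open>d M\<close> leaves that of
  \<open>c M\<close>, so edges can be removed one at a time without leaving the monomials.\<close>

lemma cd_pattern_simps [simp]:
  "cd_pattern [] = []" "cd_pattern (VarC # M) = Asc # cd_pattern M"
  "cd_pattern (VarD # M) = Des # cd_pattern (VarC # M)"
  by (simp_all add: cd_pattern_def)

text \<open>A letter \<open>Des\<close> only occurs at the start of the block for
  \<open>VarD\<close>, so a cut in front of it does not split a block.\<close>

lemma cd_pattern_suffix:
  "k < length (cd_pattern M) \<Longrightarrow> cd_pattern M ! k = Des \<Longrightarrow> \<exists>M'. cd_pattern M' = drop k (cd_pattern M)"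
proof (induction M arbitrary: k)
  case (Cons x M)
  show ?case
  proof (cases x)
    case VarC
    then show ?thesis using Cons by (cases k) auto
  next
    case VarD
    show ?thesis
    proof (cases k)
      case 0
      then show ?thesis by (metis drop0)
    next
      case (Suc k')
      then show ?thesis using Cons VarD by (cases k') auto
    qed
  qed
qed simp

text \<open>A factor different from 1 is 0 or is followed by a factor 0.\<close>

lemma prod_sign_eq_of_bool:
  fixes f :: "nat \<Rightarrow> int"
  assumes vals: "\<And>m. m \<in> {1..n} \<Longrightarrow> f m \<in> {-1, 0, 1}"
    and zero: "\<And>m. m \<in> {1..n} \<Longrightarrow> f m = -1 \<Longrightarrow> \<exists>l\<in>{m<..n}. f l = 0"
  shows "(\<Prod>m=1..n. f m) = of_bool (\<forall>m\<in>{1..n}. f m = 1)"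
proof (cases "\<forall>m\<in>{1..n}. f m = 1")
  case False
  then obtain m where "m \<in> {1..n}" "f m \<noteq> 1" by blast
  then have "\<exists>l\<in>{1..n}. f l = 0"
    using vals[of m] zero[of m] by fastforce
  then have "(\<Prod>m=1..n. f m) = 0" by (intro prod_zero) auto
  then show ?thesis using False by simp
qed simp

context coxeter
begin

lemma path_cut:
  assumes "x \<in> paths_n G S n u w" "k \<le> n"
  shows "drop k x \<in> paths_n G S (n - k) (x ! k) w"
    "y \<in> paths_n G S (n - k) (x ! k) w \<Longrightarrow> take k x @ y \<in> paths_n G S n u w"
proof -
  have "drop k x \<in> paths_n G S (n - k) (x ! k) w \<and>
    (y \<in> paths_n G S (n - k) (x ! k) w \<longrightarrow> take k x @ y \<in> paths_n G S n u w)"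
    using assms
  proof (induction k arbitrary: x n u)
    case 0
    then show ?case using path_nth_0[OF 0(1)] by simp
  next
    case (Suc k)
    then obtain n' where n: "n = Suc n'" by (cases n) auto
    obtain u' x' where x: "x = u' # x'"
      using path_nonempty[OF Suc.prems(1)] by (cases x) auto
    have *: "u' = u" "edge u (x' ! 0)" "x' \<in> paths_n G S n' (x' ! 0) w"
      using Suc.prems(1) unfolding n x Cons_path_iff by simp_all
    have "k \<le> n'" using Suc.prems(2) n by simp
    note IH = Suc.IH[OF *(3) this]
    have "take (Suc k) x @ y \<in> paths_n G S n u w" if "y \<in> paths_n G S (n' - k) (x' ! k) w"
    proof -
      have y: "take k x' @ y \<in> paths_n G S n' (x' ! 0) w"
        using IH that by blast
      show ?thesis
        using *(1,2) y path_nth_0[OF y] unfolding n x by (simp add: Cons_path_iff)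
    qed
    then show ?case using IH unfolding n x by simp
  qed
  then show "drop k x \<in> paths_n G S (n - k) (x ! k) w"
    "y \<in> paths_n G S (n - k) (x ! k) w \<Longrightarrow> take k x @ y \<in> paths_n G S n u w"
    by blast+
qed

definition pattern_sign :: "'a rel \<Rightarrow> 'a flip_family \<Rightarrow> ad list \<Rightarrow> 'a list \<Rightarrow> int" where
  "pattern_sign \<O> F \<gamma> x = (\<Prod>m<length \<gamma>. flip_sign G \<O> F (Suc m) (\<gamma> ! m) x)"

lemma monom_sign_pattern: "monom_sign G \<O> F M x = pattern_sign \<O> F (cd_pattern M) x"
  unfolding monom_sign_def pattern_sign_def length_cd_pattern monom_sign_at_def
  by (simp add: prod.atLeast1_atMost_eq)

lemma flip_tail_Cons:
  "z \<noteq> [] \<Longrightarrow> flip_tail F (Suc m) (u # z) = u # flip_tail F m z"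
  by (simp add: flip_tail_def)

lemma flip_sign_Cons:
  "z \<noteq> [] \<Longrightarrow> m \<ge> 1 \<Longrightarrow> flip_sign G \<O> F (Suc m) \<gamma> (u # z) = flip_sign G \<O> F m \<gamma> z"
  by (simp add: flip_sign_def flip_tail_Cons ad_letter_Cons_Suc)

text \<open>The sign at position m depends only on the path from its vertex m - 1 on.\<close>

lemma flip_sign_append:
  "z \<noteq> [] \<Longrightarrow> m \<ge> 1 \<Longrightarrow> flip_sign G \<O> F (length us + m) \<gamma> (us @ z) = flip_sign G \<O> F m \<gamma> z"
  by (induction us) (auto simp: flip_sign_Cons)

lemma pattern_sign_Cons:
  assumes "z \<noteq> []"
  shows "pattern_sign \<O> F (a # \<gamma>) (u # z) = flip_sign G \<O> F 1 a (u # z) * pattern_sign \<O> F \<gamma> z"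
  using assms by (simp add: pattern_sign_def prod.lessThan_Suc_shift flip_sign_Cons del: prod.lessThan_Suc)

text \<open>As a difference of indicators for the flipped tail and the tail itself, the sign at
  \<open>Des\<close> can be summed over the two separately.\<close>

lemma flip_sign_first:
  assumes "z \<in> paths_n G S n y v"
  shows "flip_sign G \<O> F 1 Asc (u # z) = of_bool (first_letter \<O> (label u y) z = Asc)"
    "F y v z \<in> paths_n G S n y v \<Longrightarrow> flip_sign G \<O> F 1 Des (u # z) =
      of_bool (first_letter \<O> (label u y) (F y v z) = Asc) - of_bool (first_letter \<O> (label u y) z = Asc)"
proof -
  have z: "z \<noteq> []" "z ! 0 = y" "last z = v"
    using path_nonempty path_nth_0 path_last assms by blast+
  show "flip_sign G \<O> F 1 Asc (u # z) = of_bool (first_letter \<O> (label u y) z = Asc)"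
    using z by (simp add: flip_sign_def ad_letter_Cons_1)
  assume "F y v z \<in> paths_n G S n y v"
  then have "F y v z ! 0 = y" by (rule path_nth_0)
  moreover have "flip_tail F 1 (u # z) = u # F y v z"
    using z by (simp add: flip_tail_def)
  ultimately show "flip_sign G \<O> F 1 Des (u # z) =
      of_bool (first_letter \<O> (label u y) (F y v z) = Asc) - of_bool (first_letter \<O> (label u y) z = Asc)"
    using z by (cases "first_letter \<O> (label u y) z"; cases "first_letter \<O> (label u y) (F y v z)")
      (simp_all add: flip_sign_def ad_letter_Cons_1)
qed

text \<open>A flip may a priori change the length, but the length can be read off from the
  ascent-descent word.\<close>

lemma flip_path:
  assumes "is_flip G S \<O> F" "z \<in> paths_n G S n y v"
  shows "F y v z \<in> paths_n G S n y v" "F y v (F y v z) = z"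
proof -
  have "bruhat_less G S y v"
    using path_bruhat_less[OF assms(2), of 0] path_nth_0[OF assms(2)] by simp
  moreover have "z \<in> paths G S y v" using assms(2) by (auto simp: paths_def)
  ultimately have *: "F y v z \<in> paths G S y v" "F y v (F y v z) = z"
    "ad_word G \<O> (F y v z) = map swap_ad (ad_word G \<O> z)"
    using assms(1) unfolding is_flip_def by blast+
  show "F y v (F y v z) = z" by fact
  obtain k where k: "F y v z \<in> paths_n G S k y v" using *(1) by (auto simp: paths_def)
  have "length (ad_word G \<O> (F y v z)) = length (ad_word G \<O> z)" by (simp add: *(3))
  then have "k = n"
    using path_length[OF k] path_length[OF assms(2)] by (simp add: ad_word_length)
  with k show "F y v z \<in> paths_n G S n y v" by simp
qed

lemma sum_flip:
  assumes "is_flip G S \<O> F"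
  shows "(\<Sum>z\<in>paths_n G S n y v. h (F y v z)) = (\<Sum>z\<in>paths_n G S n y v. h z)"
  by (rule sum.reindex_bij_witness[of _ "F y v" "F y v"]) (use flip_path[OF assms] in auto)

lemma compatible_flip_sign:
  assumes "compatible_flip G S \<O> F" "z \<in> paths_n G S (cd_degree M) y v"
  shows "monom_sign G \<O> F M z = monom_sign G (\<O>\<inverse>) F M (F y v z)"
proof -
  have "bruhat_less G S y v"
    using path_bruhat_less[OF assms(2), of 0] path_nth_0[OF assms(2)] by simp
  then show ?thesis using assms unfolding compatible_flip_def by blast
qed

section \<open>Sums of signs over truncated path sets\<close>

definition sign_sum :: "'a rel \<Rightarrow> 'a flip_family \<Rightarrow> cd list \<Rightarrow> 'a \<Rightarrow> 'a \<Rightarrow> 'a set \<Rightarrow> int" where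
  "sign_sum \<O> F M u v L =
     (\<Sum>x | x \<in> paths_n G S (cd_degree M) u v \<and> label u (x ! 1) \<in> L. monom_sign G \<O> F M x)"

lemma sign_sum_Cons:
  assumes v: "v \<in> carrier G" and deg: "cd_degree M = Suc n" and pat: "cd_pattern M = a # cd_pattern M'"
    and deg': "cd_degree M' = n"
  shows "sign_sum \<O> F M u v L = (\<Sum>y | y \<in> succs u v \<and> label u y \<in> L.
    \<Sum>z\<in>paths_n G S n y v. flip_sign G \<O> F 1 a (u # z) * monom_sign G \<O> F M' z)"
  unfolding sign_sum_def deg sum_paths_upto_Suc[OF v]
  by (intro sum.cong HOL.refl) (simp add: monom_sign_pattern pat pattern_sign_Cons path_nonempty)

lemma sign_sum_if:
  assumes "v \<in> carrier G" "cd_degree M = n"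
  shows "sign_sum \<O> F M y v L = (\<Sum>z\<in>paths_n G S n y v. of_bool (label y (z ! 1) \<in> L) * monom_sign G \<O> F M z)"
  unfolding sign_sum_def sum_paths_filter[OF assms(1)] assms(2) by (intro sum.cong) auto

context
  fixes \<O> :: "'a rel" and F :: "'a flip_family" and v :: 'a
  assumes lin: "linear_order_on T \<O>" and flip: "is_flip G S \<O> F"
    and compat: "compatible_flip G S \<O> F" and v: "v \<in> carrier G"
begin

text \<open>By compatibility the flip carries the terms for \<O> to those for the reverse order;
  without truncation it permutes the paths involved.\<close>

lemma sign_sum_UNIV: "sign_sum (\<O>\<inverse>) F M y v UNIV = sign_sum \<O> F M y v UNIV"
proof -
  have "sign_sum \<O> F M y v UNIV =
      (\<Sum>z\<in>paths_n G S (cd_degree M) y v. monom_sign G (\<O>\<inverse>) F M (F y v z))"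
    unfolding sign_sum_def by (intro sum.cong) (auto simp: compatible_flip_sign[OF compat])
  then show ?thesis by (simp add: sum_flip[OF flip] sign_sum_def)
qed

lemma sign_sum_Asc:
  assumes M: "cd_degree M = n"
  shows "(\<Sum>z\<in>paths_n G S n y v. flip_sign G \<O> F 1 Asc (u # z) * monom_sign G \<O> F M z) =
      sign_sum \<O> F M y v UNIV - sign_sum \<O> F M y v (upto_label \<O> (label u y))"
  unfolding sign_sum_if[OF v M] sum_subtractf[symmetric]
proof (intro sum.cong HOL.refl)
  fix z assume z: "z \<in> paths_n G S n y v"
  show "flip_sign G \<O> F 1 Asc (u # z) * monom_sign G \<O> F M z =
    of_bool (label y (z ! 1) \<in> UNIV) * monom_sign G \<O> F M z -
    of_bool (label y (z ! 1) \<in> upto_label \<O> (label u y)) * monom_sign G \<O> F M z"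
    unfolding flip_sign_first(1)[OF z] first_letter_Asc_iff[OF path_nth_0[OF z]] by simp
qed

lemma first_letter_converse_Asc_iff:
  assumes "edge u y" "z \<in> paths_n G S n y v"
  shows "first_letter (\<O>\<inverse>) (label u y) z = Asc \<longleftrightarrow> label y (z ! 1) \<in> upto_label \<O> (label u y)"
  using first_letter_converse[OF lin assms]
    first_letter_Des_iff[OF path_nth_0[OF assms(2)], of \<O> "label u y"]
  by (cases "first_letter \<O> (label u y) z") auto

lemma sign_sum_Asc_converse:
  assumes M: "cd_degree M = n" and e: "edge u y"
  shows "(\<Sum>z\<in>paths_n G S n y v. flip_sign G (\<O>\<inverse>) F 1 Asc (u # z) * monom_sign G (\<O>\<inverse>) F M z) =
      sign_sum (\<O>\<inverse>) F M y v (upto_label \<O> (label u y))"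
  unfolding sign_sum_if[OF v M]
  by (intro sum.cong HOL.refl) (simp only: flip_sign_first(1) first_letter_converse_Asc_iff[OF e])

text \<open>Let U be the labels up to that of the edge. The sign is 1 if the first label of
  \<open>z\<close> lies in U, minus 1 if that of \<open>F z\<close> does. In the second term
  compatibility replaces the sign of \<open>z\<close> by the reversed sign of \<open>F z\<close>,
  and reindexing by the flip removes \<open>F\<close>.\<close>

lemma sign_sum_Des:
  assumes M: "cd_degree M = n"
  shows "(\<Sum>z\<in>paths_n G S n y v. flip_sign G \<O> F 1 Des (u # z) * monom_sign G \<O> F M z) =
      sign_sum \<O> F M y v (upto_label \<O> (label u y)) - sign_sum (\<O>\<inverse>) F M y v (upto_label \<O> (label u y))"
proof -
  let ?in = "\<lambda>z. of_bool (label y (z ! 1) \<in> upto_label \<O> (label u y)) :: int"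
  have "(\<Sum>z\<in>paths_n G S n y v. flip_sign G \<O> F 1 Des (u # z) * monom_sign G \<O> F M z) =
      (\<Sum>z\<in>paths_n G S n y v. ?in z * monom_sign G \<O> F M z - ?in (F y v z) * monom_sign G (\<O>\<inverse>) F M (F y v z))"
  proof (intro sum.cong HOL.refl)
    fix z assume z: "z \<in> paths_n G S n y v"
    note Fz = flip_path(1)[OF flip z]
    show "flip_sign G \<O> F 1 Des (u # z) * monom_sign G \<O> F M z =
      ?in z * monom_sign G \<O> F M z - ?in (F y v z) * monom_sign G (\<O>\<inverse>) F M (F y v z)"
      unfolding flip_sign_first(2)[where F = F, OF z Fz] first_letter_Asc_iff[OF path_nth_0[OF z]]
        first_letter_Asc_iff[OF path_nth_0[OF Fz]]
      using compatible_flip_sign[OF compat, of z M y v] z M by auto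
  qed
  also have "\<dots> = sign_sum \<O> F M y v (upto_label \<O> (label u y)) - sign_sum (\<O>\<inverse>) F M y v (upto_label \<O> (label u y))"
    unfolding sum_subtractf sign_sum_if[OF v M]
    using sum_flip[OF flip, where h = "\<lambda>z. ?in z * monom_sign G (\<O>\<inverse>) F M z"] by simp
  finally show ?thesis .
qed

text \<open>Reversing \<O> negates the sign at the leading letter, but compatibility also exchanges
  the roles of \<open>z\<close> and \<open>F z\<close>; hence the value is that for \<O>. It mirrors
  the fact that a monomial starting with d has the same coefficient in \<open>f\<close> and in
  \<open>f + c g\<close>.\<close>

lemma sign_sum_Des_converse:
  assumes M: "cd_degree M = n" and e: "edge u y"
  shows "(\<Sum>z\<in>paths_n G S n y v. flip_sign G (\<O>\<inverse>) F 1 Des (u # z) * monom_sign G (\<O>\<inverse>) F M z) =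
      sign_sum \<O> F M y v (upto_label \<O> (label u y)) - sign_sum (\<O>\<inverse>) F M y v (upto_label \<O> (label u y))"
proof -
  let ?in = "\<lambda>z. of_bool (label y (z ! 1) \<in> upto_label \<O> (label u y)) :: int"
  have "(\<Sum>z\<in>paths_n G S n y v. flip_sign G (\<O>\<inverse>) F 1 Des (u # z) * monom_sign G (\<O>\<inverse>) F M z) =
      (\<Sum>z\<in>paths_n G S n y v. ?in (F y v z) * monom_sign G \<O> F M (F y v z) - ?in z * monom_sign G (\<O>\<inverse>) F M z)"
  proof (intro sum.cong HOL.refl)
    fix z assume z: "z \<in> paths_n G S n y v"
    note Fz = flip_path(1)[OF flip z]
    have "monom_sign G \<O> F M (F y v z) = monom_sign G (\<O>\<inverse>) F M z"
      using compatible_flip_sign[OF compat, of "F y v z" M y v] Fz M flip_path(2)[OF flip z] by simp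
    then show "flip_sign G (\<O>\<inverse>) F 1 Des (u # z) * monom_sign G (\<O>\<inverse>) F M z =
      ?in (F y v z) * monom_sign G \<O> F M (F y v z) - ?in z * monom_sign G (\<O>\<inverse>) F M z"
      unfolding flip_sign_first(2)[where F = F, OF z Fz] first_letter_converse_Asc_iff[OF e z]
        first_letter_converse_Asc_iff[OF e Fz] by (simp add: left_diff_distrib)
  qed
  also have "\<dots> = sign_sum \<O> F M y v (upto_label \<O> (label u y)) - sign_sum (\<O>\<inverse>) F M y v (upto_label \<O> (label u y))"
    unfolding sum_subtractf sign_sum_if[OF v M]
    using sum_flip[OF flip, where h = "\<lambda>z. ?in z * monom_sign G \<O> F M z"] by simp
  finally show ?thesis .
qed

lemma lookup_cd_f_g:
  assumes "cd_degree M = n"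
  shows "Poly_Mapping.lookup (cd_f \<O> n u v L) M = sign_sum (\<O>\<inverse>) F M u v L \<and>
    Poly_Mapping.lookup (cd_f \<O> n u v L + nc_monom [VarC] * cd_g \<O> n u v L) M = sign_sum \<O> F M u v L"
  using assms
proof (induction n arbitrary: u L M)
  case 0
  have M: "M = []"
  proof (cases M)
    case (Cons x M')
    then show ?thesis using 0 by (cases x) auto
  qed simp
  have "{x \<in> paths_n G S 0 u v. label u (x ! 1) \<in> L} = (if edge u v \<and> label u v \<in> L then {[u, v]} else {})"
    by (auto simp: paths_0)
  then have "sign_sum P F M u v L = of_bool (edge u v \<and> label u v \<in> L)" for P
    unfolding M sign_sum_def by (simp add: monom_sign_def)
  moreover have "Poly_Mapping.lookup (cd_f \<O> 0 u v L) M = of_bool (edge u v \<and> label u v \<in> L)"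
    unfolding M by (simp add: lookup_one zero_list_def)
  ultimately show ?case by simp
next
  case (Suc n)
  have e: "edge u y" if "y \<in> {y. y \<in> succs u v \<and> label u y \<in> L}" for y
    using that by (simp add: succs_def)
  let ?U = "\<lambda>y. upto_label \<O> (label u y)"
  obtain x M' where M: "M = x # M'" using Suc.prems by (cases M) auto
  show ?case
  proof (cases x)
    case VarC
    then have d: "cd_degree M' = n" and pat: "cd_pattern M = Asc # cd_pattern M'"
      using Suc.prems M by simp_all
    have f: "Poly_Mapping.lookup (cd_f \<O> n y v L) M' = sign_sum (\<O>\<inverse>) F M' y v L" for y L
      using Suc.IH[OF d] by blast
    have fg: "Poly_Mapping.lookup (nc_monom [VarC] * cd_g \<O> n y v L) M' =
        sign_sum \<O> F M' y v L - sign_sum (\<O>\<inverse>) F M' y v L" for y L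
      using Suc.IH[OF d, of y L] by (simp add: lookup_add)
    have "sign_sum (\<O>\<inverse>) F M u v L = (\<Sum>y | y \<in> succs u v \<and> label u y \<in> L. sign_sum (\<O>\<inverse>) F M' y v (?U y))"
      unfolding sign_sum_Cons[OF v Suc.prems pat d]
      by (intro sum.cong HOL.refl sign_sum_Asc_converse[OF d e])
    moreover have "sign_sum \<O> F M u v L = (\<Sum>y | y \<in> succs u v \<and> label u y \<in> L.
        sign_sum \<O> F M' y v UNIV - sign_sum \<O> F M' y v (?U y))"
      unfolding sign_sum_Cons[OF v Suc.prems pat d] sign_sum_Asc[OF d] ..
    \<comment> \<open>The untruncated \<open>cd_f\<close> yields the sum of signs for the reverse
      order; \<open>sign_sum_UNIV\<close> identifies it with the sum for \<O>.\<close>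
    ultimately show ?thesis
      unfolding M VarC
      by (simp add: lookup_add lookup_sum lookup_minus lookup_nc_monom_mult_Cons f fg sign_sum_UNIV
          flip: sum.distrib)
  next
    case VarD
    then obtain n' where n: "n = Suc n'" using Suc.prems M by (cases n) auto
    define N where "N = VarC # M'"
    have d: "cd_degree N = n" and pat: "cd_pattern M = Des # cd_pattern N"
      using Suc.prems M VarD n by (simp_all add: N_def)
    have g: "Poly_Mapping.lookup (cd_g \<O> n y v L) M' = sign_sum \<O> F N y v L - sign_sum (\<O>\<inverse>) F N y v L" for y L
      using Suc.IH[OF d, of y L] by (simp add: lookup_add N_def lookup_nc_monom_mult_Cons)
    have "sign_sum (\<O>\<inverse>) F M u v L = (\<Sum>y | y \<in> succs u v \<and> label u y \<in> L.
        sign_sum \<O> F N y v (?U y) - sign_sum (\<O>\<inverse>) F N y v (?U y))"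
      unfolding sign_sum_Cons[OF v Suc.prems pat d]
      by (intro sum.cong HOL.refl sign_sum_Des_converse[OF d e])
    moreover have "sign_sum \<O> F M u v L = (\<Sum>y | y \<in> succs u v \<and> label u y \<in> L.
        sign_sum \<O> F N y v (?U y) - sign_sum (\<O>\<inverse>) F N y v (?U y))"
      unfolding sign_sum_Cons[OF v Suc.prems pat d] sign_sum_Des[OF d] ..
    ultimately show ?thesis
      unfolding M VarD
      by (simp add: lookup_add lookup_sum lookup_minus lookup_nc_monom_mult_Cons g)
  qed
qed

text \<open>
  Suppose that \<open>x\<close> violates the condition for the reverse order, at a last letter \<open>m\<close> of sign
  \<open>-1\<close>. By compatibility, flipping the tail of \<open>x\<close> from \<open>m - 1\<close> on gives a tail with product of
  signs \<open>-1\<close> in the original order, which violates the condition there.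
\<close>

lemma flip_condition_converse:
  assumes cond: "flip_condition G S \<O> F M u v"
  shows "flip_condition G S (\<O>\<inverse>) F M u v"
  unfolding flip_condition_def
proof (intro ballI impI, rule ccontr)
  fix x m
  assume x: "x \<in> paths_n G S (cd_degree M) u v" and m: "m \<in> {1..cd_degree M}"
    "monom_sign_at G (\<O>\<inverse>) F M m x = - 1"
    and "\<not> (\<exists>l\<in>{m<..cd_degree M}. monom_sign_at G (\<O>\<inverse>) F M l x = 0)"
  then have nz: "monom_sign_at G (\<O>\<inverse>) F M l x \<noteq> 0" if "l \<in> {m<..cd_degree M}" for l
    using that by blast
  have vals: "monom_sign_at G P F M l y \<in> {-1, 0, 1}" for P l y
    by (auto simp: monom_sign_at_def flip_sign_def Let_def split: ad.splits)
  define X where "X = {l \<in> {1..cd_degree M}. monom_sign_at G (\<O>\<inverse>) F M l x = - 1}"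
  \<comment> \<open>Positions are counted from 1, so the last sign -1 stands at
    \<open>Suc k\<close>, and it depends on the path from vertex \<open>k\<close> on.\<close>
  define k where "k = Max X - 1"
  have "finite X" "m \<in> X" using m by (auto simp: X_def)
  then have MaxX: "Max X \<in> X" "m \<le> Max X" "\<And>l. l \<in> X \<Longrightarrow> l \<le> Max X"
    using Max_in[of X] Max_ge[of X] by blast+
  then have k: "Suc k \<in> X" "k < cd_degree M" "m \<le> Suc k" by (auto simp: k_def X_def)
  have later: "monom_sign_at G (\<O>\<inverse>) F M l x = 1" if "l \<in> {Suc k<..cd_degree M}" for l
  proof -
    have "l \<notin> X" using MaxX(3)[of l] that k by (auto simp: k_def)
    then show ?thesis using vals[of "\<O>\<inverse>" l x] nz[of l] that k(3) by (auto simp: X_def)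
  qed
  have sk: "flip_sign G (\<O>\<inverse>) F (Suc k) (cd_pattern M ! k) x = - 1"
    using k(1) by (simp add: X_def monom_sign_at_def)
  \<comment> \<open>The value -1 occurs only for \<open>Des\<close>, so the pattern from here on is
    that of a monomial \<open>N\<close>, to which compatibility applies.\<close>
  then have "cd_pattern M ! k = Des"
    by (cases "cd_pattern M ! k") (auto simp: flip_sign_def Let_def split: if_splits)
  then obtain N where N: "cd_pattern N = drop k (cd_pattern M)"
    using cd_pattern_suffix[of k M] k(2) by (auto simp: length_cd_pattern)
  have dN: "cd_degree N = cd_degree M - k"
    using arg_cong[OF N, of length] by (simp add: length_cd_pattern)
  define y where "y = drop k x"
  have cut: "y \<in> paths_n G S (cd_degree N) (x ! k) v"
    "\<And>z. z \<in> paths_n G S (cd_degree N) (x ! k) v \<Longrightarrow> take k x @ z \<in> paths_n G S (cd_degree M) u v"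
    unfolding dN y_def using path_cut[OF x less_imp_le[OF k(2)]] by blast+
  have len: "length (take k x) = k" using path_length[OF x] k(2) by simp
  have shift: "flip_sign G P F (Suc l) (cd_pattern N ! l) z = monom_sign_at G P F M (Suc (k + l)) (take k x @ z)"
    if "l < cd_degree N" "z \<in> paths_n G S (cd_degree N) (x ! k) v" for P l z
    using flip_sign_append[of z "Suc l" P F "take k x" "cd_pattern N ! l"] path_nonempty[OF that(2)] that(1) dN k(2)
    unfolding len by (simp add: N monom_sign_at_def length_cd_pattern)
  have "monom_sign G (\<O>\<inverse>) F N y = - 1"
  proof -
    define d where "d = cd_degree N - 1"
    have d: "cd_degree N = Suc d" using dN k(2) by (simp add: d_def)
    have "monom_sign G (\<O>\<inverse>) F N y = (\<Prod>l<Suc d. monom_sign_at G (\<O>\<inverse>) F M (Suc (k + l)) x)"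
      unfolding monom_sign_pattern pattern_sign_def length_cd_pattern d
      using shift[OF _ cut(1)] d by (intro prod.cong) (simp_all add: y_def)
    also have "\<dots> = monom_sign_at G (\<O>\<inverse>) F M (Suc k) x *
        (\<Prod>l<d. monom_sign_at G (\<O>\<inverse>) F M (Suc (k + Suc l)) x)"
      by (simp add: prod.lessThan_Suc_shift del: prod.lessThan_Suc)
    also have "(\<Prod>l<d. monom_sign_at G (\<O>\<inverse>) F M (Suc (k + Suc l)) x) = 1"
      using dN d by (intro prod.neutral ballI later) auto
    finally show ?thesis using k(1) by (simp add: X_def)
  qed
  then have "monom_sign G \<O> F N (F (x ! k) v y) = - 1"
    using compatible_flip_sign[OF compat flip_path(1)[OF flip cut(1)]] flip_path(2)[OF flip cut(1)] by simp
  moreover define z where "z = F (x ! k) v y"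
  have z: "z \<in> paths_n G S (cd_degree N) (x ! k) v"
    unfolding z_def by (rule flip_path(1)[OF flip cut(1)])
  ultimately have prod: "(\<Prod>l<cd_degree N. monom_sign_at G \<O> F M (Suc (k + l)) (take k x @ z)) = - 1"
    unfolding z_def[symmetric] monom_sign_pattern pattern_sign_def length_cd_pattern
    using shift[OF _ z] by simp
  \<comment> \<open>A product equal to -1 has no factor 0 and some factor other than 1, hence a
    factor -1; the flip condition would put a 0 after it.\<close>
  have "\<exists>l<cd_degree N. monom_sign_at G \<O> F M (Suc (k + l)) (take k x @ z) \<noteq> 1"
  proof (rule ccontr)
    assume "\<not> ?thesis"
    then have "(\<Prod>l<cd_degree N. monom_sign_at G \<O> F M (Suc (k + l)) (take k x @ z)) = 1"
      by (intro prod.neutral) auto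
    with prod show False by simp
  qed
  then obtain l where l: "l < cd_degree N" "monom_sign_at G \<O> F M (Suc (k + l)) (take k x @ z) \<noteq> 1" by blast
  have nonzero: "monom_sign_at G \<O> F M (Suc (k + i)) (take k x @ z) \<noteq> 0" if "i < cd_degree N" for i
  proof
    assume "monom_sign_at G \<O> F M (Suc (k + i)) (take k x @ z) = 0"
    then have "(\<Prod>l<cd_degree N. monom_sign_at G \<O> F M (Suc (k + l)) (take k x @ z)) = 0"
      using that by (intro prod_zero) auto
    with prod show False by simp
  qed
  have "monom_sign_at G \<O> F M (Suc (k + l)) (take k x @ z) = - 1"
    using l nonzero[OF l(1)] vals[of \<O> "Suc (k + l)" "take k x @ z"] by auto
  moreover have "Suc (k + l) \<in> {1..cd_degree M}" using l(1) dN by simp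
  ultimately obtain j where j: "j \<in> {Suc (k + l)<..cd_degree M}" "monom_sign_at G \<O> F M j (take k x @ z) = 0"
    using cond cut(2)[OF z] unfolding flip_condition_def by blast
  have "j = Suc (k + (j - Suc k))" "j - Suc k < cd_degree N" using j(1) dN by auto
  then show False using nonzero[of "j - Suc k"] j(2) by simp
qed

end

section \<open>From sums of signs to cardinalities\<close>

lemma card_T_set:
  assumes v: "v \<in> carrier G" and cond: "flip_condition G S P F M u v"
  shows "int (card (T_set G S P F M u v \<inter> {x \<in> paths_n G S (cd_degree M) u v. label u (x ! 1) \<in> L})) =
    sign_sum P F M u v L"
proof -
  have vals: "monom_sign_at G P F M l y \<in> {-1, 0, 1}" for l y
    by (auto simp: monom_sign_at_def flip_sign_def Let_def split: ad.splits)
  have "monom_sign G P F M x = of_bool (x \<in> T_set G S P F M u v)"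
    if "x \<in> paths_n G S (cd_degree M) u v" for x
    using prod_sign_eq_of_bool[of "cd_degree M" "\<lambda>m. monom_sign_at G P F M m x", OF vals] cond that
    unfolding monom_sign_def flip_condition_def T_set_def by auto
  then have "sign_sum P F M u v L =
      (\<Sum>x | x \<in> paths_n G S (cd_degree M) u v \<and> label u (x ! 1) \<in> L. of_bool (x \<in> T_set G S P F M u v))"
    unfolding sign_sum_def by (intro sum.cong) auto
  also have "\<dots> = int (card (T_set G S P F M u v \<inter> {x \<in> paths_n G S (cd_degree M) u v. label u (x ! 1) \<in> L}))"
    using finite_paths[OF v] by (simp add: Int_def conj_ac)
  finally show ?thesis ..
qed

lemma paths_n_upto_eq:
  assumes "linear_order_on T \<O>" "t \<in> T"
  shows "paths_n_upto G S \<O> n u v t = {x \<in> paths_n G S n u v. label u (x ! 1) \<in> upto_label \<O> t}"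
proof -
  have "(label u (x ! 1), t) \<in> \<O> \<longleftrightarrow> label u (x ! 1) \<in> upto_label \<O> t" if "x \<in> paths_n G S n u v" for x
  proof -
    have r: "label u (x ! 1) \<in> T" using path_edge_0[OF that] by (rule label_reflection)
    show ?thesis
    proof (cases "label u (x ! 1) = t")
      case True
      moreover have "(t, t) \<in> \<O>"
        using assms unfolding linear_order_on_def partial_order_on_def preorder_on_def refl_on_def by blast
      ultimately show ?thesis by (simp add: upto_label_def strictly_below_def)
    next
      case False
      then show ?thesis
        using strictly_below_linear[OF assms(1) r assms(2)] by (auto simp: upto_label_def strictly_below_def)
    qed
  qed
  then show ?thesis by (auto simp: paths_n_upto_def label_def)
qed

end

theorem theorem5p1:
  fixes G :: "('a, 'b) monoid_scheme" and S :: "'a set" and \<O> :: "'a rel"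
    and u v t :: 'a and n :: nat
  assumes "coxeter_system G S"
    and "reflection_order G S \<O>"
    and "bruhat_less G S u v"
    and "t \<in> reflections G S"
  shows "\<exists>(f :: cd ncpoly) (g :: cd ncpoly).
    cd_homogeneous (int n) f \<and> cd_homogeneous (int n - 1) g \<and>
    phi_upto G S \<O> n u v t = nc_subst cd_value f + nc_monom [Asc] * nc_subst cd_value g \<and>
    (\<forall>(F :: 'a flip_family) (M :: cd list).
       is_flip G S \<O> F \<longrightarrow> compatible_flip G S \<O> F \<longrightarrow> cd_degree M = n \<longrightarrow>
       flip_condition G S \<O> F M u v \<longrightarrow>
         int (card (T_set G S (\<O>\<inverse>) F M u v \<inter> paths_n_upto G S \<O> n u v t))
           = Poly_Mapping.lookup f M \<and>
         int (card (T_set G S \<O> F M u v \<inter> paths_n_upto G S \<O> n u v t))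
           = Poly_Mapping.lookup (f + nc_monom [VarC] * g) M)"
proof -
  interpret group G
    using assms(1) by (simp add: coxeter_system_def)
  interpret coxeter G S
    using assms(1) by unfold_locales
  have ord: "cocycle_order \<O>"
    using assms(2) by (rule reflection_order_cocycle_order)
  then have lin: "linear_order_on T \<O>"
    by (simp add: cocycle_order_def)
  have u: "u \<in> carrier G" and v: "v \<in> carrier G"
    using tranclpD[of edge u v] tranclp.cases[of edge u v] assms(3)
    unfolding bruhat_less_def bruhat_edge_def by blast+
  note upto = paths_n_upto_eq[OF lin assms(4)]
  define L where "L = upto_label \<O> t"
  show ?thesis
  proof (intro exI conjI allI impI)
    show "cd_homogeneous (int n) (cd_f \<O> n u v L)" "cd_homogeneous (int n - 1) (cd_g \<O> n u v L)"
      by (rule cd_homogeneous_cd_f_g)+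
    show "phi_upto G S \<O> n u v t =
        nc_subst cd_value (cd_f \<O> n u v L) + nc_monom [Asc] * nc_subst cd_value (cd_g \<O> n u v L)"
      using phi_eq[OF ord v u] by (simp add: phi_upto_def phi_def upto L_def)
  next
    fix F :: "'a flip_family" and M :: "cd list"
    assume F: "is_flip G S \<O> F" "compatible_flip G S \<O> F" and M: "cd_degree M = n"
      and cond: "flip_condition G S \<O> F M u v"
    note lookup = lookup_cd_f_g[OF lin F v M]
    show "int (card (T_set G S (\<O>\<inverse>) F M u v \<inter> paths_n_upto G S \<O> n u v t)) =
        Poly_Mapping.lookup (cd_f \<O> n u v L) M"
      using card_T_set[OF v flip_condition_converse[OF lin F v cond]] lookup
      by (simp add: upto L_def M)
    show "int (card (T_set G S \<O> F M u v \<inter> paths_n_upto G S \<O> n u v t)) =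
        Poly_Mapping.lookup (cd_f \<O> n u v L + nc_monom [VarC] * cd_g \<O> n u v L) M"
      using card_T_set[OF v cond] lookup by (simp add: upto L_def M)
  qed
qed

end
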